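(* Let $q$ be a prime power and $M$ a positive integer such that one of the following holds: (i) $M=3$ and $q\equiv 7 \pmod{24}$; (ii) $M=7$ and $q\equiv 11$ or $51\pmod{56}$. Put $r=M(q^2-1)/2$. Then there exists a strongly regular Cayley graph on the additive group $(\mathbb{F}_{q^6},+)$ with negative Latin square type parameters $$(v,k,\lambda,\mu)=\bigl(q^6,\; r(q^3+1),\; -q^3+r^2+3r,\; r^2+r\bigr).$$
   Context: A strongly regular graph with parameters $(v,k,\lambda,\mu)$ is a simple undirected $k$-regular graph on $v$ vertices such that any two distinct adjacent vertices have exactly $\lambda$ common neighbours and any two distinct non-adjacent vertices have exactly $\mu$ common neighbours. It is of negative Latin square type if its parameters have the form $(n^2,\,r(n-\epsilon),\,\epsilon n+r^2-3\epsilon r,\,r^2-\epsilon r)$ with $\epsilon=-1$. For a finite abelian group $G$ (written additively) and a subset $D\subseteq G\setminus\{0\}$ with $D=-D$, the Cayley graph $\mathrm{Cay}(G,D)$ has vertex set $G$, with $x,y$ adjacent if and only if $x-y\in D$. A Cayley graph on $G$ is a graph of this form. *)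

theory Defs
  imports
    "HOL-Algebra.Ring"
    "HOL-Number_Theory.Prime_Powers"
    "HOL-Number_Theory.Cong"
    "Graph_Theory.Pair_Digraph"
begin

(* Finite simple undirected graphs are the pair_graph of Graph_Theory: every edge {x, y} is
   represented by the two arcs (x, y) and (y, x), and there are no loops. *)

definition neighbours :: "'a pair_pre_digraph \<Rightarrow> 'a \<Rightarrow> 'a set" where
  "neighbours \<Gamma> x = {y \<in> pverts \<Gamma>. (x, y) \<in> parcs \<Gamma>}"

(* The parameters are integers, so that expressions such as -n + r^2 + 3 r can be
   used without truncated subtraction. *)
definition strongly_regular :: "'a pair_pre_digraph \<Rightarrow> int \<times> int \<times> int \<times> int \<Rightarrow> bool" where
  "strongly_regular \<Gamma> = (\<lambda>(v, k, l, m).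
     pair_graph \<Gamma> \<and>
     int (card (pverts \<Gamma>)) = v \<and>
     (\<forall>x\<in>pverts \<Gamma>. int (card (neighbours \<Gamma> x)) = k) \<and>
     (\<forall>x\<in>pverts \<Gamma>. \<forall>y\<in>pverts \<Gamma>. x \<noteq> y \<and> (x, y) \<in> parcs \<Gamma> \<longrightarrow>
        int (card (neighbours \<Gamma> x \<inter> neighbours \<Gamma> y)) = l) \<and>
     (\<forall>x\<in>pverts \<Gamma>. \<forall>y\<in>pverts \<Gamma>. x \<noteq> y \<and> (x, y) \<notin> parcs \<Gamma> \<longrightarrow>
        int (card (neighbours \<Gamma> x \<inter> neighbours \<Gamma> y)) = m))"

definition latin_square_params :: "int \<Rightarrow> nat \<Rightarrow> nat \<Rightarrow> int \<times> int \<times> int \<times> int" where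
  "latin_square_params \<epsilon> n r =
     ((int n)\<^sup>2,
      int r * (int n - \<epsilon>),
      \<epsilon> * int n + (int r)\<^sup>2 - 3 * \<epsilon> * int r,
      (int r)\<^sup>2 - \<epsilon> * int r)"

definition negative_latin_square_type :: "int \<times> int \<times> int \<times> int \<Rightarrow> bool" where
  "negative_latin_square_type params \<longleftrightarrow> (\<exists>n r. params = latin_square_params (- 1) n r)"

(* The finite abelian group is the additive part of a HOL-Algebra ring record; the
   multiplicative part is not used. *)
definition cayley_graph :: "('a, 'm) ring_scheme \<Rightarrow> 'a set \<Rightarrow> 'a pair_pre_digraph" where
  "cayley_graph G D =
     \<lparr>pverts = carrier G,
      parcs = {(x, y). x \<in> carrier G \<and> y \<in> carrier G \<and> x \<ominus>\<^bsub>G\<^esub> y \<in> D}\<rparr>"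

definition cayley_graph_on :: "('a, 'm) ring_scheme \<Rightarrow> 'a pair_pre_digraph \<Rightarrow> bool" where
  "cayley_graph_on G \<Gamma> \<longleftrightarrow>
     abelian_group G \<and> finite (carrier G) \<and>
     (\<exists>D. D \<subseteq> carrier G - {\<zero>\<^bsub>G\<^esub>} \<and> (\<lambda>d. \<ominus>\<^bsub>G\<^esub> d) ` D = D \<and> \<Gamma> = cayley_graph G D)"

end

(* A negative Latin square type difference set arises when all nontrivial character values of a
   set of size r (q^3 + 1) lie in r + q^3 Z: Parseval's identity then forces each of them to be
   r or r - q^3.

   Write E for the subfield with q^3 elements, F for the one with q, N for the norm K -> E and Tr
   for the trace E -> F. The isotropic cone {x in E. Tr (x * x) = 0} splits into two half cones
   P and -P, where P = {v (x) v}, and {y^2, nu y^2 : N y in P} with nu a nonsquare of norm -1 is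
   half of the elliptic quadric Tr (N x) = 0 (a hemisystem). Its character values are
   (q^2 - 1)/2 - q^3 m with m an integer: the part of the sum that is even under P <-> -P is a
   quadric sum, and the odd part reduces, by a Salie type evaluation, to the Fourier transform of
   the signed cone in E, which is again a signed cone.

   If the sets c P, c in C, are pairwise disjoint, the corresponding images of the hemisystem are
   disjoint, and their union is the required set with r = |C| (q^2 - 1)/2. For C one takes 1, b, b^2
   with b^3 in F a noncube, or the seventh roots of unity. A point of P meeting c P would make
   6, respectively 2, a square in F. *)

theory Submission
  imports Defs "HOL-Algebra.Multiplicative_Group" Complex_Main
begin

section \<open>Finite subfields and Gauss sums\<close>

text \<open>Everything rests on q being 3 mod 4: then -1 is a nonsquare in \<open>F\<close> and in
  \<open>E\<close>, so a sign can replace the quadratic character, and the isotropic cone has two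
  halves to choose from. No sign of a Gauss sum is ever determined; only g^2 = -|S| is used. The
  unknown sign is harmless: the even part carries q^3 times 0 or 1, the odd part q^3 times an
  integer of the same parity, so together they give an even multiple of q^3, which survives halving.
  Lying in r + q^3 Z adds up over disjoint pieces, so one hemisystem is analysed and the multipliers
  only have to keep the pieces apart. The numbers 6 and 2 come from the fact that the trace form of
  two points of \<open>P\<close> is 2 t^2. If x = c y with x, y in \<open>P\<close>, the two
  isotropy conditions fix x y up to a factor in \<open>F\<close>. For the cubic multipliers x y =
  w^2 with w in \<open>F\<close>, so 3 w^2 = 2 t^2; for the seventh roots of unity, comparing trace
  and norm of x y leaves 2 as a square. The congruences on q supply the multipliers and make 6,
  respectively 2, a nonsquare.\<close>

lemma sum_two_to_one:
  fixes h :: "'c \<Rightarrow> complex"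
  assumes fin: "finite X"
    and inv: "\<And>x. x \<in> X \<Longrightarrow> \<sigma> x \<in> X"
    and ne: "\<And>x. x \<in> X \<Longrightarrow> \<sigma> x \<noteq> x"
    and fib: "\<And>x y. x \<in> X \<Longrightarrow> y \<in> X \<Longrightarrow> f x = f y \<longleftrightarrow> y = x \<or> y = \<sigma> x"
  shows "(\<Sum>x\<in>X. h (f x)) = 2 * (\<Sum>z\<in>f ` X. h z)"
proof -
  have "(\<Sum>z\<in>f ` X. \<Sum>x\<in>{x \<in> X. f x = z}. h (f x)) = (\<Sum>x\<in>X. h (f x))"
    by (rule sum.image_gen[symmetric, OF fin])
  moreover have "(\<Sum>x\<in>{x \<in> X. f x = z}. h (f x)) = 2 * h z" if z: "z \<in> f ` X" for z
  proof -
    obtain x where x: "x \<in> X" "z = f x" using z by blast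
    have "{y \<in> X. f y = z} = {x, \<sigma> x}"
      using x inv[of x] fib[of x] by (auto simp: eq_commute)
    moreover have "f (\<sigma> x) = f x"
      using fib[of x "\<sigma> x"] x inv by auto
    ultimately have "(\<Sum>x\<in>{x \<in> X. f x = z}. h (f x)) = (\<Sum>y\<in>{x, \<sigma> x}. h (f y))" by simp
    also have "\<dots> = h (f x) + h (f (\<sigma> x))" using ne[of x] x(1) by simp
    finally show ?thesis using x(2) \<open>f (\<sigma> x) = f x\<close> by simp
  qed
  ultimately have "(\<Sum>x\<in>X. h (f x)) = (\<Sum>z\<in>f ` X. 2 * h z)" by (metis (no_types, lifting) sum.cong)
  thus ?thesis by (simp add: sum_distrib_left)
qed

lemma card_two_to_one:
  assumes "finite X"
    and "\<And>x. x \<in> X \<Longrightarrow> \<sigma> x \<in> X"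
    and "\<And>x. x \<in> X \<Longrightarrow> \<sigma> x \<noteq> x"
    and "\<And>x y. x \<in> X \<Longrightarrow> y \<in> X \<Longrightarrow> f x = f y \<longleftrightarrow> y = x \<or> y = \<sigma> x"
  shows "card X = 2 * card (f ` X)"
proof -
  have "complex_of_nat (card X) = complex_of_nat (2 * card (f ` X))"
    using sum_two_to_one[OF assms, of "\<lambda>_. 1"] by simp
  thus ?thesis by (simp only: of_nat_eq_iff)
qed

text \<open>The unit \<open>e\<close> of the subfield is in general not the unit of the ambient ring, so \<open>x ^ 0 = 1\<close> need
  not lie in \<open>S\<close>. This allows a record-based field to be embedded into a type-class ring.\<close>

locale finite_subfield =
  fixes S :: "'b::comm_ring_1 set" and e :: 'b
  assumes finite [simp]: "finite S"
    and zero_mem [simp]: "0 \<in> S"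
    and add_mem [simp]: "x \<in> S \<Longrightarrow> y \<in> S \<Longrightarrow> x + y \<in> S"
    and neg_mem [simp]: "x \<in> S \<Longrightarrow> - x \<in> S"
    and mult_mem [simp]: "x \<in> S \<Longrightarrow> y \<in> S \<Longrightarrow> x * y \<in> S"
    and unit_mem [simp]: "e \<in> S"
    and unit_nz [simp]: "e \<noteq> 0"
    and unit [simp]: "x \<in> S \<Longrightarrow> e * x = x"
    and inv_ex: "x \<in> S \<Longrightarrow> x \<noteq> 0 \<Longrightarrow> \<exists>y\<in>S. x * y = e"
begin

lemma unit_right [simp]: "x \<in> S \<Longrightarrow> x * e = x"
  by (metis mult.commute unit)

lemma diff_mem [simp]: "x \<in> S \<Longrightarrow> y \<in> S \<Longrightarrow> x - y \<in> S"
  using add_mem[of x "- y"] by simp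

lemma power_mem: "x \<in> S \<Longrightarrow> 0 < n \<Longrightarrow> x ^ n \<in> S"
proof (induction n)
  case (Suc n)
  thus ?case by (cases n) auto
qed simp

lemma of_nat_mult_mem [simp]: "x \<in> S \<Longrightarrow> of_nat n * x \<in> S"
  by (induction n) (simp_all add: algebra_simps)

lemma numeral_mult_mem [simp]: "x \<in> S \<Longrightarrow> numeral n * x \<in> S"
  by (metis of_nat_mult_mem of_nat_numeral)

lemma mult_eq_0 [simp]:
  assumes "x \<in> S" "y \<in> S"
  shows "x * y = 0 \<longleftrightarrow> x = 0 \<or> y = 0"
proof -
  have "y = 0" if xy: "x * y = 0" "x \<noteq> 0"
  proof -
    obtain z where z: "z \<in> S" "x * z = e" using inv_ex[OF assms(1) xy(2)] by blast
    have "y = z * (x * y)" using z assms by (metis mult.assoc mult.commute unit)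
    thus ?thesis using xy by simp
  qed
  thus ?thesis by auto
qed

lemma mult_cancel:
  assumes "x \<in> S" "y \<in> S" "z \<in> S" "z \<noteq> 0"
  shows "z * x = z * y \<longleftrightarrow> x = y"
proof -
  have "z * x = z * y \<longleftrightarrow> z * (x - y) = 0" by (simp add: algebra_simps)
  thus ?thesis using assms by simp
qed

definition recip :: "'b \<Rightarrow> 'b" where "recip x = (SOME y. y \<in> S \<and> x * y = e)"

lemma recip_mem [simp]: "x \<in> S \<Longrightarrow> x \<noteq> 0 \<Longrightarrow> recip x \<in> S"
  and recip_right [simp]: "x \<in> S \<Longrightarrow> x \<noteq> 0 \<Longrightarrow> x * recip x = e"
  using someI_ex[of "\<lambda>y. y \<in> S \<and> x * y = e"] inv_ex[of x] unfolding recip_def by blast+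

lemma recip_nz [simp]: "x \<in> S \<Longrightarrow> x \<noteq> 0 \<Longrightarrow> recip x \<noteq> 0"
  using recip_right[of x] unit_nz by (metis mult_zero_right)

lemma div_mult [simp]: "x \<in> S \<Longrightarrow> x \<noteq> 0 \<Longrightarrow> y \<in> S \<Longrightarrow> x * (recip x * y) = y"
  by (metis recip_right mult.assoc unit)

lemma scale_bij: "c \<in> S \<Longrightarrow> c \<noteq> 0 \<Longrightarrow> bij_betw ((*) c) S S"
  by (rule bij_betwI[where g = "\<lambda>x. recip c * x"])
    (auto simp: mult.left_commute[of "recip c"])

lemma scale_bij_nz: "c \<in> S \<Longrightarrow> c \<noteq> 0 \<Longrightarrow> bij_betw ((*) c) (S - {0}) (S - {0})"
  by (rule bij_betwI[where g = "\<lambda>x. recip c * x"])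
    (auto simp: mult.left_commute[of "recip c"])

lemma translate_bij: "c \<in> S \<Longrightarrow> bij_betw ((+) c) S S"
  by (rule bij_betwI[where g = "\<lambda>x. x - c"]) auto

end

locale additive_character = finite_subfield S e for S :: "'b::comm_ring_1 set" and e +
  fixes \<psi> :: "'b \<Rightarrow> complex"
  assumes char_0 [simp]: "\<psi> 0 = 1"
    and char_add: "x \<in> S \<Longrightarrow> y \<in> S \<Longrightarrow> \<psi> (x + y) = \<psi> x * \<psi> y"
    and char_nontrivial: "\<exists>x\<in>S. \<psi> x \<noteq> 1"
begin

lemma sum_char:
  assumes "a \<in> S"
  shows "(\<Sum>x\<in>S. \<psi> (a * x)) = (if a = 0 then of_nat (card S) else 0)"
proof (cases "a = 0")
  case False
  have *: "(\<Sum>x\<in>S. \<psi> (a * x)) = (\<Sum>x\<in>S. \<psi> x)"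
    by (rule sum.reindex_bij_betw[OF scale_bij[OF assms False]])
  obtain y where y: "y \<in> S" "\<psi> y \<noteq> 1" using char_nontrivial by blast
  have "(\<Sum>x\<in>S. \<psi> x) = (\<Sum>x\<in>S. \<psi> (y + x))"
    by (rule sum.reindex_bij_betw[OF translate_bij[OF y(1)], symmetric])
  also have "\<dots> = \<psi> y * (\<Sum>x\<in>S. \<psi> x)"
    using y by (simp add: char_add sum_distrib_left)
  finally have "(\<Sum>x\<in>S. \<psi> x) = 0" using y by simp
  thus ?thesis using False * by simp
qed simp

lemma sum_char_neg:
  assumes "a \<in> S"
  shows "(\<Sum>x\<in>S. \<psi> (- (a * x))) = (if a = 0 then of_nat (card S) else 0)"
  using sum_char[of "- a"] assms by simp

end

text \<open>The assumptions describe a field whose order is 3 mod 4 without mentioning the order: -1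
  is a nonsquare and every element is plus or minus a square. Negation thus does the work of
  multiplication by a nonsquare, and no quadratic character has to be defined.\<close>

locale gauss_field = additive_character S e \<psi> for S :: "'b::comm_ring_1 set" and e \<psi> +
  assumes two_nz: "x \<in> S \<Longrightarrow> x + x = 0 \<Longrightarrow> x = 0"
    and minus_unit_nonsquare: "x \<in> S \<Longrightarrow> x * x \<noteq> - e"
    and square_or_neg: "x \<in> S \<Longrightarrow> \<exists>t\<in>S. x = t * t \<or> x = - (t * t)"
begin

lemma two_mult [simp]: "x \<in> S \<Longrightarrow> 2 * x = 0 \<longleftrightarrow> x = 0"
  using two_nz[of x] by (metis mult_2 mult_zero_right)

lemma four_mult [simp]: "x \<in> S \<Longrightarrow> 4 * x = 0 \<longleftrightarrow> x = 0"
proof -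
  assume x: "x \<in> S"
  have "4 * x = 2 * (2 * x)" by simp
  thus ?thesis using x two_mult[of x] two_mult[of "2 * x"] by (metis numeral_mult_mem)
qed

lemma neg_neq [simp]: "x \<in> S \<Longrightarrow> x \<noteq> 0 \<Longrightarrow> - x \<noteq> x"
  using two_nz[of x] neg_eq_iff_add_eq_0[of x x] by blast

lemma square_eq_neg_square:
  assumes "s \<in> S" "t \<in> S" "s * s = - (t * t)"
  shows "s = 0 \<and> t = 0"
proof -
  have "t = 0"
  proof (rule ccontr)
    assume "t \<noteq> 0"
    have "(s * recip t) * (s * recip t) = (s * s) * (recip t * recip t)" by (simp add: algebra_simps)
    also have "\<dots> = - ((t * recip t) * (t * recip t))" using assms by (simp add: algebra_simps)
    also have "\<dots> = - e" using \<open>t \<noteq> 0\<close> assms by simp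
    finally show False using minus_unit_nonsquare[of "s * recip t"] \<open>t \<noteq> 0\<close> assms by simp
  qed
  thus ?thesis using assms by simp
qed

lemma square_eq_square:
  assumes "s \<in> S" "t \<in> S"
  shows "s * s = t * t \<longleftrightarrow> t = s \<or> t = - s"
proof -
  have "s * s = t * t \<longleftrightarrow> (t - s) * (t + s) = 0" by (auto simp: algebra_simps)
  also have "\<dots> \<longleftrightarrow> t = s \<or> t = - s" using assms by (simp add: eq_neg_iff_add_eq_0)
  finally show ?thesis .
qed

text \<open>For nonzero \<open>x\<close> exactly one of \<open>x\<close> and \<open>- x\<close> is a
  square, and it has two roots; for \<open>x = 0\<close> each set contributes the root 0. The count
  is uniform in \<open>x\<close>, so later sums need no case distinction.\<close>

lemma card_square_roots:
  assumes x: "x \<in> S"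
  shows "card {t \<in> S. t * t = x} + card {t \<in> S. - (t * t) = x} = 2"
proof (cases "x = 0")
  case True
  hence "{t \<in> S. t * t = x} = {0}" "{t \<in> S. - (t * t) = x} = {0}" by auto
  thus ?thesis by simp
next
  case False
  obtain w where w: "w \<in> S" "x = w * w \<or> x = - (w * w)" using square_or_neg[OF x] by blast
  have w0: "w \<noteq> 0" using w False by auto
  have "t * t = w * w \<longleftrightarrow> t = w \<or> t = - w" if "t \<in> S" for t
    using square_eq_square[OF w(1) that] by (simp add: eq_commute[of "t * t"])
  hence eq: "{t \<in> S. t * t = w * w} = {w, - w}" using w(1) neg_mem[OF w(1)] by blast
  have c: "card {w, - w} = 2" using neg_neq[OF w(1) w0, THEN not_sym] by simp
  from w(2) show ?thesis
  proof
    assume h: "x = w * w"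
    have False if "t \<in> S" "- (t * t) = x" for t
      using square_eq_neg_square[OF w(1) that(1)] that(2) h w0 by simp
    hence "{t \<in> S. - (t * t) = x} = {}" by blast
    thus ?thesis using h eq c by simp
  next
    assume h: "x = - (w * w)"
    have "{t \<in> S. t * t = x} = {}" using square_eq_neg_square[of _ w] w w0 h by auto
    moreover have "{t \<in> S. - (t * t) = x} = {w, - w}" using h eq by simp
    ultimately show ?thesis using c by simp
  qed
qed

lemma sum_squares_and_negatives:
  fixes h :: "'b \<Rightarrow> complex"
  shows "(\<Sum>t\<in>S. h (t * t)) + (\<Sum>t\<in>S. h (- (t * t))) = 2 * (\<Sum>x\<in>S. h x)"
proof -
  have "(\<Sum>t\<in>S. h (g t)) = (\<Sum>x\<in>S. of_nat (card {t \<in> S. g t = x}) * h x)"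
    if "\<And>t. t \<in> S \<Longrightarrow> g t \<in> S" for g
  proof -
    have "(\<Sum>t\<in>S. h (g t)) = (\<Sum>x\<in>S. \<Sum>t\<in>{t \<in> S. g t = x}. h (g t))"
      using that by (intro sum.group[symmetric]) auto
    thus ?thesis by simp
  qed
  note this[of "\<lambda>t. t * t"] this[of "\<lambda>t. - (t * t)"]
  hence "(\<Sum>t\<in>S. h (t * t)) + (\<Sum>t\<in>S. h (- (t * t))) =
    (\<Sum>x\<in>S. of_nat (card {t \<in> S. t * t = x} + card {t \<in> S. - (t * t) = x}) * h x)"
    by (simp add: sum.distrib ring_distribs)
  also have "\<dots> = (\<Sum>x\<in>S. 2 * h x)" by (rule sum.cong) (simp_all add: card_square_roots)
  finally show ?thesis by (simp add: sum_distrib_left)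
qed

definition gauss :: "'b \<Rightarrow> complex" where "gauss c = (\<Sum>t\<in>S. \<psi> (c * (t * t)))"

lemma gauss_0: "gauss 0 = of_nat (card S)"
  by (simp add: gauss_def)

text \<open>The values at \<open>c\<close> and \<open>- c\<close> add up to twice a full character
  sum, which vanishes.\<close>

lemma gauss_neg: "c \<in> S \<Longrightarrow> c \<noteq> 0 \<Longrightarrow> gauss (- c) = - gauss c"
  using sum_squares_and_negatives[of "\<lambda>x. \<psi> (c * x)"] sum_char[of c]
  by (simp add: gauss_def add_eq_0_iff)

lemma gauss_mult_square:
  assumes "c \<in> S" "t \<in> S" "t \<noteq> 0"
  shows "gauss (c * (t * t)) = gauss c"
proof -
  have "gauss c = (\<Sum>s\<in>S. \<psi> (c * ((t * s) * (t * s))))"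
    unfolding gauss_def by (rule sum.reindex_bij_betw[OF scale_bij[OF assms(2,3)], symmetric])
  thus ?thesis by (simp add: gauss_def algebra_simps)
qed

lemma gauss_cases: "c \<in> S \<Longrightarrow> c \<noteq> 0 \<Longrightarrow> gauss c = gauss e \<or> gauss c = - gauss e"
proof -
  assume c: "c \<in> S" "c \<noteq> 0"
  obtain t where t: "t \<in> S" "c = t * t \<or> c = - (t * t)" using square_or_neg c by blast
  have "gauss (t * t) = gauss e" using gauss_mult_square[of e t] t c by auto
  thus ?thesis using t c gauss_neg[of "t * t"] by auto
qed

text \<open>The map (s, t) -> (s + t, s - t) is invertible because 2 is; \<open>i\<close> is one
  half. It turns s^2 - t^2 into a product.\<close>

lemma sum_rotate:
  fixes h :: "'b \<Rightarrow> 'b \<Rightarrow> complex"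
  shows "(\<Sum>s\<in>S. \<Sum>t\<in>S. h (s + t) (s - t)) = (\<Sum>u\<in>S. \<Sum>v\<in>S. h u v)"
proof -
  define i where "i = recip (2 * e)"
  have i: "i \<in> S" "i \<noteq> 0" "2 * i = e" "\<And>x. x \<in> S \<Longrightarrow> 2 * (i * x) = x"
  proof -
    show *: "i \<in> S" "i \<noteq> 0" unfolding i_def by simp_all
    show "2 * i = e" using recip_right[of "2 * e"] * by (simp add: i_def mult.assoc)
    thus "2 * (i * x) = x" if "x \<in> S" for x using that by (metis mult.assoc unit)
  qed
  have "bij_betw (\<lambda>(s, t). (s + t, s - t)) (S \<times> S) (S \<times> S)"
  proof (rule bij_betwI[where g = "\<lambda>(u, v). (i * (u + v), i * (u - v))"])
    fix x assume "x \<in> S \<times> S"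
    then obtain s t where x: "x = (s, t)" "s \<in> S" "t \<in> S" by auto
    have "i * (s + t + (s - t)) = 2 * (i * s)" "i * (s + t - (s - t)) = 2 * (i * t)"
      by (simp_all add: algebra_simps)
    thus "(case (case x of (s, t) \<Rightarrow> (s + t, s - t)) of (u, v) \<Rightarrow> (i * (u + v), i * (u - v))) = x"
      using x i(4) by simp
    have "i * (s + t) + i * (s - t) = 2 * (i * s)" "i * (s + t) - i * (s - t) = 2 * (i * t)"
      by (simp_all add: algebra_simps)
    thus "(case (case x of (u, v) \<Rightarrow> (i * (u + v), i * (u - v))) of (s, t) \<Rightarrow> (s + t, s - t)) = x"
      using x i(4) by simp
  qed (use i in auto)
  from sum.reindex_bij_betw[OF this, of "\<lambda>(u, v). h u v"]
  show ?thesis by (simp add: sum.cartesian_product case_prod_unfold)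
qed

lemma sum_char_product: "(\<Sum>u\<in>S. \<Sum>v\<in>S. \<psi> (u * v)) = of_nat (card S)"
  by (simp add: sum_char)

text \<open>Multiplying by \<open>gauss (- e)\<close> instead gives the hyperbolic form s^2 - t^2 =
  u v, whose sum is elementary; \<open>gauss_neg\<close> then supplies the minus sign.\<close>

lemma gauss_square: "gauss e * gauss e = - of_nat (card S)"
proof -
  have "gauss e * gauss (- e) = (\<Sum>s\<in>S. \<Sum>t\<in>S. \<psi> ((s + t) * (s - t)))"
    unfolding gauss_def sum_product
    by (intro sum.cong refl, subst char_add[symmetric]) (auto simp: algebra_simps)
  also have "\<dots> = of_nat (card S)"
    by (subst sum_rotate[of "\<lambda>u v. \<psi> (u * v)"]) (rule sum_char_product)
  finally show ?thesis using gauss_neg[of e] by (simp add: minus_equation_iff)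
qed

text \<open>The circle and the hyperbola together meet every vertical line in exactly two points.\<close>

lemma circle_plus_hyperbola:
  fixes h :: "'b \<Rightarrow> complex"
  assumes "a \<in> S"
  shows "(\<Sum>(s, t)\<in>{(s, t) \<in> S \<times> S. s * s + t * t = a}. h s) +
         (\<Sum>(s, t)\<in>{(s, t) \<in> S \<times> S. s * s - t * t = a}. h s) = 2 * (\<Sum>s\<in>S. h s)"
proof -
  have *: "(\<Sum>(s, t)\<in>{(s, t) \<in> S \<times> S. s * s + g t = a}. h s) =
      (\<Sum>s\<in>S. of_nat (card {t \<in> S. g t = a - s * s}) * h s)" for g
  proof -
    have "{(s, t) \<in> S \<times> S. s * s + g t = a} = Sigma S (\<lambda>s. {t \<in> S. g t = a - s * s})"
      by (auto simp: algebra_simps)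
    hence "(\<Sum>(s, t)\<in>{(s, t) \<in> S \<times> S. s * s + g t = a}. h s) =
        (\<Sum>s\<in>S. \<Sum>t\<in>{t \<in> S. g t = a - s * s}. h s)"
      by (simp only:) (rule sum.Sigma[symmetric], simp_all)
    thus ?thesis by simp
  qed
  note *[of "\<lambda>t. t * t"] *[of "\<lambda>t. - (t * t)"]
  hence "(\<Sum>(s, t)\<in>{(s, t) \<in> S \<times> S. s * s + t * t = a}. h s) +
         (\<Sum>(s, t)\<in>{(s, t) \<in> S \<times> S. s * s - t * t = a}. h s) =
    (\<Sum>s\<in>S. of_nat (card {t \<in> S. t * t = a - s * s} + card {t \<in> S. - (t * t) = a - s * s}) * h s)"
    by (simp add: sum.distrib ring_distribs)
  also have "\<dots> = (\<Sum>s\<in>S. 2 * h s)"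
    by (rule sum.cong) (simp_all add: card_square_roots assms)
  finally show ?thesis by (simp add: sum_distrib_left)
qed

end

section \<open>Existence of a nontrivial character; squares in fields of order 3 mod 4\<close>

context finite_subfield
begin

lemma power_card:
  assumes x: "x \<in> S" "x \<noteq> 0"
  shows "x ^ (card S - 1) = e"
proof -
  have fin: "finite (S - {0})" by simp
  have c: "card (S - {0}) = card S - 1" by simp
  have pos: "0 < card S - 1" using card_gt_0_iff[of "S - {0}"] c fin unit_mem unit_nz
    by (metis DiffI empty_iff singletonD)
  have "\<Prod>A \<in> S \<and> \<Prod>A \<noteq> 0" if "A \<subseteq> S - {0}" "A \<noteq> {}" "finite A" for A
    using that(3,2,1) by (induction A rule: finite_ne_induct) auto
  from this[of "S - {0}"] have P: "\<Prod>(S - {0}) \<in> S" "\<Prod>(S - {0}) \<noteq> 0"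
    using unit_mem unit_nz fin by blast+
  have "\<Prod>(S - {0}) = (\<Prod>y\<in>S - {0}. x * y)"
    by (rule prod.reindex_bij_betw[OF scale_bij_nz[OF x], symmetric])
  also have "\<dots> = x ^ (card S - 1) * \<Prod>(S - {0})" by (simp add: prod.distrib)
  finally have "\<Prod>(S - {0}) * e = \<Prod>(S - {0}) * x ^ (card S - 1)"
    using P by (simp add: mult.commute)
  thus ?thesis using mult_cancel[OF unit_mem power_mem[OF x(1) pos] P] by simp
qed

lemma e_power [simp]: "0 < k \<Longrightarrow> e ^ k = e"
  by (induction k) (auto simp: power_mem, metis power_0 mult_1_right neq0_conv unit unit_mem)

text \<open>Let \<open>H\<close> be a largest additively closed set that avoids \<open>e\<close>.
  Maximality makes every element congruent to a multiple of \<open>e\<close> modulo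
  \<open>H\<close>, so S / H is cyclic of order p, generated by the class of \<open>e\<close>;
  sending this class to a primitive p-th root of unity gives the character. Neither bases nor
  quotient groups are involved.\<close>

lemma exists_character:
  assumes p: "prime p" and p0: "of_nat p * e = 0"
  shows "\<exists>\<psi>. additive_character S e \<psi>"
proof -
  have p0': "of_nat p * x = 0" if "x \<in> S" for x
    using p0 that by (metis mult.assoc mult_zero_left unit)
  have modp: "of_nat (k mod p) * x = of_nat k * x" if "x \<in> S" for k x
  proof -
    have "of_nat k * x = of_nat (k div p * p + k mod p) * x" by simp
    also have "\<dots> = of_nat (k div p) * (of_nat p * x) + of_nat (k mod p) * x"
      by (simp only: of_nat_add of_nat_mult ring_distribs mult.assoc)
    finally show ?thesis using p0'[OF that] by simp
  qed
  define good where "good H \<longleftrightarrow> H \<subseteq> S \<and> 0 \<in> H \<and> (\<forall>x\<in>H. \<forall>y\<in>H. x + y \<in> H) \<and> e \<notin> H" for H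
  have "good {0}" by (auto simp: good_def)
  moreover have "\<forall>H. good H \<longrightarrow> card H < card S + 1"
    by (auto simp: good_def less_Suc_eq_le intro: card_mono)
  ultimately obtain H where H: "good H" and max: "\<And>H'. good H' \<Longrightarrow> card H' \<le> card H"
    using ex_has_greatest_nat[of good "{0}" card] by blast
  have HS: "x \<in> H \<Longrightarrow> x \<in> S" and H0: "0 \<in> H" and He: "e \<notin> H"
    and Hadd: "x \<in> H \<Longrightarrow> y \<in> H \<Longrightarrow> x + y \<in> H" for x y
    using H by (auto simp: good_def)
  have Hnat: "of_nat k * x \<in> H" if "x \<in> H" for k x
    using that by (induction k) (auto simp: H0 Hadd algebra_simps)
  \<comment> \<open>Closure under addition suffices for a subgroup: in characteristic p, negation is
    a (p - 1)-fold sum.\<close>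
  have Hneg: "- x \<in> H" if "x \<in> H" for x
  proof -
    have "x + of_nat (p - 1) * x = of_nat (p - 1 + 1) * x"
      by (simp only: of_nat_add of_nat_1 ring_distribs mult_1 add.commute)
    also have "\<dots> = 0" using p0'[OF HS[OF that]] prime_gt_0_nat[OF p] by simp
    finally have "- x = of_nat (p - 1) * x" by (simp add: minus_unique)
    thus ?thesis using Hnat[OF that] by simp
  qed
  have ex: "\<exists>j. x - of_nat j * e \<in> H" if x: "x \<in> S" for x
  proof (cases "x \<in> H")
    case True
    thus ?thesis by (intro exI[of _ 0]) simp
  next
    case False
    \<comment> \<open>\<open>H'\<close> is generated by \<open>H\<close> and \<open>x\<close>. By
      maximality it contains \<open>e\<close>, and the coefficient of \<open>x\<close> in such a
      representation is invertible modulo p, so that it can be solved for \<open>x\<close>.\<close>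
    define H' where "H' = {h + of_nat n * x | h n. h \<in> H}"
    have "h \<in> H'" if "h \<in> H" for h
    proof -
      have "h = h + of_nat 0 * x" by simp
      thus ?thesis unfolding H'_def using that by blast
    qed
    hence sub: "H \<subseteq> H'" by blast
    have "x = 0 + of_nat 1 * x" by simp
    hence xH': "x \<in> H'" unfolding H'_def using H0 by blast
    have H'S: "H' \<subseteq> S" unfolding H'_def using x HS by auto
    have add': "u + v \<in> H'" if uv: "u \<in> H'" "v \<in> H'" for u v
    proof -
      obtain h n h' n' where h: "u = h + of_nat n * x" "v = h' + of_nat n' * x" "h \<in> H" "h' \<in> H"
        using uv unfolding H'_def by blast
      have "u + v = (h + h') + of_nat (n + n') * x" unfolding h by (simp add: algebra_simps)
      thus ?thesis unfolding H'_def using Hadd h by blast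
    qed
    have "card H < card H'"
      using sub xH' False by (intro psubset_card_mono finite_subset[OF H'S]) auto
    hence "\<not> good H'" using max[of H'] by auto
    hence "e \<in> H'" using H'S sub H0 add' by (auto simp: good_def)
    then obtain h n where hn: "h \<in> H" "e = h + of_nat n * x" unfolding H'_def by blast
    have "\<not> p dvd n"
    proof
      assume "p dvd n"
      hence "of_nat n * x = 0" using modp[OF x, of n] by simp
      thus False using hn He by simp
    qed
    hence "coprime n p" using p prime_imp_coprime[of p n] by (simp add: coprime_commute)
    then obtain m where m: "[n * m = 1] (mod p)" using cong_solve_coprime_nat[of n p] by auto
    have "of_nat m * e = of_nat m * h + of_nat (n * m) * x"
      using hn(2) by (simp add: algebra_simps)
    also have "of_nat (n * m) * x = of_nat ((n * m) mod p) * x" using modp[OF x] by simp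
    also have "\<dots> = of_nat (1 mod p) * x" by (simp only: m[unfolded Cong.cong_def])
    also have "\<dots> = x" using prime_gt_1_nat[OF p] by simp
    finally have "x - of_nat m * e = - (of_nat m * h)" by simp
    thus ?thesis using Hneg Hnat hn(1) by metis
  qed
  \<comment> \<open>The index is an arbitrary choice, determined only modulo p; \<open>zeq\<close>
    below shows that the power of \<open>z\<close> does not depend on it.\<close>
  define idx where "idx x = (SOME j. x - of_nat j * e \<in> H)" for x
  have idx: "x - of_nat (idx x) * e \<in> H" if "x \<in> S" for x
    unfolding idx_def using someI_ex[OF ex[OF that]] .
  define z where "z = cis (2 * pi / p)"
  have zp: "z ^ p = 1" using prime_gt_0_nat[OF p] by (simp add: z_def DeMoivre)
  have z1: "z \<noteq> 1"
  proof
    assume "z = 1"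
    moreover have "p > 0" using prime_gt_0_nat[OF p] .
    hence "inj_on (\<lambda>k. cis (2 * pi * k / p)) {..<p}"
      using bij_betw_roots_unity[of p] by (simp add: bij_betw_def)
    ultimately have "(0::nat) = 1" if "p > 1" using inj_onD[of "\<lambda>k. cis (2 * pi * k / p)" "{..<p}" "0::nat" 1] that
      by (simp add: z_def)
    thus False using prime_gt_1_nat[OF p] by simp
  qed
  have zmod: "z ^ (k mod p) = z ^ k" for k
  proof -
    have "z ^ k = z ^ (p * (k div p) + k mod p)" by simp
    also have "\<dots> = z ^ (k mod p)" by (simp only: power_add power_mult zp) simp
    finally show ?thesis by simp
  qed
  have cong: "[i = j] (mod p)" if ij: "of_nat i * e - of_nat j * e \<in> H" for i j
  proof (rule ccontr)
    assume nc: "\<not> [i = j] (mod p)"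
    \<comment> \<open>A natural number that represents i - j modulo p.\<close>
    define n where "n = i + (p - 1) * j"
    have pj: "i + p * j = n + j" unfolding n_def using prime_gt_0_nat[OF p]
      by (cases p) auto
    have "\<not> p dvd n"
    proof
      assume "p dvd n"
      hence "[n + j = 0 + j] (mod p)" by (intro cong_add) (simp_all add: Cong.cong_0_iff)
      moreover have "[i + p * j = i + 0] (mod p)" by (intro cong_add) (simp_all add: Cong.cong_0_iff)
      ultimately show False using nc pj by (metis add.right_neutral add_0 cong_sym cong_trans)
    qed
    hence "coprime n p" using p prime_imp_coprime[of p n] by (simp add: coprime_commute)
    then obtain m where m: "[n * m = 1] (mod p)" using cong_solve_coprime_nat[of n p] by auto
    have "of_nat n * e + of_nat j * e = of_nat (i + p * j) * e"
      unfolding pj by (simp add: algebra_simps)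
    also have "\<dots> = of_nat i * e + of_nat j * (of_nat p * e)" by (simp add: algebra_simps)
    also have "\<dots> = of_nat i * e" using p0 by simp
    finally have "of_nat n * e = of_nat i * e - of_nat j * e" by (simp add: eq_diff_eq)
    hence "of_nat n * e \<in> H" using ij by simp
    hence "of_nat m * (of_nat n * e) \<in> H" by (rule Hnat)
    moreover have "of_nat m * (of_nat n * e) = of_nat ((n * m) mod p) * e"
      by (subst modp) (simp_all add: algebra_simps)
    moreover have "(n * m) mod p = 1" using m[unfolded Cong.cong_def] prime_gt_1_nat[OF p] by simp
    ultimately show False using He by simp
  qed
  have zeq: "z ^ i = z ^ j" if "of_nat i * e - of_nat j * e \<in> H" for i j
    using cong[OF that] zmod[of i] zmod[of j] by (simp add: Cong.cong_def)
  show ?thesis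
  proof (intro exI[of _ "\<lambda>x. z ^ idx x"], unfold_locales)
    have "of_nat (idx 0) * e - of_nat 0 * e \<in> H" using Hneg[OF idx[of 0]] by simp
    thus "z ^ idx 0 = 1" using zeq[of "idx 0" 0] by simp
  next
    fix x y assume xy: "x \<in> S" "y \<in> S"
    have "(x - of_nat (idx x) * e) + (y - of_nat (idx y) * e) + - (x + y - of_nat (idx (x + y)) * e) \<in> H"
      using xy by (intro Hadd Hneg idx) auto
    hence "of_nat (idx (x + y)) * e - of_nat (idx x + idx y) * e \<in> H"
      by (simp add: algebra_simps)
    thus "z ^ idx (x + y) = z ^ idx x * z ^ idx y" by (metis zeq power_add)
  next
    have "of_nat 1 * e - of_nat (idx e) * e \<in> H" using idx[of e] by simp
    hence "z ^ 1 = z ^ idx e" by (rule zeq)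
    thus "\<exists>x\<in>S. z ^ idx x \<noteq> 1" using z1 by (intro bexI[of _ e]) auto
  qed
qed

text \<open>The exponent 4 k + 3 is the order of the field. If x^2 = -e, then x^(4 k + 3) = (-e)^(2
  k + 1) x = -x, against the assumed x^(4 k + 3) = x.\<close>

lemma minus_unit_nonsquare_if_power:
  assumes two: "\<And>x. x \<in> S \<Longrightarrow> x + x = 0 \<Longrightarrow> x = 0"
    and pow: "\<And>x. x \<in> S \<Longrightarrow> x ^ (4 * k + 3) = x" and x: "x \<in> S"
  shows "x * x \<noteq> - e"
proof
  assume h: "x * x = - e"
  have "4 * k + 3 = 2 * (2 * k + 1) + 1" by simp
  hence "x ^ (4 * k + 3) = (x * x) ^ (2 * k + 1) * x"
    by (simp only: power_add power_mult power2_eq_square power_one_right)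
  also have "(x * x) ^ (2 * k + 1) = - e"
    unfolding h using e_power[of "2 * k + 1"] by (subst power_minus_odd) simp_all
  finally have "x = - x" using pow[OF x] x by simp
  hence "x = 0" using two[OF x] by (simp add: eq_neg_iff_add_eq_0)
  thus False using h by simp
qed

text \<open>The root is x^(k + 1): its fourth power is x^(4 k + 4) = x^2, so its square is
  \<open>x\<close> or \<open>- x\<close>.\<close>

lemma square_or_neg_if_power:
  assumes pow: "\<And>x. x \<in> S \<Longrightarrow> x ^ (4 * k + 3) = x" and x: "x \<in> S"
  shows "\<exists>t\<in>S. x = t * t \<or> x = - (t * t)"
proof -
  define t where "t = x ^ (k + 1)"
  have t: "t \<in> S" unfolding t_def using x by (intro power_mem) auto
  have "t * t * (t * t) = x ^ ((k + 1) + (k + 1) + ((k + 1) + (k + 1)))"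
    by (simp only: t_def power_add)
  also have "(k + 1) + (k + 1) + ((k + 1) + (k + 1)) = 4 * k + 3 + 1" by simp
  also have "x ^ \<dots> = x * x" using pow[OF x] by (simp only: power_add power_one_right)
  finally have "(x - t * t) * (x + t * t) = 0" by (simp add: algebra_simps)
  thus ?thesis using t x by (auto simp: eq_neg_iff_add_eq_0)
qed

end

section \<open>The tower of fields with q, q^3 and q^6 elements\<close>

text \<open>The factor \<open>e\<close> in the generator condition covers the exponent 0, since
  \<open>\<omega> ^ 0\<close> is the ambient 1, which need not lie in \<open>K\<close>.\<close>

locale field_tower = K: finite_subfield K e for K :: "'b::comm_ring_1 set" and e +
  fixes p f q :: nat and \<omega> :: 'b
  assumes prime_p: "prime p" and q_def: "q = p ^ f" and q_mod_4: "q mod 4 = 3"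
    and card_K: "card K = q ^ 6"
    and omega_mem [simp]: "\<omega> \<in> K"
    and omega_gen: "x \<in> K \<Longrightarrow> x \<noteq> 0 \<Longrightarrow> \<exists>i. x = e * \<omega> ^ i"
begin

lemma q_ge_3: "q \<ge> 3" using q_mod_4 by (metis mod_less_eq_dividend)

lemma q_pos [simp]: "0 < q" using q_ge_3 by simp

lemma odd_p: "odd p"
proof -
  have "odd q" using q_mod_4 by presburger
  thus ?thesis using q_mod_4 by (cases "f = 0") (auto simp: q_def)
qed

text \<open>Translation by \<open>e\<close> does not change the sum of all elements, so |K| e = 0.
  As |K| is a power of p and there are no zero divisors, p e = 0 already.\<close>

lemma p_mult [simp]: "x \<in> K \<Longrightarrow> of_nat p * x = 0"
proof -
  have "(\<Sum>x\<in>K. x) = (\<Sum>x\<in>K. e + x)"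
    by (rule sum.reindex_bij_betw[OF K.translate_bij, symmetric]) simp
  hence "of_nat (q ^ 6) * e = 0" by (simp add: sum.distrib card_K)
  hence "of_nat p ^ (f * 6) * e = 0" by (simp add: q_def power_mult)
  moreover have "of_nat p * e = 0" if "of_nat p ^ k * e = 0" for k
    using that
  proof (induction k)
    case (Suc k)
    have "(of_nat p * e) * (of_nat (p ^ k) * e) = of_nat p ^ Suc k * (e * e)"
      by (simp only: power_Suc of_nat_power mult_ac)
    also have "\<dots> = 0" using Suc.prems by simp
    finally have "of_nat p * e = 0 \<or> of_nat (p ^ k) * e = 0"
      by (subst (asm) K.mult_eq_0) (simp_all del: of_nat_power)
    thus ?case using Suc.IH by auto
  qed simp
  ultimately have "of_nat p * e = 0" by blast
  thus "x \<in> K \<Longrightarrow> of_nat p * x = 0"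
    by (metis K.unit mult.assoc mult_zero_left)
qed

lemma two_nz: 
  assumes "x \<in> K" "x + x = 0"
  shows "x = 0"
proof -
  obtain k where k: "p = 2 * k + 1" using odd_p by (elim oddE)
  have "of_nat p * x = of_nat k * (x + x) + x" by (simp add: k algebra_simps)
  thus ?thesis using assms by simp
qed

lemma frobenius_p:
  assumes xy: "x \<in> K" "y \<in> K"
  shows "(x + y) ^ p = x ^ p + y ^ p"
proof -
  have p0: "0 < p" using prime_gt_0_nat[OF prime_p] .
  have "(\<Sum>k\<in>{..p} - {0, p}. of_nat (p choose k) * x ^ k * y ^ (p - k)) = 0"
  proof (rule sum.neutral, rule ballI)
    fix k assume k: "k \<in> {..p} - {0, p}"
    hence "p dvd p choose k" using prime_p p0 by (intro dvd_choose_prime) auto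
    then obtain c where c: "p choose k = c * p" by (metis dvd_div_mult_self)
    have m: "x ^ k * y ^ (p - k) \<in> K" using k xy by (intro K.mult_mem K.power_mem) auto
    have "of_nat (p choose k) * x ^ k * y ^ (p - k) = of_nat c * (of_nat p * (x ^ k * y ^ (p - k)))"
      by (simp add: c algebra_simps)
    thus "of_nat (p choose k) * x ^ k * y ^ (p - k) = 0" using m by simp
  qed
  moreover have "(x + y) ^ p = (\<Sum>k\<in>{0, p}. of_nat (p choose k) * x ^ k * y ^ (p - k)) +
      (\<Sum>k\<in>{..p} - {0, p}. of_nat (p choose k) * x ^ k * y ^ (p - k))"
    unfolding binomial_ring by (subst sum.subset_diff[of "{0, p}"]) (auto simp: add.commute)
  ultimately show ?thesis using p0 by (simp add: add.commute)
qed

lemma frobenius: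
  assumes "x \<in> K" "y \<in> K"
  shows "(x + y) ^ (p ^ j) = x ^ (p ^ j) + y ^ (p ^ j)"
proof (induction j)
  case (Suc j)
  have "(x + y) ^ (p ^ Suc j) = ((x + y) ^ (p ^ j)) ^ p" by (simp add: power_mult[symmetric] mult.commute)
  also have "\<dots> = (x ^ (p ^ j)) ^ p + (y ^ (p ^ j)) ^ p"
    unfolding Suc.IH using assms prime_gt_0_nat[OF prime_p] by (intro frobenius_p K.power_mem) auto
  finally show ?case by (simp add: power_mult[symmetric] mult.commute)
qed simp

lemma fixed_subfield:
  assumes S: "S = {x \<in> K. x ^ (p ^ j) = x}"
  shows "finite_subfield S e"
proof
  have pos: "0 < p ^ j" using prime_gt_0_nat[OF prime_p] by simp
  have odd: "odd (p ^ j)" using odd_p by simp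
  show "finite S" "0 \<in> S" "e \<in> S" "e \<noteq> 0"
    using pos zero_power[OF pos] unfolding S by auto
  show "e * x = x" if "x \<in> S" for x using that unfolding S by auto
  show "x + y \<in> S" if "x \<in> S" "y \<in> S" for x y
    using that frobenius[of x y j] unfolding S by auto
  show "x * y \<in> S" if "x \<in> S" "y \<in> S" for x y
    using that unfolding S by (auto simp: power_mult_distrib)
  show "- x \<in> S" if "x \<in> S" for x
    using that odd unfolding S by (auto simp: power_minus_odd)
  show "\<exists>y\<in>S. x * y = e" if x: "x \<in> S" "x \<noteq> 0" for x
  proof -
    from x obtain y where y: "y \<in> K" "x * y = e" using K.inv_ex unfolding S by blast
    have "x ^ (p ^ j) * y ^ (p ^ j) = e" using y pos by (simp add: power_mult_distrib[symmetric])
    hence "x * y ^ (p ^ j) = x * y" using x y unfolding S by simp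
    hence "y ^ (p ^ j) = y" using x y pos K.mult_cancel[of "y ^ (p ^ j)" y x] K.power_mem[of y "p ^ j"]
      unfolding S by auto
    thus ?thesis using y unfolding S by blast
  qed
qed

lemma card_K_minus_1: "card K - 1 > 1"
proof -
  have "3 ^ 6 \<le> q ^ 6" using q_ge_3 by (rule power_mono) simp
  thus ?thesis by (simp add: card_K)
qed

definition "n = q ^ 6 - 1"

lemma card_K_n: "card K - 1 = n" by (simp add: card_K n_def)

lemma n_gt_1: "n > 1" using card_K_minus_1 by (simp only: card_K_n)

lemma omega_nz [simp]: "\<omega> \<noteq> 0"
proof
  assume "\<omega> = 0"
  hence "x \<in> {0, e}" if "x \<in> K" for x using omega_gen[OF that] by (cases "x = 0") (auto simp: power_0_left split: if_splits)
  hence "card K \<le> card {0, e}" by (intro card_mono) auto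
  thus False using card_K_minus_1 by (cases "0 = e") auto
qed

lemma omega_pow_mem [simp]: "0 < i \<Longrightarrow> \<omega> ^ i \<in> K" "e * \<omega> ^ i \<in> K"
proof -
  show *: "0 < i \<Longrightarrow> \<omega> ^ i \<in> K" for i by (rule K.power_mem) simp_all
  show "e * \<omega> ^ i \<in> K" using * by (cases "i = 0") auto
qed

lemma omega_n: "\<omega> ^ n = e"
  using K.power_card[of \<omega>] unfolding card_K_n by simp

lemma omega_mod: "e * \<omega> ^ i = e * \<omega> ^ (i mod n)"
proof -
  have "e * \<omega> ^ (n * k + r) = e * \<omega> ^ r" for k r
  proof (induction k)
    case (Suc k)
    have "e * \<omega> ^ (n * Suc k + r) = e * (\<omega> ^ n * \<omega> ^ (n * k + r))"
      by (simp add: power_add[symmetric] add.assoc)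
    also have "\<dots> = e * \<omega> ^ (n * k + r)" by (simp add: omega_n)
    finally show ?case using Suc.IH by simp
  qed simp
  from this[of "i div n" "i mod n"] show ?thesis by simp
qed

text \<open>Exponents run over 1..n rather than 0..n - 1: the unit is then
  \<open>\<omega> ^ n\<close>, and every listed power lies in \<open>K\<close>.\<close>

lemma omega_surj:
  assumes "x \<in> K" "x \<noteq> 0"
  obtains i where "i \<in> {1..n}" "x = \<omega> ^ i"
proof -
  obtain i where "x = e * \<omega> ^ i" using omega_gen assms by blast
  hence x: "x = e * \<omega> ^ (i mod n)" using omega_mod by simp
  show thesis
  proof (cases "i mod n = 0")
    case True
    thus ?thesis using x omega_n n_gt_1 by (intro that[of n]) auto
  next
    case False
    thus ?thesis using x mod_less_divisor[of n i] n_gt_1 by (intro that[of "i mod n"]) (auto simp del: mod_less_divisor)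
  qed
qed

lemma omega_power_nz [simp]: "0 < i \<Longrightarrow> \<omega> ^ i \<noteq> 0"
  by (induction i) (auto, metis K.mult_eq_0 neq0_conv omega_mem omega_nz omega_pow_mem(1) power_0 mult_1_right)

lemma omega_inj: "inj_on (\<lambda>i. \<omega> ^ i) {1..n}"
proof (rule eq_card_imp_inj_on)
  have "(\<lambda>i. \<omega> ^ i) ` {1..n} = K - {0}" using omega_surj by (force elim!: omega_surj)
  thus "card ((\<lambda>i. \<omega> ^ i) ` {1..n}) = card {1..n}" by (simp add: card_K n_def)
qed simp

lemma omega_eq_unit:
  assumes "0 < i"
  shows "\<omega> ^ i = e \<longleftrightarrow> n dvd i"
proof
  assume "\<omega> ^ i = e"
  hence eq: "e * \<omega> ^ (i mod n) = e" using omega_mod[of i] by simp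
  show "n dvd i"
  proof (rule ccontr)
    assume "\<not> n dvd i"
    hence r: "0 < i mod n" by (simp add: dvd_eq_mod_eq_0)
    hence "\<omega> ^ (i mod n) = \<omega> ^ n" using eq omega_n by simp
    moreover have "i mod n < n" using n_gt_1 by (intro mod_less_divisor) simp
    ultimately show False using inj_onD[OF omega_inj, of "i mod n" n] r by auto
  qed
next
  assume "n dvd i"
  hence "e * \<omega> ^ i = e" using omega_mod[of i] by simp
  thus "\<omega> ^ i = e" using assms by simp
qed

text \<open>The nonzero solutions are the powers of \<omega> whose exponent is a multiple of n / d.
  The form x^(d + 1) = x admits 0 and matches the Frobenius equations that define \<open>E\<close>
  and \<open>F\<close>.\<close>

lemma card_roots_of_unity:
  assumes d: "d dvd n"
  shows "card {x \<in> K. x ^ Suc d = x} = Suc d"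
proof -
  have d0: "0 < d" using d n_gt_1 by (metis dvd_0_left_iff gr0I not_one_less_zero)
  obtain c where c: "n = d * c" using d by blast
  have c0: "0 < c" using c n_gt_1 by (cases c) auto
  have "{x \<in> K. x ^ Suc d = x} = insert 0 ((\<lambda>i. \<omega> ^ i) ` (\<lambda>j. c * j) ` {1..d})" (is "?L = ?R")
  proof (intro equalityI subsetI)
    fix x assume x: "x \<in> ?L"
    show "x \<in> ?R"
    proof (cases "x = 0")
      case False
      obtain i where i: "i \<in> {1..n}" "x = \<omega> ^ i" using omega_surj x False by blast
      have "x * x ^ d = x * e" using x by simp
      hence "x ^ d = e" using K.mult_cancel[of "x ^ d" e x] K.power_mem[of x d] x False d0 by simp
      hence "\<omega> ^ (i * d) = e" using i by (simp add: power_mult)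
      hence "n dvd i * d" using omega_eq_unit[of "i * d"] i d0 by simp
      hence "c dvd i" using c d0 by (simp add: mult.commute)
      then obtain j where j: "i = c * j" by blast
      have "c * j \<le> c * d" "0 < c * j" using i j c by (auto simp: mult.commute)
      hence "j \<in> {1..d}" using c0 by auto
      thus ?thesis using i j by blast
    qed simp
  next
    fix x assume "x \<in> ?R"
    then consider "x = 0" | j where "j \<in> {1..d}" "x = \<omega> ^ (c * j)" by blast
    thus "x \<in> ?L"
    proof cases
      case 2
      have "x ^ d = \<omega> ^ (n * j)" using 2 c by (simp add: power_mult[symmetric] mult.commute mult.left_commute)
      also have "\<dots> = e" using omega_eq_unit[of "n * j"] 2 n_gt_1 by simp
      finally show ?thesis using 2 c0 by simp
    qed (use d0 in simp)
  qed
  moreover have "inj_on (\<lambda>j. \<omega> ^ (c * j)) {1..d}"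
  proof (rule inj_onI)
    fix i j assume h: "i \<in> {1..d}" "j \<in> {1..d}" "\<omega> ^ (c * i) = \<omega> ^ (c * j)"
    have "c * i \<in> {1..n}" "c * j \<in> {1..n}" using h c c0 by (auto simp: mult.commute)
    hence "c * i = c * j" using inj_onD[OF omega_inj h(3)] by simp
    thus "i = j" using c0 by simp
  qed
  hence "card ((\<lambda>i. \<omega> ^ i) ` (\<lambda>j. c * j) ` {1..d}) = d"
    unfolding image_image by (simp add: card_image)
  moreover have "0 \<notin> (\<lambda>i. \<omega> ^ i) ` (\<lambda>j. c * j) ` {1..d}" using c0 by (auto dest!: sym[of 0])
  ultimately show ?thesis by simp
qed

definition "E = {x \<in> K. x ^ (q ^ 3) = x}"
definition "F = {x \<in> K. x ^ q = x}"

lemma card_E: "card E = q ^ 3"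
proof -
  have "n = (q ^ 3 - 1) * (q ^ 3 + 1)"
    by (simp add: n_def algebra_simps diff_mult_distrib power_add[symmetric])
  hence "card {x \<in> K. x ^ Suc (q ^ 3 - 1) = x} = Suc (q ^ 3 - 1)"
    by (intro card_roots_of_unity) (metis dvd_triv_left)
  thus ?thesis by (simp add: E_def del: power_Suc)
qed

lemma card_F: "card F = q"
proof -
  have "1 \<le> q ^ 6" by (rule one_le_power) (use q_pos in linarith)
  hence "int n = int q ^ 6 - 1" unfolding n_def by (simp only: of_nat_diff) simp
  also have "\<dots> = (int q - 1) * (\<Sum>i<6. int q ^ i)" by (rule power_diff_1_eq)
  also have "\<dots> = int ((q - 1) * (\<Sum>i<6. q ^ i))" using q_ge_3 by (cases q) auto
  finally have "n = (q - 1) * (\<Sum>i<6. q ^ i)" by (simp only: of_nat_eq_iff)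
  hence "card {x \<in> K. x ^ Suc (q - 1) = x} = Suc (q - 1)"
    by (intro card_roots_of_unity) (metis dvd_triv_left)
  thus ?thesis by (simp add: F_def del: power_Suc)
qed

end

section \<open>Frobenius, conjugation, norm and trace; a square root of -1 and a nonsquare\<close>

context field_tower
begin

definition fr :: "'b \<Rightarrow> 'b" where "fr x = x ^ q"
definition bar :: "'b \<Rightarrow> 'b" where "bar x = x ^ (q ^ 3)"
definition N :: "'b \<Rightarrow> 'b" where "N x = x * bar x"
definition Tr :: "'b \<Rightarrow> 'b" where "Tr x = x + fr x + fr (fr x)"

lemma q_power: "q ^ j = p ^ (f * j)"
  by (simp add: q_def power_mult)

sublocale E: finite_subfield E e
  by (rule fixed_subfield[of _ "f * 3"]) (simp add: E_def q_power)

sublocale F: finite_subfield F e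
  by (rule fixed_subfield[of _ f]) (simp add: F_def q_def[symmetric])

lemma E_K [simp]: "x \<in> E \<Longrightarrow> x \<in> K" unfolding E_def by blast

lemma fr_mult [simp]: "fr (x * y) = fr x * fr y" by (simp add: fr_def power_mult_distrib)
lemma bar_mult [simp]: "bar (x * y) = bar x * bar y" by (simp add: bar_def power_mult_distrib)
lemma N_mult [simp]: "N (x * y) = N x * N y" by (simp add: N_def algebra_simps)

lemma fr_add [simp]: "x \<in> K \<Longrightarrow> y \<in> K \<Longrightarrow> fr (x + y) = fr x + fr y"
  using frobenius[of x y f, folded q_def] unfolding fr_def .
lemma bar_add [simp]: "x \<in> K \<Longrightarrow> y \<in> K \<Longrightarrow> bar (x + y) = bar x + bar y"
  using frobenius[of x y "f * 3"] by (simp add: bar_def q_power)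

lemma odd_q: "odd q" using q_mod_4 by presburger

lemma fr_minus [simp]: "fr (- x) = - fr x" by (simp add: fr_def odd_q)
lemma bar_minus [simp]: "bar (- x) = - bar x" by (simp add: bar_def odd_q)
lemma N_minus [simp]: "N (- x) = N x" by (simp add: N_def)
lemma fr_diff [simp]: "x \<in> K \<Longrightarrow> y \<in> K \<Longrightarrow> fr (x - y) = fr x - fr y"
  using fr_add[of x "- y"] by simp
lemma bar_diff [simp]: "x \<in> K \<Longrightarrow> y \<in> K \<Longrightarrow> bar (x - y) = bar x - bar y"
  using bar_add[of x "- y"] by simp

lemma fr_0 [simp]: "fr 0 = 0" unfolding fr_def by (rule zero_power) simp
lemma bar_0 [simp]: "bar 0 = 0" unfolding bar_def by (rule zero_power) simp
lemma N_0 [simp]: "N 0 = 0" by (simp add: N_def)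

lemma fr_K [simp]: "x \<in> K \<Longrightarrow> fr x \<in> K" unfolding fr_def by (rule K.power_mem) simp_all
lemma bar_K [simp]: "x \<in> K \<Longrightarrow> bar x \<in> K" unfolding bar_def by (rule K.power_mem) simp_all

lemma fr_E [simp]: "x \<in> E \<Longrightarrow> fr x \<in> E" unfolding fr_def by (rule E.power_mem) simp_all

lemma bar_E [simp]: "x \<in> E \<Longrightarrow> bar x = x" unfolding E_def bar_def by blast
lemma E_iff: "x \<in> E \<longleftrightarrow> x \<in> K \<and> bar x = x" unfolding E_def bar_def by blast
lemma fr_F [simp]: "x \<in> F \<Longrightarrow> fr x = x" unfolding F_def fr_def by blast
lemma F_iff: "x \<in> F \<longleftrightarrow> x \<in> K \<and> fr x = x" unfolding F_def fr_def by blast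

lemma bar_fr: "bar x = fr (fr (fr x))"
  by (simp add: bar_def fr_def power_mult[symmetric] power3_eq_cube mult.assoc)

lemma bar_bar [simp]: "x \<in> K \<Longrightarrow> bar (bar x) = x"
proof (cases "x = 0")
  case False
  assume x: "x \<in> K"
  have "x ^ (q ^ 6 - 1) = e" using K.power_card[OF x False] by (simp only: card_K)
  hence "x ^ Suc (q ^ 6 - 1) = x" unfolding power_Suc using x by simp
  moreover have "Suc (q ^ 6 - 1) = q ^ 3 * q ^ 3" using q_pos by (simp add: power_add[symmetric])
  ultimately have "x ^ (q ^ 3 * q ^ 3) = x" by (simp only:)
  thus ?thesis unfolding bar_def power_mult[symmetric] .
qed simp

lemma F_E [simp]: "x \<in> F \<Longrightarrow> x \<in> E"
  unfolding E_iff bar_fr F_iff by simp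

lemma F_K [simp]: "x \<in> F \<Longrightarrow> x \<in> K" by simp

lemma fr3 [simp]: "x \<in> E \<Longrightarrow> fr (fr (fr x)) = x"
  using bar_fr[of x] by simp

lemma F_iff_E: "x \<in> F \<longleftrightarrow> x \<in> E \<and> fr x = x"
  by (metis F_E F_iff E_K)

lemma N_E [simp]: "x \<in> K \<Longrightarrow> N x \<in> E"
  unfolding E_iff N_def by (simp add: mult.commute)

lemma N_eq_0 [simp]: "x \<in> K \<Longrightarrow> N x = 0 \<longleftrightarrow> x = 0"
proof -
  assume x: "x \<in> K"
  have "bar x = 0 \<Longrightarrow> x = 0" using bar_bar[OF x] by (metis bar_0)
  thus ?thesis using x by (auto simp: N_def)
qed

lemma trace_K_E [simp]: "x \<in> K \<Longrightarrow> x + bar x \<in> E"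
  unfolding E_iff by (simp add: add.commute)

lemma Tr_F [simp]: "x \<in> E \<Longrightarrow> Tr x \<in> F"
  unfolding F_iff_E Tr_def by (simp add: add_ac)

lemma Tr_add [simp]: "x \<in> E \<Longrightarrow> y \<in> E \<Longrightarrow> Tr (x + y) = Tr x + Tr y"
  by (simp add: Tr_def)
lemma Tr_minus [simp]: "Tr (- x) = - Tr x" by (simp add: Tr_def)
lemma Tr_diff [simp]: "x \<in> E \<Longrightarrow> y \<in> E \<Longrightarrow> Tr (x - y) = Tr x - Tr y"
  by (simp add: Tr_def)
lemma Tr_0 [simp]: "Tr 0 = 0" by (simp add: Tr_def)
lemma Tr_scale [simp]: "c \<in> F \<Longrightarrow> Tr (c * x) = c * Tr x"
  by (simp add: Tr_def ring_distribs)
lemma Tr_of_F: "c \<in> F \<Longrightarrow> Tr c = 3 * c" by (simp add: Tr_def)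
lemma Tr_numeral [simp]: "x \<in> E \<Longrightarrow> Tr (numeral k * x) = numeral k * Tr x"
proof -
  assume x: "x \<in> E"
  have "Tr (of_nat m * x) = of_nat m * Tr x" for m
    using x by (induction m) (simp_all add: ring_distribs)
  from this[of "numeral k"] show ?thesis by simp
qed

lemma two_K [simp]: "x \<in> K \<Longrightarrow> 2 * x = 0 \<longleftrightarrow> x = 0"
  using two_nz[of x] by (metis mult_2 mult_zero_right)

lemma four_k_plus_3: "\<exists>k. q = 4 * k + 3" "\<exists>k. q ^ 3 = 4 * k + 3"
proof -
  show "\<exists>k. q = 4 * k + 3" using q_mod_4 by presburger
  have "q ^ 3 mod 4 = (q mod 4) ^ 3 mod 4" by (simp add: power_mod)
  hence "q ^ 3 mod 4 = 3" by (simp add: q_mod_4)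
  thus "\<exists>k. q ^ 3 = 4 * k + 3" by presburger
qed

text \<open>Artin's independence argument for the three embeddings of \<open>E\<close> over \<open>F\<close>.\<close>

lemma Tr_nontrivial: "\<exists>x\<in>E. Tr x \<noteq> 0"
proof (rule ccontr)
  assume "\<not> ?thesis"
  hence T: "Tr x = 0" if "x \<in> E" for x using that by blast
  have "q ^ 1 < q ^ 3" using q_ge_3 by (intro power_strict_increasing) auto
  hence "card F < card E" by (simp add: card_E card_F)
  hence "\<not> E \<subseteq> F" using card_mono[OF F.finite, of E] by auto
  then obtain g where g: "g \<in> E" "g \<notin> F" by blast
  define g1 where "g1 = fr g"
  define g2 where "g2 = fr (fr g)"
  have m: "g1 \<in> E" "g2 \<in> E" using g by (simp_all add: g1_def g2_def)
  have "g2 \<noteq> g"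
  proof
    assume "g2 = g"
    hence "fr g = fr g2" by simp
    thus False using g unfolding g2_def F_iff_E by simp
  qed
  moreover have "g2 \<noteq> g1"
  proof
    assume "g2 = g1"
    hence "fr (fr g2) = fr (fr g1)" by simp
    hence "g1 = g" using g by (simp add: g1_def g2_def)
    thus False using g unfolding g1_def F_iff_E by simp
  qed
  \<comment> \<open>The traces of e, g and g^2 are the power sums of the three conjugates of g.
    Their vanishing is a Vandermonde system, from which this product is eliminated.\<close>
  moreover have "(g2 - g) * (g2 - g1) = 0"
  proof -
    have 0: "e + e + e = 0" using T[of e] by (simp add: Tr_def)
    have 1: "g + g1 + g2 = 0" using T[of g] g by (simp add: Tr_def g1_def g2_def)
    have 2: "g * g + g1 * g1 + g2 * g2 = 0"
      using T[of "g * g"] g by (simp add: Tr_def g1_def g2_def)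
    have "g + g + g = g * (e + e + e)" unfolding ring_distribs using g by simp
    hence 3: "g + g + g = 0" using 0 by simp
    have h2: "g2 = - g - g1" using 1 by (simp add: algebra_simps eq_neg_iff_add_eq_0)
    hence "(g2 - g) * (g2 - g1) = (g * g + g1 * g1 + g2 * g2) + (g + g + g) * g1"
      unfolding h2 by (simp add: algebra_simps)
    thus ?thesis using 2 3 by simp
  qed
  ultimately show False using g m by simp
qed

text \<open>The element is \<omega>^(n / 4), of order 4. Since q^3 is 3 mod 4, conjugation cubes it,
  which is negation. In the coordinates s + i t over \<open>E\<close> the norm becomes s^2 +
  t^2.\<close>

lemma imaginary_unit:
  obtains i where "i \<in> K" "i * i = - e" "bar i = - i"
proof -
  obtain k where k: "q ^ 3 = 4 * k + 3" using four_k_plus_3 by blast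
  have n: "n = 4 * ((4 * k + 2) * (k + 1))"
  proof -
    have "n = (q ^ 3 - 1) * (q ^ 3 + 1)"
      by (simp add: n_def algebra_simps diff_mult_distrib power_add[symmetric])
    thus ?thesis by (simp add: k algebra_simps)
  qed
  define m where "m = (4 * k + 2) * (k + 1)"
  have m: "0 < m" "n = 4 * m" using n by (simp_all add: m_def)
  define i where "i = \<omega> ^ m"
  have i: "i \<in> K" using m by (simp add: i_def)
  have "i * i \<noteq> e"
    using omega_eq_unit[of "m + m"] m dvd_imp_le[of "4 * m" "m + m"] by (auto simp add: i_def power_add[symmetric])
  moreover have "(i * i - e) * (i * i + e) = 0"
  proof -
    have "m + m + (m + m) = n" by (simp add: m)
    hence "(i * i) * (i * i) = \<omega> ^ n" by (simp only: i_def power_add[symmetric])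
    thus ?thesis using omega_n i by (simp add: algebra_simps)
  qed
  ultimately have i2: "i * i = - e" using i by (simp add: eq_neg_iff_add_eq_0)
  have "4 * k + 3 = 2 * (2 * k + 1) + 1" by simp
  hence "bar i = (i * i) ^ (2 * k + 1) * i"
    by (simp only: bar_def k power_add power_mult power2_eq_square power_one_right)
  also have "(i * i) ^ (2 * k + 1) = (- e) ^ (2 * k + 1)" by (simp only: i2)
  also have "\<dots> = - e" using K.e_power[of "2 * k + 1"] by (subst power_minus_odd) simp_all
  finally have "bar i = - i" using i by simp
  thus ?thesis using i i2 that by blast
qed

text \<open>The choice is \<omega>^((q^3 - 1) / 2). Its exponent is odd, and its norm is \<omega>^(n
  / 2) = -e. This norm is wanted later, where N (\<nu> y^2) = - N(y)^2 places the \<nu>-multiples of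
  squares on the same quadric as the squares.\<close>

lemma nonsquare:
  "\<exists>\<nu>\<in>K. N \<nu> = - e \<and> (\<forall>b\<in>K. b \<noteq> 0 \<longrightarrow> (\<exists>z\<in>K. b = z * z \<or> b = \<nu> * (z * z)))"
proof -
  obtain k where k: "q ^ 3 = 4 * k + 3" using four_k_plus_3 by blast
  define m where "m = 2 * k + 1"
  have n: "n = m * (q ^ 3 + 1) * 2"
  proof -
    have "n = (q ^ 3 - 1) * (q ^ 3 + 1)"
      by (simp add: n_def algebra_simps diff_mult_distrib power_add[symmetric])
    thus ?thesis by (simp add: k m_def algebra_simps)
  qed
  define \<nu> where "\<nu> = \<omega> ^ m"
  have nu: "\<nu> \<in> K" unfolding \<nu>_def by (rule omega_pow_mem) (simp add: m_def)
  have "N \<nu> = \<nu> ^ (q ^ 3 + 1)" by (simp add: N_def bar_def)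
  also have "\<dots> = \<omega> ^ (m * (q ^ 3 + 1))" by (simp only: \<nu>_def power_mult)
  finally have N: "N \<nu> = \<omega> ^ (m * (q ^ 3 + 1))" .
  have "N \<nu> \<noteq> e"
  proof
    assume "N \<nu> = e"
    moreover have pos: "0 < m * (q ^ 3 + 1)" by (simp add: m_def)
    ultimately have "n dvd m * (q ^ 3 + 1)" using omega_eq_unit unfolding N by blast
    hence "n \<le> m * (q ^ 3 + 1)" using pos by (rule dvd_imp_le)
    thus False using n pos by linarith
  qed
  moreover have "(N \<nu> - e) * (N \<nu> + e) = 0"
  proof -
    have "N \<nu> * N \<nu> = \<omega> ^ n" by (simp only: N n power_add[symmetric] mult_2_right)
    thus ?thesis using omega_n nu by (simp add: algebra_simps)
  qed
  ultimately have N1: "N \<nu> = - e" using nu by (simp add: eq_neg_iff_add_eq_0)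
  have "\<exists>z\<in>K. b = z * z \<or> b = \<nu> * (z * z)" if b: "b \<in> K" "b \<noteq> 0" for b
  proof -
    obtain i where i: "i \<in> {1..n}" "b = \<omega> ^ i" using omega_surj b by blast
    show ?thesis
    proof (cases "even i")
      case True
      then obtain j where j: "i = j + j" by (metis evenE mult_2)
      hence "\<omega> ^ j \<in> K" using i by simp
      thus ?thesis using i j by (metis power_add)
    next
      case False
      have "m < n" unfolding n by (simp add: m_def)
      \<comment> \<open>\<open>i\<close> and \<open>m\<close> are odd and \<open>n\<close> is even;
        adding a full period keeps the subtraction in range.\<close>
      moreover have "even (i + n - m)" using False n \<open>m < n\<close> by (simp add: m_def)
      then obtain j where j: "i + n - m = j + j" by (metis evenE mult_2)
      ultimately have j': "i + n = m + (j + j)" "0 < j" using i by auto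
      have "\<omega> ^ (i + n) = b" using i b by (simp add: power_add omega_n)
      hence "b = \<nu> * (\<omega> ^ j * \<omega> ^ j)" by (simp only: j' power_add \<nu>_def)
      thus ?thesis using j' by (intro bexI[of _ "\<omega> ^ j"]) auto
    qed
  qed
  thus ?thesis using nu N1 by blast
qed

end

section \<open>Characters of the three fields, obtained from one on \<open>F\<close> by composing
  with traces\<close>

locale field_tower_character = field_tower K e p f q \<omega>
  for K :: "'b::comm_ring_1 set" and e p f q \<omega> +
  fixes \<psi> :: "'b \<Rightarrow> complex"
  assumes character: "additive_character {x \<in> K. x ^ q = x} e \<psi>"
begin

definition "\<psi>E x = \<psi> (Tr x)"
definition "\<psi>K x = \<psi>E (x + bar x)"

sublocale F: gauss_field F e \<psi>
proof -
  interpret additive_character F e \<psi> using character unfolding F_def .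
  obtain k where k: "q = 4 * k + 3" using four_k_plus_3 by blast
  have pow: "x ^ (4 * k + 3) = x" if "x \<in> F" for x using that unfolding F_def k[symmetric] by blast
  show "gauss_field F e \<psi>"
  proof
    show two: "x + x = 0 \<Longrightarrow> x = 0" if "x \<in> F" for x using that two_nz by simp
    show "x * x \<noteq> - e" if "x \<in> F" for x
      using F.minus_unit_nonsquare_if_power[OF two pow that] .
    show "\<exists>t\<in>F. x = t * t \<or> x = - (t * t)" if "x \<in> F" for x
      using F.square_or_neg_if_power[OF pow that] .
  qed
qed

sublocale E: gauss_field E e \<psi>E
proof -
  obtain k where k: "q ^ 3 = 4 * k + 3" using four_k_plus_3 by blast
  have pow: "x ^ (4 * k + 3) = x" if "x \<in> E" for x using that unfolding E_def k[symmetric] by blast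
  show "gauss_field E e \<psi>E"
  proof
    show two: "x + x = 0 \<Longrightarrow> x = 0" if "x \<in> E" for x using that two_nz by simp
    show "x * x \<noteq> - e" if "x \<in> E" for x
      using E.minus_unit_nonsquare_if_power[OF two pow that] .
    show "\<exists>t\<in>E. x = t * t \<or> x = - (t * t)" if "x \<in> E" for x
      using E.square_or_neg_if_power[OF pow that] .
    show "\<psi>E 0 = 1" by (simp add: \<psi>E_def)
    show "\<psi>E (x + y) = \<psi>E x * \<psi>E y" if "x \<in> E" "y \<in> E" for x y
      using that by (simp add: \<psi>E_def F.char_add)
    obtain y where y: "y \<in> F" "\<psi> y \<noteq> 1" using F.char_nontrivial by blast
    obtain x where x: "x \<in> E" "Tr x \<noteq> 0" using Tr_nontrivial by blast
    have "Tr (y * F.recip (Tr x) * x) = y"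
      using x y by (simp add: mult.assoc) (simp add: mult.commute[of "F.recip _"])
    thus "\<exists>x\<in>E. \<psi>E x \<noteq> 1"
      using x y by (intro bexI[of _ "y * F.recip (Tr x) * x"]) (auto simp: \<psi>E_def)
  qed
qed

sublocale K: additive_character K e \<psi>K
proof
  show "\<psi>K 0 = 1" by (simp add: \<psi>K_def)
  show "\<psi>K (x + y) = \<psi>K x * \<psi>K y" if "x \<in> K" "y \<in> K" for x y
    using that by (simp add: \<psi>K_def E.char_add[symmetric] add_ac)
  obtain y where y: "y \<in> E" "\<psi>E y \<noteq> 1" using E.char_nontrivial by blast
  \<comment> \<open>On \<open>E\<close> the trace from \<open>K\<close> is doubling, which
    \<open>h\<close>, one half, undoes.\<close>
  define h where "h = E.recip (2 * e)"
  have h: "h \<in> E" "2 * (h * y) = y"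
  proof -
    have "2 * e \<noteq> 0" by simp
    thus "h \<in> E" unfolding h_def by (intro E.recip_mem) simp_all
    have "(2 * e) * (h * y) = y" unfolding h_def using \<open>2 * e \<noteq> 0\<close> y by (intro E.div_mult) simp_all
    thus "2 * (h * y) = y" using \<open>h \<in> E\<close> y by (simp add: mult.assoc)
  qed
  hence "\<psi>K (h * y) = \<psi>E y" using y by (simp add: \<psi>K_def mult_2[symmetric])
  thus "\<exists>x\<in>K. \<psi>K x \<noteq> 1" using h y by (intro bexI[of _ "h * y"]) auto
qed

end

section \<open>Difference sets from character values\<close>

context additive_character
begin

lemma sum_char_delta:
  assumes "x \<in> S" "y \<in> S"
  shows "(\<Sum>b\<in>S. \<psi> (b * x) * \<psi> (- (b * y))) = (if x = y then of_nat (card S) else 0)"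
proof -
  have "(\<Sum>b\<in>S. \<psi> (b * x) * \<psi> (- (b * y))) = (\<Sum>b\<in>S. \<psi> ((x - y) * b))"
    using assms by (intro sum.cong) (simp_all add: char_add[symmetric] algebra_simps)
  thus ?thesis using assms sum_char[of "x - y"] by simp
qed

text \<open>Let \<open>w\<close> be (X - r)(X - r + n) evaluated at the transform of
  \<open>D\<close>. Away from 0 its values are n^2 m (m - 1), nonnegative for integers m, and
  Parseval makes their sum 0. So \<open>w\<close> is concentrated at 0 and its inverse transform is
  constant; equating this constant with the transform at \<open>a\<close> gives the count.\<close>

lemma difference_count:
  fixes r n :: nat
  assumes D: "D \<subseteq> S" and D_neg: "\<And>x. x \<in> D \<Longrightarrow> - x \<in> D" and D_0: "0 \<notin> D"
    and card_D: "card D = r * (n + 1)" and card_S: "card S = n ^ 2"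
    and hat: "\<And>b. b \<in> S \<Longrightarrow> b \<noteq> 0 \<Longrightarrow>
      \<exists>m::int. (\<Sum>x\<in>D. \<psi> (b * x)) = of_nat r - of_nat n * of_int m"
    and a: "a \<in> S" "a \<noteq> 0"
  shows "int (card {d \<in> D. d - a \<in> D}) =
    int r ^ 2 + int r + (if a \<in> D then 2 * int r - int n else 0)"
proof -
  define dh where "dh b = (\<Sum>x\<in>D. \<psi> (b * x))" for b
  define c where "c a = card {d \<in> D. d - a \<in> D}" for a
  define w where "w b = (dh b - of_nat r) * (dh b - of_nat r + of_nat n)" for b
  have fin: "finite D" by (rule finite_subset[OF D]) simp
  have DS: "x \<in> D \<Longrightarrow> x \<in> S" for x using D by blast
  have n0: "n > 0" using card_S a by (cases n) auto
  have 1: "(\<Sum>b\<in>S. dh b * \<psi> (- (b * a))) = of_nat (n ^ 2) * of_bool (a \<in> D)" if "a \<in> S" for a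
  proof -
    have "(\<Sum>b\<in>S. dh b * \<psi> (- (b * a))) = (\<Sum>x\<in>D. \<Sum>b\<in>S. \<psi> (b * x) * \<psi> (- (b * a)))"
      unfolding dh_def sum_distrib_right by (rule sum.swap)
    also have "\<dots> = (\<Sum>x\<in>D. if x = a then of_nat (n ^ 2) else 0)"
      using DS that by (intro sum.cong) (simp_all add: sum_char_delta card_S)
    finally show ?thesis using fin by simp
  qed
  have 2: "(\<Sum>b\<in>S. dh b * dh b * \<psi> (- (b * a))) = of_nat (n ^ 2) * of_nat (c a)" if a: "a \<in> S" for a
  proof -
    have "(\<Sum>b\<in>S. dh b * dh b * \<psi> (- (b * a))) =
        (\<Sum>b\<in>S. \<Sum>x\<in>D. \<Sum>y\<in>D. \<psi> (b * x) * \<psi> (b * y) * \<psi> (- (b * a)))"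
      unfolding dh_def sum_product unfolding sum_distrib_right ..
    also have "\<dots> = (\<Sum>x\<in>D. \<Sum>b\<in>S. \<Sum>y\<in>D. \<psi> (b * x) * \<psi> (b * y) * \<psi> (- (b * a)))"
      by (rule sum.swap)
    also have "\<dots> = (\<Sum>x\<in>D. \<Sum>y\<in>D. \<Sum>b\<in>S. \<psi> (b * x) * \<psi> (b * y) * \<psi> (- (b * a)))"
      by (intro sum.cong refl sum.swap)
    also have "\<dots> = (\<Sum>x\<in>D. \<Sum>y\<in>D. if y = a - x then of_nat (n ^ 2) else 0)"
    proof (intro sum.cong refl)
      fix x y assume "x \<in> D" "y \<in> D"
      hence xy: "x \<in> S" "y \<in> S" using DS by auto
      have "(\<Sum>b\<in>S. \<psi> (b * x) * \<psi> (b * y) * \<psi> (- (b * a))) = (\<Sum>b\<in>S. \<psi> (b * (x + y)) * \<psi> (- (b * a)))"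
        using xy by (intro sum.cong) (simp_all add: char_add[symmetric] algebra_simps)
      thus "(\<Sum>b\<in>S. \<psi> (b * x) * \<psi> (b * y) * \<psi> (- (b * a))) = (if y = a - x then of_nat (n ^ 2) else 0)"
        using xy a sum_char_delta[of "x + y" a] by (simp add: card_S algebra_simps eq_diff_eq)
    qed
    also have "\<dots> = (\<Sum>x\<in>D. if a - x \<in> D then of_nat (n ^ 2) else 0)" using fin by simp
    also have "\<dots> = of_nat (n ^ 2) * of_nat (card {x \<in> D. a - x \<in> D})"
      using fin by (simp add: sum.If_cases Int_def)
    \<comment> \<open>Symmetry of \<open>D\<close> turns representations a = x + y into
      differences.\<close>
    also have "{x \<in> D. a - x \<in> D} = {d \<in> D. d - a \<in> D}"
      using D_neg by (metis (no_types, opaque_lifting) minus_diff_eq)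
    finally show ?thesis by (simp add: c_def)
  qed
  have 3: "(\<Sum>b\<in>S. \<psi> (- (b * a))) = of_nat (n ^ 2) * of_bool (a = 0)" if "a \<in> S" for a
    using sum_char_neg[OF that] by (simp add: card_S mult.commute)
  have T: "(\<Sum>b\<in>S. w b * \<psi> (- (b * a))) = of_nat (n ^ 2) *
      (of_nat (c a) + (of_nat n - 2 * of_nat r) * of_bool (a \<in> D) +
       of_nat r * (of_nat r - of_nat n) * of_bool (a = 0))" if "a \<in> S" for a
  proof -
    have "(\<Sum>b\<in>S. w b * \<psi> (- (b * a))) = (\<Sum>b\<in>S. dh b * dh b * \<psi> (- (b * a)) +
        (of_nat n - 2 * of_nat r) * (dh b * \<psi> (- (b * a))) +
        of_nat r * (of_nat r - of_nat n) * \<psi> (- (b * a)))"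
      by (intro sum.cong refl) (simp add: w_def algebra_simps)
    also have "\<dots> = of_nat (n ^ 2) * of_nat (c a) +
        (of_nat n - 2 * of_nat r) * (of_nat (n ^ 2) * of_bool (a \<in> D)) +
        of_nat r * (of_nat r - of_nat n) * (of_nat (n ^ 2) * of_bool (a = 0))"
      unfolding sum.distrib sum_distrib_left[symmetric] 1[OF that] 2[OF that] 3[OF that] ..
    finally show ?thesis by (simp add: algebra_simps)
  qed
  have "\<forall>b. \<exists>m::int. b \<in> S - {0} \<longrightarrow> dh b = of_nat r - of_nat n * of_int m"
    using hat unfolding dh_def by blast
  then obtain m :: "'b \<Rightarrow> int" where m: "b \<in> S - {0} \<Longrightarrow> dh b = of_nat r - of_nat n * of_int (m b)" for b
    by metis
  have wm: "w b = of_int (int n ^ 2 * (m b * (m b - 1)))" if "b \<in> S - {0}" for b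
    unfolding w_def m[OF that] by (simp add: algebra_simps power2_eq_square)
  have w0: "w 0 = of_nat (n ^ 2) * (of_nat r * (of_nat r + 1))"
    by (simp add: w_def dh_def card_D algebra_simps power2_eq_square)
  have c0: "c 0 = r * (n + 1)" by (simp add: c_def card_D)
  have split: "(\<Sum>b\<in>S. g b) = g 0 + (\<Sum>b\<in>S - {0}. g b)" for g :: "'b \<Rightarrow> complex"
    by (rule sum.remove) simp_all
  \<comment> \<open>At the point 0, \<open>T\<close> gives n^2 (r (n + 1) + r (r - n)), which is
    already \<open>w 0\<close>; nothing is left for the other terms.\<close>
  have "(\<Sum>b\<in>S. w b) = of_nat (n ^ 2) * (of_nat r * (of_nat r + 1))"
    using T[of 0] D_0 by (simp add: c0 algebra_simps)
  hence "(\<Sum>b\<in>S - {0}. w b) = 0" using split[of w] w0 by simp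
  hence "of_int (\<Sum>b\<in>S - {0}. int n ^ 2 * (m b * (m b - 1))) = (0::complex)"
    by (simp add: wm)
  hence s0: "(\<Sum>b\<in>S - {0}. int n ^ 2 * (m b * (m b - 1))) = 0" by (simp only: of_int_eq_0_iff)
  have pos: "0 \<le> int n ^ 2 * (k * (k - 1))" for k
  proof -
    have "0 \<le> k * (k - 1)" by (cases "k \<ge> 1") (auto simp: mult_nonpos_nonpos)
    thus ?thesis by simp
  qed
  have "w b = 0" if "b \<in> S - {0}" for b
  proof -
    have "\<forall>b\<in>S - {0}. int n ^ 2 * (m b * (m b - 1)) = 0"
      using s0 by (subst (asm) sum_nonneg_eq_0_iff) (auto intro: pos)
    hence "int n ^ 2 * (m b * (m b - 1)) = 0" using that by blast
    thus ?thesis unfolding wm[OF that] by (simp only: of_int_0)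
  qed
  hence "(\<Sum>b\<in>S. w b * \<psi> (- (b * a))) = w 0" using split[of "\<lambda>b. w b * \<psi> (- (b * a))"] by simp
  hence "of_nat (c a) + (of_nat n - 2 * of_nat r) * of_bool (a \<in> D) = (of_nat r * (of_nat r + 1) :: complex)"
    unfolding T[OF a(1)] w0 using n0 a(2) by simp
  hence "of_int (int (c a)) = (of_int (int r ^ 2 + int r + (if a \<in> D then 2 * int r - int n else 0)) :: complex)"
    by (auto simp: algebra_simps power2_eq_square split: if_splits)
  thus ?thesis unfolding c_def of_int_eq_iff .
qed

end

section \<open>Exponential sums of binary quadratic forms\<close>

context gauss_field
begin

lemma gauss_product_neg:
  "a \<in> S \<Longrightarrow> d \<in> S \<Longrightarrow> a \<noteq> 0 \<Longrightarrow> gauss a * gauss d - gauss (- a) * gauss (- d) =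
    (if d = 0 then 2 * of_nat (card S) * gauss a else 0)"
  using gauss_neg[of a] gauss_neg[of d] gauss_0 by auto

text \<open>A nondegenerate form yields a product of two Gauss sums; both change sign when the form
  is negated, so the difference cancels. A form of rank one yields |S| times a single Gauss sum,
  which changes sign, so the difference doubles.\<close>

lemma binary_form_sum:
  assumes mem: "a \<in> S" "b \<in> S" "c \<in> S" and nz: "a \<noteq> 0 \<or> b \<noteq> 0 \<or> c \<noteq> 0"
  defines "f \<equiv> \<lambda>u v. a * (u * u) + 2 * (b * (u * v)) + c * (v * v)"
  shows "(\<Sum>u\<in>S. \<Sum>v\<in>S. \<psi> (f u v) - \<psi> (- f u v)) =
    (if a * c = b * b then 2 * of_nat (card S) * gauss (if a = 0 then c else a) else 0)"
proof -
  have split: "(\<Sum>u\<in>S. \<Sum>v\<in>S. \<psi> (f u v) - \<psi> (- f u v)) =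
      (\<Sum>v\<in>S. \<Sum>u\<in>S. \<psi> (f u v)) - (\<Sum>v\<in>S. \<Sum>u\<in>S. \<psi> (- f u v))"
    by (subst sum.swap) (simp add: sum_subtractf)
  show ?thesis
  proof (cases "a = 0")
    case False
    \<comment> \<open>Completing the square: \<open>k\<close> is b / a and \<open>d\<close> is c -
      b^2 / a, so that a d = a c - b^2.\<close>
    define k where "k = recip a * b"
    define d where "d = c - b * k"
    have k: "k \<in> S" "a * k = b" unfolding k_def using mem False by simp_all
    have d: "d \<in> S" unfolding d_def using mem k by simp
    have d0: "d = 0 \<longleftrightarrow> a * c = b * b"
    proof -
      have "a * d = a * c - b * (a * k)" by (simp add: d_def algebra_simps)
      hence "a * d = a * c - b * b" by (simp only: k)
      thus ?thesis using mult_eq_0[OF mem(1) d] False by auto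
    qed
    have f: "f u v = a * ((k * v + u) * (k * v + u)) + d * (v * v)" for u v
    proof -
      have "a * ((k * v + u) * (k * v + u)) + d * (v * v) =
          a * (u * u) + 2 * ((a * k) * (u * v)) + (a * k) * k * (v * v) + (c - b * k) * (v * v)"
        by (simp add: d_def algebra_simps)
      thus ?thesis unfolding k by (simp add: f_def algebra_simps)
    qed
    have sum: "(\<Sum>v\<in>S. \<Sum>u\<in>S. \<psi> (\<epsilon> * (a * ((k * v + u) * (k * v + u)) + d * (v * v)))) =
        gauss (\<epsilon> * a) * gauss (\<epsilon> * d)" if "\<epsilon> = 1 \<or> \<epsilon> = -1" for \<epsilon>
    proof -
      have em: "\<epsilon> * x \<in> S" if "x \<in> S" for x using that \<open>\<epsilon> = 1 \<or> \<epsilon> = -1\<close> by auto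
      have "(\<Sum>u\<in>S. \<psi> (\<epsilon> * (a * ((k * v + u) * (k * v + u)) + d * (v * v)))) =
          (\<Sum>u\<in>S. \<psi> (\<epsilon> * a * (u * u)) * \<psi> (\<epsilon> * d * (v * v)))" if v: "v \<in> S" for v
      proof -
        have "(\<Sum>u\<in>S. \<psi> (\<epsilon> * (a * ((k * v + u) * (k * v + u)) + d * (v * v)))) =
            (\<Sum>u\<in>S. \<psi> (\<epsilon> * (a * (u * u) + d * (v * v))))"
          using v k by (intro sum.reindex_bij_betw[OF translate_bij]) simp
        also have "\<dots> = (\<Sum>u\<in>S. \<psi> (\<epsilon> * a * (u * u)) * \<psi> (\<epsilon> * d * (v * v)))"
          using v d mem em by (intro sum.cong refl) (simp add: char_add[symmetric] ring_distribs mult.assoc)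
        finally show ?thesis .
      qed
      thus ?thesis by (simp add: gauss_def sum_product sum_distrib_left mult.commute)
    qed
    show ?thesis
      unfolding split unfolding f using sum[of 1] sum[of "-1"] gauss_product_neg[OF mem(1) d False] d0 False
      by simp
  next
    case True
    have *: "(\<Sum>v\<in>S. \<Sum>u\<in>S. \<psi> (\<epsilon> * f u v)) =
        (if b = 0 then of_nat (card S) * gauss (\<epsilon> * c) else of_nat (card S))" if e: "\<epsilon> = 1 \<or> \<epsilon> = -1" for \<epsilon>
    proof -
      have em: "\<epsilon> * x \<in> S" if "x \<in> S" for x using that \<open>\<epsilon> = 1 \<or> \<epsilon> = -1\<close> by auto
      have e0: "\<epsilon> * x = 0 \<longleftrightarrow> x = 0" for x using e by auto
      have "(\<Sum>u\<in>S. \<psi> (\<epsilon> * f u v)) = (if b = 0 \<or> v = 0 then of_nat (card S) * \<psi> (\<epsilon> * c * (v * v)) else 0)"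
        if v: "v \<in> S" for v
      proof -
        have "(\<Sum>u\<in>S. \<psi> (\<epsilon> * f u v)) = (\<Sum>u\<in>S. \<psi> (\<epsilon> * (2 * (b * v)) * u) * \<psi> (\<epsilon> * c * (v * v)))"
        proof (rule sum.cong[OF refl])
          fix u assume u: "u \<in> S"
          have "\<epsilon> * f u v = \<epsilon> * (2 * (b * v)) * u + \<epsilon> * c * (v * v)"
            by (simp add: f_def True algebra_simps)
          thus "\<psi> (\<epsilon> * f u v) = \<psi> (\<epsilon> * (2 * (b * v)) * u) * \<psi> (\<epsilon> * c * (v * v))"
            using u v mem em by (simp add: char_add)
        qed
        also have "\<dots> = \<psi> (\<epsilon> * c * (v * v)) * (\<Sum>u\<in>S. \<psi> (\<epsilon> * (2 * (b * v)) * u))"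
          by (simp add: sum_distrib_left mult.commute)
        finally show ?thesis using v mem em e0 sum_char[of "\<epsilon> * (2 * (b * v))"] by simp
      qed
      hence "(\<Sum>v\<in>S. \<Sum>u\<in>S. \<psi> (\<epsilon> * f u v)) =
          (\<Sum>v\<in>S. if b = 0 \<or> v = 0 then of_nat (card S) * \<psi> (\<epsilon> * c * (v * v)) else 0)" by simp
      thus ?thesis by (simp add: gauss_def sum_distrib_left)
    qed
    show ?thesis
      unfolding split using *[of 1] *[of "-1"] True nz gauss_neg[of c] mem by auto
  qed
qed

end

section \<open>Norm fibres, circle sums and the character sum of the quadric\<close>

context field_tower_character
begin

text \<open>Conjugation separates s from i t, whence injectivity; surjectivity is the count q^3 q^3
  = q^6.\<close>

lemma coordinates_bij:
  assumes i: "i \<in> K" "i * i = - e" "bar i = - i"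
  shows "bij_betw (\<lambda>(s, t). s + i * t) (E \<times> E) K"
proof -
  have inj: "inj_on (\<lambda>(s, t). s + i * t) (E \<times> E)"
  proof (rule inj_onI, clarify)
    fix s t s' t' assume st: "s \<in> E" "t \<in> E" "s' \<in> E" "t' \<in> E" and eq: "s + i * t = s' + i * t'"
    have "bar (s + i * t) = bar (s' + i * t')" using eq by simp
    hence eq': "s - i * t = s' - i * t'" using st i by simp
    have "2 * (s - s') = (s + i * t) - (s' + i * t') + ((s - i * t) - (s' - i * t'))" by (simp add: algebra_simps)
    hence "s = s'" using eq eq' two_K[of "s - s'"] st by simp
    moreover have "i \<noteq> 0" using i by auto
    ultimately show "s = s' \<and> t = t'" using eq st i K.mult_cancel[of t t' i] by simp
  qed
  moreover have "(\<lambda>(s, t). s + i * t) ` (E \<times> E) = K"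
  proof (rule card_subset_eq)
    show "(\<lambda>(s, t). s + i * t) ` (E \<times> E) \<subseteq> K" using i by auto
    show "card ((\<lambda>(s, t). s + i * t) ` (E \<times> E)) = card K"
      unfolding card_image[OF inj] by (simp add: card_cartesian_product card_E card_K power_add[symmetric])
  qed simp
  ultimately show ?thesis by (simp add: bij_betw_def)
qed

lemma sum_K_coordinates:
  fixes h :: "'b \<Rightarrow> complex"
  assumes i: "i \<in> K" "i * i = - e" "bar i = - i"
  shows "(\<Sum>y\<in>K. h y) = (\<Sum>s\<in>E. \<Sum>t\<in>E. h (s + i * t))"
  using sum.reindex_bij_betw[OF coordinates_bij[OF i], of h]
  by (simp add: sum.cartesian_product case_prod_unfold)

lemma N_coordinates:
  assumes i: "i \<in> K" "i * i = - e" "bar i = - i" and st: "s \<in> E" "t \<in> E"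
  shows "N (s + i * t) = s * s + t * t"
proof -
  have "(s + i * t) * (s - i * t) = s * s - (i * i) * (t * t)" by (simp add: algebra_simps)
  hence "N (s + i * t) = s * s - (i * i) * (t * t)" using i st by (simp add: N_def)
  thus ?thesis using i st by simp
qed

lemma psiK_square_coordinates:
  assumes i: "i \<in> K" "i * i = - e" "bar i = - i" and st: "s \<in> E" "t \<in> E"
  shows "\<psi>K ((s + i * t) * (s + i * t)) = \<psi>E (2 * (s * s) - 2 * (t * t))"
proof -
  have "(s + i * t) * (s + i * t) + (s - i * t) * (s - i * t) = 2 * (s * s) + 2 * ((i * i) * (t * t))"
    by (simp add: algebra_simps)
  hence "(s + i * t) * (s + i * t) + bar ((s + i * t) * (s + i * t)) = 2 * (s * s) + 2 * ((i * i) * (t * t))"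
    using i st by simp
  thus ?thesis using i st by (simp add: \<psi>K_def)
qed

lemma fiber_bij:
  assumes i: "i \<in> K" "i * i = - e" "bar i = - i"
  shows "bij_betw (\<lambda>(s, t). s + i * t) {(s, t) \<in> E \<times> E. s * s + t * t = a} {y \<in> K. N y = a}"
proof -
  have "(\<lambda>(s, t). s + i * t) ` {(s, t) \<in> E \<times> E. s * s + t * t = a} = {y \<in> K. N y = a}" (is "?f ` ?A = ?B")
  proof (intro equalityI subsetI)
    fix y assume y: "y \<in> ?B"
    hence "y \<in> ?f ` (E \<times> E)" using bij_betw_imp_surj_on[OF coordinates_bij[OF i]] by simp
    then obtain s t where "s \<in> E" "t \<in> E" "y = s + i * t" by auto
    thus "y \<in> ?f ` ?A" using N_coordinates[OF i] y by (auto intro!: image_eqI[of _ _ "(s, t)"])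
  qed (use N_coordinates[OF i] i in auto)
  moreover have "inj_on ?f ?A"
    by (rule inj_on_subset[OF bij_betw_imp_inj_on[OF coordinates_bij[OF i]]]) auto
  ultimately show ?thesis by (simp add: bij_betw_def)
qed

text \<open>The hyperbola s^2 - t^2 = a becomes u v = a and has q^3 - 1 points. Circle and hyperbola
  together have 2 q^3, which leaves q^3 + 1 for the circle, that is, for the norm fibre.\<close>

lemma card_fiber:
  assumes a: "a \<in> E" "a \<noteq> 0"
  shows "card {y \<in> K. N y = a} = q ^ 3 + 1"
proof -
  obtain i where i: "i \<in> K" "i * i = - e" "bar i = - i" using imaginary_unit .
  have q3: "1 \<le> q ^ 3" by (rule one_le_power) (use q_pos in linarith)
  have hyp: "complex_of_nat (card {(s, t) \<in> E \<times> E. s * s - t * t = a}) = of_nat (q ^ 3) - 1"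
  proof -
    have "complex_of_nat (card {(s, t) \<in> E \<times> E. s * s - t * t = a}) =
        (\<Sum>(s, t)\<in>E \<times> E. of_bool (s * s - t * t = a))"
      by (simp add: case_prod_unfold sum.If_cases of_bool_def Int_def mem_Times_iff)
    also have "\<dots> = (\<Sum>s\<in>E. \<Sum>t\<in>E. of_bool ((s + t) * (s - t) = a))"
      by (simp only: sum.cartesian_product square_diff_square_factored)
    also have "\<dots> = (\<Sum>u\<in>E. \<Sum>v\<in>E. of_bool (u * v = a))" by (rule E.sum_rotate)
    also have "\<dots> = (\<Sum>u\<in>E. of_bool (u \<noteq> 0))"
    proof (rule sum.cong[OF refl])
      fix u assume u: "u \<in> E"
      show "(\<Sum>v\<in>E. of_bool (u * v = a)) = (of_bool (u \<noteq> 0) :: complex)"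
      proof (cases "u = 0")
        case False
        have "u * v = a \<longleftrightarrow> v = E.recip u * a" if "v \<in> E" for v
          using E.mult_cancel[of v "E.recip u * a" u] u a False that by simp
        hence "(\<Sum>v\<in>E. of_bool (u * v = a)) = (\<Sum>v\<in>E. of_bool (v = E.recip u * a) :: complex)" by simp
        thus ?thesis using u a False by (simp add: of_bool_def)
      qed (use a in simp)
    qed
    also have "\<dots> = of_nat (q ^ 3) - 1"
      by (subst sum.remove[of _ 0]) (use q3 in \<open>simp_all add: of_bool_def card_E of_nat_diff\<close>)
    finally show ?thesis .
  qed
  have "complex_of_nat (card {(s, t) \<in> E \<times> E. s * s + t * t = a}) +
      of_nat (card {(s, t) \<in> E \<times> E. s * s - t * t = a}) = 2 * of_nat (q ^ 3)"
    using E.circle_plus_hyperbola[OF a(1), of "\<lambda>_. 1"] by (simp add: card_E)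
  hence "complex_of_nat (card {(s, t) \<in> E \<times> E. s * s + t * t = a}) = of_nat (q ^ 3 + 1)"
    unfolding hyp by (simp add: algebra_simps)
  hence "card {(s, t) \<in> E \<times> E. s * s + t * t = a} = q ^ 3 + 1" by (simp only: of_nat_eq_iff)
  thus ?thesis using bij_betw_same_card[OF fiber_bij[OF i]] by metis
qed

lemma N_surj: 
  assumes "a \<in> E"
  obtains y where "y \<in> K" "N y = a"
proof (cases "a = 0")
  case False
  hence "{y \<in> K. N y = a} \<noteq> {}" using card_fiber[OF assms] by (metis card.empty add_is_0 one_neq_zero)
  thus ?thesis using that by blast
qed (use that[of 0] in simp)

definition circle_sum :: "'b \<Rightarrow> complex" where
  "circle_sum a = (\<Sum>y\<in>{y \<in> K. N y = a}. \<psi>K (y * y))"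

text \<open>On the circle s^2 + t^2 = a the argument 2 s^2 - 2 t^2 equals 4 s^2 - 2 a, and so does 2
  s^2 + 2 t^2 on the hyperbola s^2 - t^2 = a. Both sums then depend on s alone and add up to a Gauss
  sum times a character value. Swapping s and t shows that the hyperbola sum is even in
  \<open>a\<close>, so it drops out of the difference.\<close>

lemma circle_sum_odd:
  assumes a: "a \<in> E"
  shows "circle_sum a - circle_sum (- a) = 2 * E.gauss e * (\<psi>E (- (2 * a)) - \<psi>E (2 * a))"
proof -
  obtain i where i: "i \<in> K" "i * i = - e" "bar i = - i" using imaginary_unit .
  define hyp where "hyp a = (\<Sum>(s, t)\<in>{(s, t) \<in> E \<times> E. s * s - t * t = a}. \<psi>E (2 * (s * s) + 2 * (t * t)))" for a
  have sym: "hyp a = hyp (- a)" for a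
    unfolding hyp_def
    by (rule sum.reindex_bij_witness[of _ "\<lambda>(s, t). (t, s)" "\<lambda>(s, t). (t, s)"])
       (auto simp: add.commute diff_eq_eq eq_diff_eq)
  have "circle_sum a + hyp a = 2 * E.gauss e * \<psi>E (- (2 * a))" if a: "a \<in> E" for a
  proof -
    have "circle_sum a = (\<Sum>(s, t)\<in>{(s, t) \<in> E \<times> E. s * s + t * t = a}. \<psi>K ((s + i * t) * (s + i * t)))"
      unfolding circle_sum_def
      by (subst sum.reindex_bij_betw[OF fiber_bij[OF i], symmetric]) (simp add: case_prod_unfold)
    also have "\<dots> = (\<Sum>(s, t)\<in>{(s, t) \<in> E \<times> E. s * s + t * t = a}. \<psi>E (4 * (s * s) + - (2 * a)))"
    proof (intro sum.cong refl, clarify)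
      fix s t assume st: "s \<in> E" "t \<in> E" "a = s * s + t * t"
      have "2 * (s * s) - 2 * (t * t) = 4 * (s * s) + - (2 * (s * s + t * t))" by (simp add: algebra_simps)
      thus "\<psi>K ((s + i * t) * (s + i * t)) = \<psi>E (4 * (s * s) + - (2 * (s * s + t * t)))"
        using psiK_square_coordinates[OF i st(1,2)] by simp
    qed
    finally have 1: "circle_sum a = \<dots>" .
    have 2: "hyp a = (\<Sum>(s, t)\<in>{(s, t) \<in> E \<times> E. s * s - t * t = a}. \<psi>E (4 * (s * s) + - (2 * a)))"
      unfolding hyp_def
    proof (intro sum.cong refl, clarify)
      fix s t :: 'b
      have "2 * (s * s) + 2 * (t * t) = 4 * (s * s) + - (2 * (s * s - t * t))" by (simp add: algebra_simps)
      thus "\<psi>E (2 * (s * s) + 2 * (t * t)) = \<psi>E (4 * (s * s) + - (2 * (s * s - t * t)))" by simp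
    qed
    have "(\<Sum>s\<in>E. \<psi>E (4 * (s * s) + - (2 * a))) = (\<Sum>s\<in>E. \<psi>E (4 * (s * s)) * \<psi>E (- (2 * a)))"
      using a by (intro sum.cong refl E.char_add) auto
    also have "\<dots> = (\<Sum>s\<in>E. \<psi>E (4 * (s * s))) * \<psi>E (- (2 * a))" by (simp add: sum_distrib_right)
    \<comment> \<open>4 is the square of 2 e and is absorbed by the Gauss sum.\<close>
    also have "(\<Sum>s\<in>E. \<psi>E (4 * (s * s))) = E.gauss (e * ((2 * e) * (2 * e)))"
    proof -
      have "(2 * e) * (2 * e) = 2 * (2 * (e * e))" by (simp only: mult.assoc mult.left_commute[of e 2])
      hence "e * ((2 * e) * (2 * e)) * (s * s) = 4 * (s * s)" if "s \<in> E" for s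
        using that by (simp add: mult.assoc)
      thus ?thesis unfolding E.gauss_def by simp
    qed
    also have "\<dots> = E.gauss e" by (rule E.gauss_mult_square) simp_all
    finally show ?thesis using E.circle_plus_hyperbola[OF a, of "\<lambda>s. \<psi>E (4 * (s * s) + - (2 * a))"] 1 2
      by simp
  qed
  from this[OF a] this[of "- a"] have
    1: "circle_sum a + hyp a = 2 * E.gauss e * \<psi>E (- (2 * a))" and
    2: "circle_sum (- a) + hyp (- a) = 2 * E.gauss e * \<psi>E (2 * a)" using a by simp_all
  have "circle_sum a - circle_sum (- a) = (circle_sum a + hyp a) - (circle_sum (- a) + hyp (- a))"
    using sym by simp
  thus ?thesis unfolding 1 2 by (simp add: algebra_simps)
qed

text \<open>In the coordinates s + i t this is the square of \<open>E.gauss c\<close>, so its sign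
  relative to \<open>E.gauss e\<close> disappears.\<close>

lemma sum_psiE_N:
  assumes c: "c \<in> E" "c \<noteq> 0"
  shows "(\<Sum>y\<in>K. \<psi>E (c * N y)) = - of_nat (q ^ 3)"
proof -
  obtain i where i: "i \<in> K" "i * i = - e" "bar i = - i" using imaginary_unit .
  have "(\<Sum>y\<in>K. \<psi>E (c * N y)) = (\<Sum>s\<in>E. \<Sum>t\<in>E. \<psi>E (c * (s * s)) * \<psi>E (c * (t * t)))"
    unfolding sum_K_coordinates[OF i]
    using c by (intro sum.cong refl) (simp add: N_coordinates[OF i] E.char_add[symmetric] ring_distribs)
  also have "\<dots> = E.gauss c * E.gauss c" unfolding E.gauss_def sum_product ..
  also have "\<dots> = E.gauss e * E.gauss e" using E.gauss_cases[OF c] by auto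
  finally show ?thesis by (simp add: E.gauss_square card_E)
qed

text \<open>Expand the condition Tr (N x) = 0 over the characters of \<open>F\<close>. For nonzero
  c, completing the square in the hermitian form c N x leaves the norm sum -q^3 times a character
  value at -N b / c; summing over all 1 / c produces the indicator of Tr (N b) = 0, so the quadric
  is its own dual.\<close>

lemma quadric_sum:
  assumes b: "b \<in> K" "b \<noteq> 0"
  shows "(\<Sum>x\<in>{x \<in> K. Tr (N x) = 0}. \<psi>K (b * x)) = of_nat q ^ 2 - of_nat q ^ 3 * of_bool (Tr (N b) = 0)"
proof -
  have ind: "(\<Sum>c\<in>F. \<psi> (t * c)) = of_nat q * of_bool (t = 0)" if "t \<in> F" for t
    using F.sum_char[OF that] by (simp add: card_F)
  have inner: "(\<Sum>x\<in>K. \<psi>E (c * N x) * \<psi>K (b * x)) =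
      - of_nat (q ^ 3) * \<psi>E (- (N b * F.recip c))" if c: "c \<in> F" "c \<noteq> 0" for c
  proof -
    define d where "d = F.recip c"
    have d: "d \<in> F" "c * d = e" unfolding d_def using c by simp_all
    \<comment> \<open>The shift that completes the square: c N (w + x) = c N x + (b x + bar (b x)) +
      N b / c.\<close>
    define w where "w = bar b * d"
    have w: "w \<in> K" "bar w = b * d" unfolding w_def using b d by simp_all
    have "\<psi>E (c * N x) * \<psi>K (b * x) = \<psi>E (c * N (w + x)) * \<psi>E (- (N b * d))" if x: "x \<in> K" for x
    proof -
      have "c * N (w + x) = c * N x + (c * d) * (b * x + bar b * bar x) + (c * d) * (N b * d)"
        using w x unfolding N_def by (simp add: w_def algebra_simps)
      also have "\<dots> = c * N x + (b * x + bar (b * x)) + N b * d" using d b x by simp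
      finally have "c * N x + (b * x + bar (b * x)) = c * N (w + x) + - (N b * d)" by (simp add: algebra_simps)
      moreover have "\<psi>E (c * N x) * \<psi>K (b * x) = \<psi>E (c * N x + (b * x + bar (b * x)))"
        unfolding \<psi>K_def using c b x by (intro E.char_add[symmetric]) (simp_all del: bar_mult)
      ultimately show ?thesis using c w x b d by (simp add: E.char_add[symmetric])
    qed
    hence "(\<Sum>x\<in>K. \<psi>E (c * N x) * \<psi>K (b * x)) = (\<Sum>x\<in>K. \<psi>E (c * N (w + x)) * \<psi>E (- (N b * d)))" by simp
    also have "\<dots> = (\<Sum>x\<in>K. \<psi>E (c * N (w + x))) * \<psi>E (- (N b * d))" by (simp add: sum_distrib_right)
    also have "(\<Sum>x\<in>K. \<psi>E (c * N (w + x))) = (\<Sum>x\<in>K. \<psi>E (c * N x))"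
      by (rule sum.reindex_bij_betw[OF K.translate_bij[OF w(1)]])
    finally show ?thesis using sum_psiE_N[of c] c by (simp add: d_def)
  qed
  have "of_nat q * (\<Sum>x\<in>{x \<in> K. Tr (N x) = 0}. \<psi>K (b * x)) =
      (\<Sum>x\<in>K. of_nat q * of_bool (Tr (N x) = 0) * \<psi>K (b * x))"
    by (simp add: sum_distrib_left of_bool_def if_distrib if_distribR sum.If_cases Int_def cong: if_cong)
  also have "\<dots> = (\<Sum>x\<in>K. (\<Sum>c\<in>F. \<psi> (Tr (N x) * c)) * \<psi>K (b * x))"
    by (intro sum.cong refl) (simp add: ind)
  also have "\<dots> = (\<Sum>c\<in>F. \<Sum>x\<in>K. \<psi>E (c * N x) * \<psi>K (b * x))"
    unfolding sum_distrib_right by (subst sum.swap) (simp add: \<psi>E_def mult.commute)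
  also have "\<dots> = (\<Sum>x\<in>K. \<psi>K (b * x)) + (\<Sum>c\<in>F - {0}. \<Sum>x\<in>K. \<psi>E (c * N x) * \<psi>K (b * x))"
    by (subst sum.remove[of _ 0]) simp_all
  also have "(\<Sum>x\<in>K. \<psi>K (b * x)) = 0" using K.sum_char b by simp
  also have "(\<Sum>c\<in>F - {0}. \<Sum>x\<in>K. \<psi>E (c * N x) * \<psi>K (b * x)) =
      (\<Sum>c\<in>F - {0}. - of_nat (q ^ 3) * \<psi>E (- (N b * F.recip c)))"
    by (intro sum.cong refl) (simp add: inner)
  also have "\<dots> = (\<Sum>c\<in>F - {0}. - of_nat (q ^ 3) * \<psi> (- Tr (N b) * c))"
  proof (rule sum.reindex_bij_witness[of _ F.recip F.recip])
    have rr: "F.recip (F.recip c) = c" if "c \<in> F - {0}" for c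
    proof -
      have "F.recip c * F.recip (F.recip c) = F.recip c * c" using that by (simp add: mult.commute[of _ c])
      thus ?thesis using that F.mult_cancel[of "F.recip (F.recip c)" c "F.recip c"] by simp
    qed
    fix c assume c: "c \<in> F - {0}"
    show "F.recip (F.recip c) = c" "F.recip (F.recip c) = c" "F.recip c \<in> F - {0}" "F.recip c \<in> F - {0}"
      using rr c by simp_all
    have "Tr (- (N b * F.recip c)) = - Tr (N b) * F.recip c"
      using c b Tr_scale[of "F.recip c" "N b"] by (simp add: mult.commute)
    thus "- of_nat (q ^ 3) * \<psi> (- Tr (N b) * F.recip c) = - of_nat (q ^ 3) * \<psi>E (- (N b * F.recip c))"
      by (simp add: \<psi>E_def)
  qed
  also have "\<dots> = - of_nat (q ^ 3) * ((\<Sum>c\<in>F. \<psi> (- Tr (N b) * c)) - 1)"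
    unfolding sum_distrib_left[symmetric] by (subst (2) sum.remove[of _ 0]) simp_all
  also have "\<dots> = of_nat q * (of_nat q ^ 2 - of_nat q ^ 3 * of_bool (Tr (N b) = 0))"
    using b by (subst ind) (simp_all add: algebra_simps power2_eq_square power3_eq_cube)
  finally show ?thesis using q_pos by simp
qed

end

section \<open>The half cone\<close>

context field_tower_character
begin

lemma half: "\<exists>h\<in>F. \<forall>x\<in>K. 2 * (h * x) = x"
proof -
  have nz: "2 * e \<noteq> 0" by simp
  define h where "h = F.recip (2 * e)"
  have h: "h \<in> F" "2 * h = e"
  proof -
    show "h \<in> F" unfolding h_def using nz by (intro F.recip_mem) simp_all
    thus "2 * h = e" using F.recip_right[of "2 * e"] nz by (simp add: h_def mult.assoc)
  qed
  have "2 * (h * x) = x" if "x \<in> K" for x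
    using that unfolding mult.assoc[symmetric] h by simp
  thus ?thesis using h by blast
qed

text \<open>Elements fr g - g have trace 0 and are squares up to sign, so a square root
  \<open>A\<close> of one of them, or of its negative, is isotropic. A partner of \<open>A\<close>
  is made isotropic by subtracting a multiple of \<open>A\<close>. The normalisation 2 e yields Tr
  (x^2) = 4 (a c - b^2) in the coordinates introduced below.\<close>

lemma hyperbolic_pair:
  obtains A C where "A \<in> E" "C \<in> E" "Tr (A * A) = 0" "Tr (C * C) = 0" "Tr (A * C) = 2 * e"
proof -
  obtain h where h': "h \<in> F" "\<forall>x\<in>K. 2 * (h * x) = x" using half by blast
  note h = h'(1) bspec[OF h'(2)]
  obtain x where x: "x \<in> E" "Tr x \<noteq> 0" using Tr_nontrivial by blast
  have "q ^ 1 < q ^ 3" using q_ge_3 by (intro power_strict_increasing) auto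
  hence "card F < card E" by (simp add: card_E card_F)
  hence "\<not> E \<subseteq> F" using card_mono[OF F.finite, of E] by auto
  then obtain g where "g \<in> E" "g \<notin> F" by blast
  hence g: "g \<in> E" "fr g \<noteq> g" using F_iff_E[of g] by blast+
  have "fr g - g \<in> E" using g by simp
  then obtain A where A: "A \<in> E" "fr g - g = A * A \<or> fr g - g = - (A * A)"
    using E.square_or_neg by blast
  have "Tr (fr g - g) = 0" using g by (simp add: Tr_def)
  hence AA: "Tr (A * A) = 0" using A(2) by auto
  have A0: "A \<noteq> 0" using A g by auto
  define C1 where "C1 = 2 * (F.recip (Tr x) * (E.recip A * x))"
  have C1: "C1 \<in> E" using A A0 x by (simp add: C1_def)
  have "A * C1 = 2 * (F.recip (Tr x) * (A * (E.recip A * x)))" by (simp add: C1_def algebra_simps)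
  hence "A * C1 = 2 * (F.recip (Tr x) * x)" using A A0 x by simp
  moreover have "F.recip (Tr x) * Tr x = e" by (subst mult.commute) (use x in simp)
  ultimately have AC1: "Tr (A * C1) = 2 * e" using x by simp
  \<comment> \<open>\<open>h\<close> is one half, so \<open>k\<close> is a quarter of Tr (C1^2);
    then 2 k Tr (A C1) cancels Tr (C1^2).\<close>
  define k where "k = h * (h * Tr (C1 * C1))"
  have k: "k \<in> F" using h C1 by (simp add: k_def)
  have "h * (2 * x) = x" if "x \<in> K" for x using h(2)[OF that] by (simp add: algebra_simps)
  hence k4: "2 * (2 * k) = Tr (C1 * C1)" unfolding k_def using h C1 by simp
  define C where "C = C1 - k * A"
  have C: "C \<in> E" using C1 k A by (simp add: C_def)
  have "A * C = A * C1 - k * (A * A)" by (simp add: C_def algebra_simps)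
  hence AC: "Tr (A * C) = 2 * e" using A C1 k AA AC1 by simp
  have "C * C = C1 * C1 - 2 * (k * (A * C1)) + k * (k * (A * A))"
    by (simp add: C_def algebra_simps)
  hence "Tr (C * C) = Tr (C1 * C1) - 2 * (k * (2 * e))" using A C1 k AA AC1 by simp
  moreover have "k * (2 * e) = 2 * (k * e)" by (simp only: mult.left_commute)
  ultimately have "Tr (C * C) = 0" using k4 k by simp
  thus ?thesis using that A(1) C AA AC by blast
qed

end

locale hemisystem = field_tower_character K e p f q \<omega> \<psi>
  for K :: "'b::comm_ring_1 set" and e p f q \<omega> \<psi> +
  fixes i \<nu> A C :: 'b
  assumes i: "i \<in> K" "i * i = - e" "bar i = - i"
    and nu: "\<nu> \<in> K" "N \<nu> = - e"
    and square_or_nu: "\<And>b. b \<in> K \<Longrightarrow> b \<noteq> 0 \<Longrightarrow> \<exists>z\<in>K. b = z * z \<or> b = \<nu> * (z * z)"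
    and AC [simp]: "A \<in> E" "C \<in> E" "Tr (A * A) = 0" "Tr (C * C) = 0" "Tr (A * C) = 2 * e"
begin

text \<open>The cross product of \<open>A\<close> and \<open>C\<close> with respect to the trace form.\<close>

definition "B = fr A * fr (fr C) - fr (fr A) * fr C"

lemma B_E [simp]: "B \<in> E"
  by (simp add: B_def)

lemma fr_B: "fr B = fr (fr A) * C - A * fr (fr C)" "fr (fr B) = A * fr C - fr A * C"
  by (simp_all add: B_def)

lemma B_orthogonal [simp]: "Tr (A * B) = 0" "Tr (B * C) = 0"
  by (simp_all add: Tr_def fr_B) (simp_all add: B_def algebra_simps)

text \<open>Lagrange's identity for the cross product: with x read as the vector of its three
  conjugates, Tr (x y) is the dot product.\<close>

lemma B_norm [simp]: "Tr (B * B) = - (4 * e)"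
proof -
  have "Tr (B * B) = Tr (A * A) * Tr (C * C) - Tr (A * C) * Tr (A * C)"
    by (simp add: Tr_def fr_B) (simp add: B_def algebra_simps)
  moreover have "(2 * e) * (2 * e) = 2 * (2 * (e * e))"
    by (simp only: mult.assoc mult.left_commute[of e 2])
  ultimately show ?thesis by simp
qed

lemma Tr_coordinates:
  assumes "a \<in> F" "b \<in> F" "c \<in> F" "a' \<in> F" "b' \<in> F" "c' \<in> F"
  shows "Tr ((a * A + b * B + c * C) * (a' * A + b' * B + c' * C)) =
    2 * (a * c') + 2 * (c * a') - 4 * (b * b')"
proof -
  have "(a * A + b * B + c * C) * (a' * A + b' * B + c' * C) =
    (a * a') * (A * A) + (a * b' + b * a') * (A * B) + (a * c' + c * a') * (A * C) +
    (b * b') * (B * B) + (b * c' + c * b') * (B * C) + (c * c') * (C * C)"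
    by (simp add: algebra_simps)
  also have "Tr \<dots> = (a * c' + c * a') * (2 * e) - (b * b') * (4 * e)"
    using assms by simp
  also have "\<dots> = 2 * ((a * c') * e) + 2 * ((c * a') * e) - 4 * ((b * b') * e)"
    by (simp add: algebra_simps)
  finally show ?thesis using assms by (simp del: mult.assoc)
qed

text \<open>Orthogonality to \<open>A\<close> and \<open>C\<close> makes r proportional to their
  cross product \<open>B\<close>. Hence r Tr (B B) = B Tr (r B) = 0, while Tr (B B) is
  nonzero.\<close>

lemma nondegenerate:
  assumes r: "r \<in> E" "Tr (r * A) = 0" "Tr (r * B) = 0" "Tr (r * C) = 0"
  shows "r = 0"
proof -
  have rA: "r * A + fr r * fr A + fr (fr r) * fr (fr A) = 0" using r by (simp add: Tr_def)
  have rC: "r * C + fr r * fr C + fr (fr r) * fr (fr C) = 0" using r by (simp add: Tr_def)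
  have rB: "r * B + fr r * fr B + fr (fr r) * fr (fr B) = 0" using r by (simp add: Tr_def)
  have "fr r * B - r * fr B = (r * A + fr r * fr A + fr (fr r) * fr (fr A)) * fr (fr C) -
      (r * C + fr r * fr C + fr (fr r) * fr (fr C)) * fr (fr A)"
    unfolding fr_B by (simp add: B_def algebra_simps)
  hence 1: "fr r * B = r * fr B" using rA rC by simp
  have "r * fr (fr B) - fr (fr r) * B = (r * A + fr r * fr A + fr (fr r) * fr (fr A)) * fr C -
      (r * C + fr r * fr C + fr (fr r) * fr (fr C)) * fr A"
    unfolding fr_B by (simp add: B_def algebra_simps)
  hence 2: "fr (fr r) * B = r * fr (fr B)" using rA rC by simp
  have "r * Tr (B * B) = r * B * B + (r * fr B) * fr B + (r * fr (fr B)) * fr (fr B)"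
    by (simp add: Tr_def algebra_simps)
  also have "\<dots> = B * (r * B + fr r * fr B + fr (fr r) * fr (fr B))"
    unfolding 1[symmetric] 2[symmetric] by (simp add: algebra_simps)
  finally have "r * (4 * e) = 0" using rB by simp
  moreover have "r * (4 * e) = 4 * (r * e)" by (simp only: mult.left_commute)
  ultimately show ?thesis using r by simp
qed

lemma coordinates:
  assumes w: "w \<in> E"
  obtains a b c where "a \<in> F" "b \<in> F" "c \<in> F" "w = a * A + b * B + c * C"
proof -
  obtain h where h': "h \<in> F" "\<forall>x\<in>K. 2 * (h * x) = x" using half by blast
  note h = h'(1) bspec[OF h'(2)]
  \<comment> \<open>The dual basis of A, B, C is C / 2, -B / 4, A / 2.\<close>
  define a where "a = h * Tr (w * C)"
  define c where "c = h * Tr (w * A)"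
  define b where "b = - (h * (h * Tr (w * B)))"
  have abc: "a \<in> F" "b \<in> F" "c \<in> F" using w h by (simp_all add: a_def b_def c_def)
  define u where "u = a * A + b * B + c * C"
  have u: "u \<in> E" using abc by (simp add: u_def)
  have eF: "e \<in> F" "0 \<in> F" by simp_all
  have t: "Tr (u * A) = 2 * c" "Tr (u * B) = - (4 * b)" "Tr (u * C) = 2 * a"
    using Tr_coordinates[OF abc eF(1) eF(2) eF(2)] Tr_coordinates[OF abc eF(2) eF(1) eF(2)]
      Tr_coordinates[OF abc eF(2) eF(2) eF(1)] abc by (simp_all add: u_def)
  have t': "Tr (w * A) = 2 * c" "Tr (w * C) = 2 * a" "Tr (w * B) = - (4 * b)"
  proof -
    show "Tr (w * A) = 2 * c" "Tr (w * C) = 2 * a" using h(2) w by (simp_all add: a_def c_def)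
    have "- (4 * b) = 2 * (2 * (h * (h * Tr (w * B))))" by (simp add: b_def)
    also have "2 * (h * (h * Tr (w * B))) = h * Tr (w * B)" using h w by simp
    also have "2 * (h * Tr (w * B)) = Tr (w * B)" using h w by simp
    finally show "Tr (w * B) = - (4 * b)" by simp
  qed
  have "w - u = 0"
  proof (rule nondegenerate)
    show "Tr ((w - u) * A) = 0" "Tr ((w - u) * B) = 0" "Tr ((w - u) * C) = 0"
      unfolding left_diff_distrib using w u by (simp_all only: Tr_diff E.mult_mem AC B_E t t' diff_self)
  qed (use w u in simp)
  thus ?thesis using that abc by (simp add: u_def)
qed

lemma coordinates_eq:
  assumes "a \<in> F" "b \<in> F" "c \<in> F" "a' \<in> F" "b' \<in> F" "c' \<in> F"
    and eq: "a * A + b * B + c * C = a' * A + b' * B + c' * C"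
  shows "a = a'" "b = b'" "c = c'"
proof -
  define u where "u = (a - a') * A + (b - b') * B + (c - c') * C"
  have u: "u = 0" using eq by (simp add: u_def algebra_simps)
  have m: "a - a' \<in> F" "b - b' \<in> F" "c - c' \<in> F" using assms by simp_all
  have eF: "e \<in> F" "0 \<in> F" by simp_all
  have "2 * (c - c') = Tr (u * A)" "- (4 * (b - b')) = Tr (u * B)" "2 * (a - a') = Tr (u * C)"
    using Tr_coordinates[OF m eF(1) eF(2) eF(2)] Tr_coordinates[OF m eF(2) eF(1) eF(2)]
      Tr_coordinates[OF m eF(2) eF(2) eF(1)] m by (simp_all add: u_def)
  hence "2 * (c - c') = 0" "4 * (b - b') = 0" "2 * (a - a') = 0" unfolding u by simp_all
  hence "c - c' = 0" "b - b' = 0" "a - a' = 0"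
    using F.two_mult[OF m(3)] F.four_mult[OF m(2)] F.two_mult[OF m(1)] by blast+
  thus "a = a'" "b = b'" "c = c'" by simp_all
qed

text \<open>The Veronese parametrisation of the conic a c = b^2, which is the isotropy condition in
  these coordinates. Having squares as outer coefficients singles out one half of the cone.\<close>

definition \<phi> :: "'b \<times> 'b \<Rightarrow> 'b" where
  "\<phi> = (\<lambda>(u, v). (u * u) * A + (u * v) * B + (v * v) * C)"

definition "F2 = F \<times> F - {(0, 0)}"

definition "P = \<phi> ` F2"

lemma phi_E [simp]: "u \<in> F \<Longrightarrow> v \<in> F \<Longrightarrow> \<phi> (u, v) \<in> E"
  by (simp add: \<phi>_def)

text \<open>On tensor squares the form is twice the square of a determinant. Hence any two points of
  \<open>P\<close> pair to twice a square, the property that finally rules out coincidences between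
  multiples of \<open>P\<close>.\<close>

lemma Tr_phi:
  assumes "u \<in> F" "v \<in> F" "u' \<in> F" "v' \<in> F"
  shows "Tr (\<phi> (u, v) * \<phi> (u', v')) = 2 * ((u * v' - v * u') * (u * v' - v * u'))"
proof -
  have "Tr (\<phi> (u, v) * \<phi> (u', v')) =
      2 * ((u * u) * (v' * v')) + 2 * ((v * v) * (u' * u')) - 4 * ((u * v) * (u' * v'))"
    unfolding \<phi>_def prod.case using assms by (intro Tr_coordinates) simp_all
  thus ?thesis by (simp only:) (simp add: algebra_simps)
qed

lemma P_E [simp]: "x \<in> P \<Longrightarrow> x \<in> E"
  by (auto simp: P_def F2_def)

lemma finite_P [simp]: "finite P"
  by (simp add: P_def F2_def)

lemma Tr_P:
  assumes "x \<in> P" "y \<in> P"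
  shows "\<exists>t\<in>F. Tr (x * y) = 2 * (t * t)"
  using assms unfolding P_def F2_def by (fastforce simp: Tr_phi)

lemma phi_eq:
  assumes "x \<in> F2" "y \<in> F2"
  shows "\<phi> x = \<phi> y \<longleftrightarrow> y = x \<or> y = (- fst x, - snd x)"
proof
  obtain u v where x: "x = (u, v)" "u \<in> F" "v \<in> F" using assms by (auto simp: F2_def)
  obtain u' v' where y: "y = (u', v')" "u' \<in> F" "v' \<in> F" using assms by (auto simp: F2_def)
  assume "\<phi> x = \<phi> y"
  hence eq: "u * u = u' * u'" "u * v = u' * v'" "v * v = v' * v'"
    using coordinates_eq[of "u * u" "u * v" "v * v" "u' * u'" "u' * v'" "v' * v'"] x y
    by (simp_all add: \<phi>_def)
  have u: "u' = u \<or> u' = - u" using eq(1) F.square_eq_square x y by simp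
  show "y = x \<or> y = (- fst x, - snd x)"
  proof (cases "u = 0")
    case True
    hence "u' = 0" using u by auto
    thus ?thesis using eq(3) F.square_eq_square[of v v'] True x y by simp
  next
    case False
    have "u' = u \<Longrightarrow> v' = v" using eq(2) F.mult_cancel[of v v' u] x y False by simp
    moreover have "u' = - u \<Longrightarrow> v' = - v" using eq(2) F.mult_cancel[of v "- v'" u] x y False by auto
    ultimately show ?thesis using u x y by auto
  qed
next
  assume "y = x \<or> y = (- fst x, - snd x)"
  thus "\<phi> x = \<phi> y" by (auto simp: \<phi>_def case_prod_unfold)
qed

lemma F2_involution: "x \<in> F2 \<Longrightarrow> (- fst x, - snd x) \<in> F2" "x \<in> F2 \<Longrightarrow> (- fst x, - snd x) \<noteq> x"
  by (auto simp: F2_def)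

lemma finite_F2: "finite F2" by (simp add: F2_def)

lemma card_P: "2 * card P = q ^ 2 - 1"
proof -
  have "card F2 = q ^ 2 - 1"
    unfolding F2_def by (subst card_Diff_singleton) (simp_all add: card_cartesian_product card_F power2_eq_square)
  thus ?thesis
    using card_two_to_one[OF finite_F2 F2_involution phi_eq] by (simp add: P_def)
qed

lemma P_nonzero: "x \<in> P \<Longrightarrow> x \<noteq> 0"
proof -
  assume "x \<in> P"
  then obtain u v where uv: "u \<in> F" "v \<in> F" "(u, v) \<noteq> (0, 0)" "x = \<phi> (u, v)"
    by (auto simp: P_def F2_def)
  have "x = 0 \<Longrightarrow> u * u = 0 \<and> v * v = 0"
    using coordinates_eq[of "u * u" "u * v" "v * v" 0 0 0] uv by (simp add: \<phi>_def)
  thus ?thesis using uv by auto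
qed

lemma P_isotropic: "x \<in> P \<Longrightarrow> Tr (x * x) = 0"
  by (auto simp: P_def F2_def Tr_phi algebra_simps)

lemma P_disjoint: "x \<in> P \<Longrightarrow> - x \<notin> P"
proof
  assume "x \<in> P" "- x \<in> P"
  then obtain u v u' v' where uv: "u \<in> F" "v \<in> F" "(u, v) \<noteq> (0, 0)" "x = \<phi> (u, v)"
    "u' \<in> F" "v' \<in> F" "- x = \<phi> (u', v')" by (auto simp: P_def F2_def)
  have eq: "- (u * u) * A + - (u * v) * B + - (v * v) * C = (u' * u') * A + (u' * v') * B + (v' * v') * C"
    using uv(4,7) by (simp add: \<phi>_def algebra_simps)
  have "- (u * u) = u' * u'" by (rule coordinates_eq(1)[OF _ _ _ _ _ _ eq]) (use uv in simp_all)
  moreover have "- (v * v) = v' * v'" by (rule coordinates_eq(3)[OF _ _ _ _ _ _ eq]) (use uv in simp_all)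
  ultimately have "u = 0" "v = 0" using F.square_eq_neg_square[of u' u] F.square_eq_neg_square[of v' v] uv by simp_all
  thus False using uv by simp
qed

text \<open>Isotropy reads a c = b^2, so \<open>a\<close> or \<open>c\<close> is nonzero, and it is
  plus or minus a square t^2; negating \<open>x\<close> makes the sign positive. The parameters are
  (t, b / t) if \<open>a\<close> is nonzero and (0, t) otherwise.\<close>

lemma cone_cases:
  assumes x: "x \<in> E" "x \<noteq> 0" "Tr (x * x) = 0"
  shows "x \<in> P \<or> - x \<in> P"
proof -
  have main: "x \<in> P" if abc: "a \<in> F" "b \<in> F" "c \<in> F" "x = a * A + b * B + c * C" and ac: "a * c = b * b"
    and t: "t \<in> F" "t \<noteq> 0" "a = t * t \<or> a = 0 \<and> c = t * t" for a b c t x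
  proof (cases "a = 0")
    case True
    hence "b = 0" "c = t * t" using ac abc t by auto
    hence "x = \<phi> (0, t)" using True abc by (simp add: \<phi>_def)
    thus ?thesis using t by (auto simp: P_def F2_def)
  next
    case False
    define v where "v = F.recip t * b"
    have v: "v \<in> F" "t * v = b" using t abc by (simp_all add: v_def)
    have "(t * t) * (v * v) = (t * v) * (t * v)" by (simp add: algebra_simps)
    also have "\<dots> = (t * t) * c" using ac False t v by auto
    finally have "v * v = c" using F.mult_cancel[of "v * v" c "t * t"] t v abc by simp
    hence "x = \<phi> (t, v)" using v False t abc by (simp add: \<phi>_def)
    thus ?thesis using t v by (auto simp: P_def F2_def)
  qed
  obtain a b c where abc: "a \<in> F" "b \<in> F" "c \<in> F" "x = a * A + b * B + c * C" using coordinates x by blast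
  have "4 * (a * c - b * b) = Tr (x * x)"
    unfolding abc(4) Tr_coordinates[OF abc(1-3) abc(1-3)] by (simp add: algebra_simps)
  hence "4 * (a * c - b * b) = 0" by (simp only: x(3))
  moreover have "a * c - b * b \<in> F" using abc by simp
  ultimately have "a * c - b * b = 0" using F.four_mult by blast
  hence ac: "a * c = b * b" by simp
  have "a \<noteq> 0 \<or> c \<noteq> 0" using ac abc x by auto
  then obtain d where d: "d \<in> F" "d \<noteq> 0" "d = a \<or> a = 0 \<and> d = c" using abc by blast
  obtain t where t: "t \<in> F" "d = t * t \<or> d = - (t * t)" using F.square_or_neg d by blast
  have t0: "t \<noteq> 0" using t d by auto
  from t(2) show ?thesis
  proof
    assume "d = t * t"
    thus ?thesis using main[OF abc ac t(1) t0] d by auto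
  next
    assume dt: "d = - (t * t)"
    have "- x = (- a) * A + (- b) * B + (- c) * C" using abc by simp
    thus ?thesis using main[of "- a" "- b" "- c" "- x" t] abc ac t t0 d dt by auto
  qed
qed

text \<open>The Fourier transform of the signed cone: weight 1 on \<open>P\<close>, weight -1 on its
  negative.\<close>

definition H :: "'b \<Rightarrow> complex" where
  "H w = (\<Sum>x\<in>P. \<psi>E (w * x) - \<psi>E (- (w * x)))"

text \<open>Pulled back along \<phi>, Tr (w x) is a binary quadratic form whose discriminant
  vanishes iff w is isotropic, so only rank one forms contribute. The factor
  \<open>E.gauss e\<close> is the one that the circle sums supply. The product of a Gauss sum over
  \<open>E\<close> and one over \<open>F\<close> squares to (-q^3)(-q) = q^4, so it is q^2 up to a
  sign left open.\<close>

lemma H_value: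
  assumes w: "w \<in> E" "w \<noteq> 0"
  shows "\<exists>\<kappa>::int. E.gauss e * H w = of_nat q ^ 3 * of_int \<kappa> \<and> \<bar>\<kappa>\<bar> = of_bool (Tr (w * w) = 0)"
proof -
  obtain a b c where abc: "a \<in> F" "b \<in> F" "c \<in> F" "w = a * A + b * B + c * C" using coordinates w by blast
  have nz: "2 * c \<noteq> 0 \<or> - (2 * b) \<noteq> 0 \<or> 2 * a \<noteq> 0" using abc w by auto
  have form: "Tr (w * \<phi> (u, v)) = (2 * c) * (u * u) + 2 * (- (2 * b) * (u * v)) + (2 * a) * (v * v)"
    if "u \<in> F" "v \<in> F" for u v
  proof -
    have "Tr (w * \<phi> (u, v)) = 2 * (a * (v * v)) + 2 * (c * (u * u)) - 4 * (b * (u * v))"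
      unfolding abc(4) \<phi>_def prod.case using that abc by (intro Tr_coordinates) simp_all
    thus ?thesis by (simp only:) (simp add: algebra_simps)
  qed
  have "2 * H w = (\<Sum>x\<in>F2. \<psi>E (w * \<phi> x) - \<psi>E (- (w * \<phi> x)))"
    unfolding H_def P_def
    by (rule sum_two_to_one[OF finite_F2 F2_involution phi_eq, symmetric])
  \<comment> \<open>The origin contributes 1 - 1 = 0, so it may be added.\<close>
  also have "\<dots> = (\<Sum>x\<in>F \<times> F. \<psi>E (w * \<phi> x) - \<psi>E (- (w * \<phi> x)))"
    unfolding F2_def by (subst (2) sum.remove[of _ "(0, 0)"]) (simp_all add: \<phi>_def)
  also have "\<dots> = (\<Sum>u\<in>F. \<Sum>v\<in>F. \<psi>E (w * \<phi> (u, v)) - \<psi>E (- (w * \<phi> (u, v))))"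
    by (simp add: sum.cartesian_product)
  also have "\<dots> = (\<Sum>u\<in>F. \<Sum>v\<in>F.
      \<psi> ((2 * c) * (u * u) + 2 * (- (2 * b) * (u * v)) + (2 * a) * (v * v)) -
      \<psi> (- ((2 * c) * (u * u) + 2 * (- (2 * b) * (u * v)) + (2 * a) * (v * v))))"
    by (intro sum.cong refl) (simp only: \<psi>E_def Tr_minus form)
  also have "\<dots> = (if (2 * c) * (2 * a) = (- (2 * b)) * (- (2 * b)) then
      2 * of_nat (card F) * F.gauss (if 2 * c = 0 then 2 * a else 2 * c) else 0)"
    using abc nz by (intro F.binary_form_sum) simp_all
  finally have "2 * H w = \<dots>" .
  moreover have "(2 * c) * (2 * a) = (- (2 * b)) * (- (2 * b)) \<longleftrightarrow> Tr (w * w) = 0"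
  proof -
    have "Tr (w * w) = (2 * c) * (2 * a) - (- (2 * b)) * (- (2 * b))"
      unfolding abc(4) Tr_coordinates[OF abc(1-3) abc(1-3)] by (simp add: algebra_simps)
    thus ?thesis by auto
  qed
  ultimately have Hw: "H w = (if Tr (w * w) = 0 then of_nat q * F.gauss (if 2 * c = 0 then 2 * a else 2 * c) else 0)"
    by (auto simp: card_F split: if_splits)
  show ?thesis
  proof (cases "Tr (w * w) = 0")
    case False
    thus ?thesis using Hw by (intro exI[of _ 0]) simp
  next
    case True
    define d where "d = (if 2 * c = 0 then 2 * a else 2 * c)"
    have d: "d \<in> F" "d \<noteq> 0"
    proof -
      show "d \<in> F" using abc by (simp add: d_def)
      have "a \<noteq> 0 \<or> c \<noteq> 0"
      proof (rule ccontr)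
        assume "\<not> ?thesis"
        hence "Tr (w * w) = - (4 * (b * b))"
          unfolding abc(4) Tr_coordinates[OF abc(1-3) abc(1-3)] by (simp add: algebra_simps)
        hence "b = 0" using True abc by simp
        thus False using \<open>\<not> (a \<noteq> 0 \<or> c \<noteq> 0)\<close> nz by simp
      qed
      thus "d \<noteq> 0" using abc by (auto simp: d_def)
    qed
    define g where "g = E.gauss e * F.gauss e"
    have "g * g = (E.gauss e * E.gauss e) * (F.gauss e * F.gauss e)" by (simp add: g_def)
    also have "\<dots> = of_nat q ^ 2 * of_nat q ^ 2"
      unfolding E.gauss_square F.gauss_square by (simp add: card_E card_F power2_eq_square power3_eq_cube)
    finally have "g = of_nat q ^ 2 \<or> g = - (of_nat q ^ 2)" by (simp only: square_eq_iff)
    moreover have "E.gauss e * F.gauss d = g \<or> E.gauss e * F.gauss d = - g"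
      using F.gauss_cases[OF d] by (auto simp: g_def)
    ultimately have "E.gauss e * F.gauss d = of_nat q ^ 2 \<or> E.gauss e * F.gauss d = - (of_nat q ^ 2)" by auto
    moreover have HW: "E.gauss e * H w = of_nat q * (E.gauss e * F.gauss d)" using Hw True by (simp add: d_def)
    ultimately have "E.gauss e * H w = of_nat q ^ 3 * of_int 1 \<or> E.gauss e * H w = of_nat q ^ 3 * of_int (-1)"
      unfolding HW by (elim disjE) (simp_all add: power2_eq_square power3_eq_cube)
    thus ?thesis using True by (auto intro: exI[of _ 1] exI[of _ "-1"])
  qed
qed

end

section \<open>Fourier transform of the hemisystem\<close>

context hemisystem
begin

lemma nu_nz [simp]: "\<nu> \<noteq> 0" using nu by auto

lemma N_e [simp]: "N e = e" by (simp add: N_def)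

lemma N_bar [simp]: "x \<in> K \<Longrightarrow> N (bar x) = N x"
  by (simp add: N_def mult.commute)

lemma N_i [simp]: "N i = e"
  by (simp add: N_def i)

lemma psiK_bar: "x \<in> K \<Longrightarrow> \<psi>K (bar x) = \<psi>K x"
  by (simp add: \<psi>K_def add.commute)

text \<open>Summing over \<open>y\<close> rather than over the values y^2 meets every square twice;
  the division by 2 is postponed to the end.\<close>

definition V :: "'b set \<Rightarrow> 'b \<Rightarrow> complex" where
  "V Q b = (\<Sum>y\<in>{y \<in> K. N y \<in> Q}. \<psi>K (b * (y * y)))"

lemma circle_sum_scale:
  assumes z: "z \<in> K" "z \<noteq> 0" and x: "x \<in> E"
  shows "(\<Sum>y\<in>{y \<in> K. N y = x}. \<psi>K (z * z * (y * y))) = circle_sum (x * N z)"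
proof -
  have "bij_betw ((*) z) {y \<in> K. N y = x} {y \<in> K. N y = x * N z}"
  proof (rule bij_betwI[where g = "\<lambda>y. K.recip z * y"])
    show "(*) z \<in> {y \<in> K. N y = x} \<rightarrow> {y \<in> K. N y = x * N z}"
      using z by (auto simp: mult.commute)
    have "N (K.recip z * y) = x" if "y \<in> K" "N y = x * N z" for y
    proof -
      have "N z * N (K.recip z * y) = N (z * (K.recip z * y))" by (simp only: N_mult)
      also have "\<dots> = N y" by (subst K.div_mult) (use that z in simp_all)
      also have "\<dots> = N z * x" using that by (simp add: mult.commute)
      finally have "N z * N (K.recip z * y) = N z * x" .
      thus ?thesis using that z x E.mult_cancel[of "N (K.recip z * y)" x "N z"] by simp
    qed
    thus "(\<lambda>y. K.recip z * y) \<in> {y \<in> K. N y = x * N z} \<rightarrow> {y \<in> K. N y = x}"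
      using z by auto
  qed (use z in \<open>auto simp: mult.left_commute[of "K.recip z"]\<close>)
  from sum.reindex_bij_betw[OF this, of "\<lambda>y. \<psi>K (y * y)"]
  show ?thesis unfolding circle_sum_def by (simp add: mult_ac)
qed

lemma V_square:
  assumes z: "z \<in> K" "z \<noteq> 0" and Q: "finite Q" "Q \<subseteq> E"
  shows "V Q (z * z) = (\<Sum>x\<in>Q. circle_sum (x * N z))"
proof -
  have "V Q (z * z) = (\<Sum>x\<in>Q. \<Sum>y\<in>{y \<in> {y \<in> K. N y \<in> Q}. N y = x}. \<psi>K (z * z * (y * y)))"
    unfolding V_def using Q by (intro sum.group[symmetric]) auto
  also have "\<dots> = (\<Sum>x\<in>Q. \<Sum>y\<in>{y \<in> K. N y = x}. \<psi>K (z * z * (y * y)))"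
    by (intro sum.cong refl) auto
  also have "\<dots> = (\<Sum>x\<in>Q. circle_sum (x * N z))"
    using z Q by (intro sum.cong refl circle_sum_scale) auto
  finally show ?thesis .
qed

definition "P' = uminus ` P"

lemma P'_iff: "x \<in> P' \<longleftrightarrow> - x \<in> P"
  by (force simp: P'_def)

lemma P'_sub: "finite P'" "P' \<subseteq> E" by (auto simp: P'_def)

text \<open>At a square argument, z is absorbed into y, which leaves circle sums at x N z; their odd
  part is a Gauss sum times the transform of the signed cone.\<close>

lemma V_square_diff:
  assumes z: "z \<in> K" "z \<noteq> 0"
  shows "V P (z * z) - V P' (z * z) = - 2 * (E.gauss e * H (2 * N z))"
proof -
  have "V P' (z * z) = (\<Sum>x\<in>P. circle_sum (- (x * N z)))"
    unfolding V_square[OF z P'_sub] unfolding P'_def by (subst sum.reindex) (auto simp: inj_on_def)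
  hence "V P (z * z) - V P' (z * z) = (\<Sum>x\<in>P. circle_sum (x * N z) - circle_sum (- (x * N z)))"
    using V_square[OF z finite_P] by (simp add: sum_subtractf subset_iff)
  also have "\<dots> = (\<Sum>x\<in>P. 2 * E.gauss e * (\<psi>E (- (2 * (x * N z))) - \<psi>E (2 * (x * N z))))"
    using z by (intro sum.cong refl circle_sum_odd) simp
  also have "\<dots> = (\<Sum>x\<in>P. - 2 * E.gauss e * (\<psi>E (2 * N z * x) - \<psi>E (- (2 * N z * x))))"
    by (intro sum.cong refl) (simp add: algebra_simps)
  finally show ?thesis by (simp add: H_def sum_distrib_left mult.assoc)
qed

lemma V_indicator: "V Q b = (\<Sum>y\<in>K. of_bool (N y \<in> Q) * \<psi>K (b * (y * y)))"
  unfolding V_def by (rule sum.mono_neutral_cong_left) auto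

text \<open>The substitution \<open>y \<mapsto> \<mu> bar y\<close> negates \<open>N y\<close> and conjugates the argument of the character.\<close>

lemma V_nonsquare:
  assumes z: "z \<in> K" "z \<noteq> 0"
  shows "V P (\<nu> * (z * z)) = V P' (\<nu> * (z * z))"
proof -
  \<comment> \<open>Chosen so that \<nu> z \<mu> = i bar z. Norms then give N \<mu> = -e, and
    squaring, with i^2 = -e = N \<nu>, gives the conjugated argument.\<close>
  define \<mu> where "\<mu> = K.recip z * (K.recip \<nu> * (i * bar z))"
  have mu: "\<mu> \<in> K" "\<nu> * (z * \<mu>) = i * bar z"
    unfolding \<mu>_def using z nu i by simp_all
  have "N z * (- e * N \<mu>) = N z * e"
  proof -
    have "N (\<nu> * (z * \<mu>)) = N (i * bar z)" using mu by simp
    thus ?thesis using z nu mu by (simp add: algebra_simps)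
  qed
  hence Nmu: "N \<mu> = - e" using E.mult_cancel[of "- e * N \<mu>" e "N z"] z mu by (simp add: minus_equation_iff)
  hence mu0: "\<mu> \<noteq> 0" by auto
  have "bij_betw bar K K" by (rule bij_betwI[where g = bar]) auto
  hence bij: "bij_betw ((*) \<mu> \<circ> bar) K K"
    by (rule bij_betw_trans) (rule K.scale_bij[OF mu(1) mu0])
  have arg: "\<nu> * (z * z) * ((\<mu> * bar y) * (\<mu> * bar y)) = bar (\<nu> * (z * z) * (y * y))" if y: "y \<in> K" for y
  proof -
    have "\<nu> * (\<nu> * (z * z) * ((\<mu> * bar y) * (\<mu> * bar y))) =
        (\<nu> * (z * \<mu>)) * (\<nu> * (z * \<mu>)) * (bar y * bar y)" by (simp add: algebra_simps)
    also have "\<dots> = (i * i) * (bar z * bar z * (bar y * bar y))" unfolding mu by (simp add: algebra_simps)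
    also have "\<dots> = N \<nu> * (bar z * bar z * (bar y * bar y))" by (simp add: i nu)
    also have "\<dots> = \<nu> * bar (\<nu> * (z * z) * (y * y))" by (simp add: N_def algebra_simps)
    finally show ?thesis using y z mu nu by (subst (asm) K.mult_cancel) simp_all
  qed
  have "V P' (\<nu> * (z * z)) =
      (\<Sum>y\<in>K. of_bool (N (((*) \<mu> \<circ> bar) y) \<in> P') * \<psi>K (\<nu> * (z * z) * (((*) \<mu> \<circ> bar) y * ((*) \<mu> \<circ> bar) y)))"
    unfolding V_indicator by (rule sum.reindex_bij_betw[OF bij, symmetric])
  also have "\<dots> = (\<Sum>y\<in>K. of_bool (N y \<in> P) * \<psi>K (\<nu> * (z * z) * (y * y)))"
  proof (rule sum.cong[OF refl])
    fix y assume y: "y \<in> K"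
    have "N (\<mu> * bar y) = - N y" using y Nmu by simp
    moreover have "\<psi>K (\<nu> * (z * z) * ((\<mu> * bar y) * (\<mu> * bar y))) = \<psi>K (\<nu> * (z * z) * (y * y))"
      unfolding arg[OF y] using y z nu by (intro psiK_bar) simp
    ultimately show "of_bool (N (((*) \<mu> \<circ> bar) y) \<in> P') *
        \<psi>K (\<nu> * (z * z) * (((*) \<mu> \<circ> bar) y * ((*) \<mu> \<circ> bar) y)) =
        of_bool (N y \<in> P) * \<psi>K (\<nu> * (z * z) * (y * y))"
      by (simp add: P'_iff)
  qed
  finally show ?thesis by (simp add: V_indicator)
qed

lemma K_square_eq:
  assumes "x \<in> K" "y \<in> K"
  shows "x * x = y * y \<longleftrightarrow> y = x \<or> y = - x"
proof -
  have "x * x = y * y \<longleftrightarrow> (y - x) * (y + x) = 0" by (auto simp: algebra_simps)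
  thus ?thesis using assms by (simp add: eq_neg_iff_add_eq_0)
qed

lemma K_neg_neq: "x \<in> K \<Longrightarrow> x \<noteq> 0 \<Longrightarrow> - x \<noteq> x"
  using two_nz[of x] neg_eq_iff_add_eq_0[of x x] by blast

lemma square_neq_nonsquare:
  assumes "x \<in> K" "y \<in> K" "y \<noteq> 0"
  shows "x * x \<noteq> \<nu> * (y * y)"
proof
  assume "x * x = \<nu> * (y * y)"
  hence "N x * N x = - (N y * N y)" using assms nu by (metis N_mult N_E E.unit E.mult_mem mult_minus_left)
  thus False using E.square_eq_neg_square[of "N x" "N y"] assms by simp
qed

text \<open>Because of the sign of y both parametrisations are two to one, and norms keep squares
  and \<nu>-multiples of squares apart.\<close>

lemma sum_squares_nonsquares:
  fixes h :: "'b \<Rightarrow> complex"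
  assumes X: "X \<subseteq> K" "0 \<notin> X" and neg: "\<And>y. y \<in> X \<Longrightarrow> - y \<in> X"
  shows "(\<Sum>y\<in>X. h (y * y)) + (\<Sum>y\<in>X. h (\<nu> * (y * y))) =
    2 * (\<Sum>x\<in>(\<lambda>y. y * y) ` X \<union> (\<lambda>y. \<nu> * (y * y)) ` X. h x)"
proof -
  have fin: "finite X" by (rule finite_subset[OF X(1)]) simp
  have XK: "y \<in> X \<Longrightarrow> y \<in> K \<and> y \<noteq> 0" for y using X by auto
  have 1: "(\<Sum>y\<in>X. h (y * y)) = 2 * (\<Sum>x\<in>(\<lambda>y. y * y) ` X. h x)"
    using XK K_neg_neq K_square_eq by (intro sum_two_to_one[OF fin neg]) blast+
  have 2: "(\<Sum>y\<in>X. h (\<nu> * (y * y))) = 2 * (\<Sum>x\<in>(\<lambda>y. \<nu> * (y * y)) ` X. h x)"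
  proof (rule sum_two_to_one[OF fin neg])
    show "- x \<noteq> x" if "x \<in> X" for x using XK[OF that] K_neg_neq by blast
    show "\<nu> * (x * x) = \<nu> * (y * y) \<longleftrightarrow> y = x \<or> y = - x" if "x \<in> X" "y \<in> X" for x y
      using XK[OF that(1)] XK[OF that(2)] nu K.mult_cancel[of "x * x" "y * y" \<nu>] K_square_eq[of x y] by simp
  qed
  have "(\<lambda>y. y * y) ` X \<inter> (\<lambda>y. \<nu> * (y * y)) ` X = {}"
    using XK square_neq_nonsquare by blast
  hence "(\<Sum>x\<in>(\<lambda>y. y * y) ` X \<union> (\<lambda>y. \<nu> * (y * y)) ` X. h x) =
      (\<Sum>x\<in>(\<lambda>y. y * y) ` X. h x) + (\<Sum>x\<in>(\<lambda>y. \<nu> * (y * y)) ` X. h x)"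
    using fin by (intro sum.union_disjoint) auto
  thus ?thesis using 1 2 by simp
qed

text \<open>N (y^2) = N(y)^2 and N (\<nu> y^2) = - N(y)^2, so the y with N y on either half cone
  parametrise the whole quadric Tr (N x) = 0 except 0; the missing point accounts for the
  -1.\<close>

lemma V_total:
  assumes b: "b \<in> K" "b \<noteq> 0"
  shows "V P b + V P' b + V P (\<nu> * b) + V P' (\<nu> * b) =
    2 * (of_nat q ^ 2 - 1 - of_nat q ^ 3 * of_bool (Tr (N b) = 0))"
proof -
  define X where "X = {y \<in> K. y \<noteq> 0 \<and> Tr (N y * N y) = 0}"
  have X: "X = {y \<in> K. N y \<in> P} \<union> {y \<in> K. N y \<in> P'}"
  proof (intro equalityI subsetI)
    fix y assume "y \<in> X"
    thus "y \<in> {y \<in> K. N y \<in> P} \<union> {y \<in> K. N y \<in> P'}"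
      using cone_cases[of "N y"] by (auto simp: X_def P'_iff)
  next
    fix y assume "y \<in> {y \<in> K. N y \<in> P} \<union> {y \<in> K. N y \<in> P'}"
    thus "y \<in> X" using P_isotropic[of "N y"] P_isotropic[of "- N y"] P_nonzero[of "N y"] P_nonzero[of "- N y"]
      by (auto simp: X_def P'_iff)
  qed
  have "V P c + V P' c = (\<Sum>y\<in>X. \<psi>K (c * (y * y)))" for c
    unfolding X V_def using P_disjoint by (intro sum.union_disjoint[symmetric]) (auto simp: P'_iff)
  hence "V P b + V P' b + V P (\<nu> * b) + V P' (\<nu> * b) =
      (\<Sum>y\<in>X. \<psi>K (b * (y * y))) + (\<Sum>y\<in>X. \<psi>K (b * (\<nu> * (y * y))))"
    by (simp add: add.assoc mult_ac)
  also have "\<dots> = 2 * (\<Sum>x\<in>(\<lambda>y. y * y) ` X \<union> (\<lambda>y. \<nu> * (y * y)) ` X. \<psi>K (b * x))"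
    by (rule sum_squares_nonsquares[of X "\<lambda>x. \<psi>K (b * x)"]) (auto simp: X_def)
  also have "(\<lambda>y. y * y) ` X \<union> (\<lambda>y. \<nu> * (y * y)) ` X = {x \<in> K. Tr (N x) = 0} - {0}"
  proof (intro equalityI subsetI)
    fix x assume "x \<in> (\<lambda>y. y * y) ` X \<union> (\<lambda>y. \<nu> * (y * y)) ` X"
    thus "x \<in> {x \<in> K. Tr (N x) = 0} - {0}" using nu by (auto simp: X_def)
  next
    fix x assume x: "x \<in> {x \<in> K. Tr (N x) = 0} - {0}"
    then obtain z where z: "z \<in> K" "x = z * z \<or> x = \<nu> * (z * z)" using square_or_nu by blast
    have "z \<noteq> 0" "Tr (N z * N z) = 0" using z x nu by auto
    thus "x \<in> (\<lambda>y. y * y) ` X \<union> (\<lambda>y. \<nu> * (y * y)) ` X" using z unfolding X_def by blast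
  qed
  also have "(\<Sum>x\<in>{x \<in> K. Tr (N x) = 0} - {0}. \<psi>K (b * x)) = (\<Sum>x\<in>{x \<in> K. Tr (N x) = 0}. \<psi>K (b * x)) - 1"
    by (subst (2) sum.remove[of _ 0]) simp_all
  finally show ?thesis unfolding quadric_sum[OF b] by simp
qed

text \<open>Of b and \<nu> b, one is a square z^2 and the other \<nu> times a square, where
  \<open>P\<close> and its negative give equal sums. So the odd part comes from z^2 alone. Added to
  the even part it leaves q^3 times \<iota> + \<kappa>, which is even whatever the sign of \<kappa>;
  hence the factor 2 q^3.\<close>

lemma V_sum_value:
  assumes b: "b \<in> K" "b \<noteq> 0"
  shows "\<exists>m::int. V P b + V P (\<nu> * b) = of_nat q ^ 2 - 1 - 2 * of_nat q ^ 3 * of_int m"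
proof -
  have main: "\<exists>m::int. V P c + V P (z * z) = of_nat q ^ 2 - 1 - 2 * of_nat q ^ 3 * of_int m"
    if z: "z \<in> K" "z \<noteq> 0" and c: "V P c = V P' c"
      and tot: "V P c + V P' c + V P (z * z) + V P' (z * z) =
        2 * (of_nat q ^ 2 - 1 - of_nat q ^ 3 * of_bool (Tr (N z * N z) = 0))" for z c
  proof -
    have w: "2 * N z \<in> E" "2 * N z \<noteq> 0" using z by simp_all
    obtain \<kappa> :: int where k: "E.gauss e * H (2 * N z) = of_nat q ^ 3 * of_int \<kappa>"
      "\<bar>\<kappa>\<bar> = of_bool (Tr ((2 * N z) * (2 * N z)) = 0)" using H_value[OF w] by blast
    have "(2 * N z) * (2 * N z) = 4 * (N z * N z)" by (simp add: algebra_simps)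
    hence "Tr ((2 * N z) * (2 * N z)) = 0 \<longleftrightarrow> Tr (N z * N z) = 0" using z by simp
    hence k': "\<bar>\<kappa>\<bar> = of_bool (Tr (N z * N z) = 0)" using k by simp
    define \<iota> where "\<iota> = (of_bool (Tr (N z * N z) = 0) :: int)"
    have "\<exists>m. \<iota> + \<kappa> = 2 * m" using k' unfolding \<iota>_def by (cases "Tr (N z * N z) = 0") (auto, presburger)
    then obtain m where m: "\<iota> + \<kappa> = 2 * m" by blast
    have "2 * (V P c + V P (z * z)) = (V P c + V P' c + V P (z * z) + V P' (z * z)) +
        (V P (z * z) - V P' (z * z))" using c by simp
    also have "\<dots> = 2 * (of_nat q ^ 2 - 1 - of_nat q ^ 3 * of_int (\<iota> + \<kappa>))"
      unfolding tot V_square_diff[OF z] k(1) \<iota>_def by (simp add: algebra_simps)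
    also have "\<dots> = 2 * (of_nat q ^ 2 - 1 - 2 * of_nat q ^ 3 * of_int m)"
      unfolding m by simp
    finally have "V P c + V P (z * z) = of_nat q ^ 2 - 1 - 2 * of_nat q ^ 3 * of_int m"
      by (simp only: mult_cancel_left) simp
    thus ?thesis ..
  qed
  obtain z where z: "z \<in> K" "b = z * z \<or> b = \<nu> * (z * z)" using square_or_nu b by blast
  have z0: "z \<noteq> 0" using z b by auto
  from z(2) show ?thesis
  proof
    assume bz: "b = z * z"
    show ?thesis
      using main[OF z(1) z0 V_nonsquare[OF z(1) z0]] V_total[OF b] unfolding bz
      by (simp add: add_ac)
  next
    assume bz: "b = \<nu> * (z * z)"
    have nz: "\<nu> * z \<in> K" "\<nu> * z \<noteq> 0" using z z0 nu by simp_all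
    have eq: "\<nu> * b = (\<nu> * z) * (\<nu> * z)" by (simp add: bz mult_ac)
    have "N (\<nu> * z) * N (\<nu> * z) = N z * N z" using z nu by simp
    moreover have "Tr (N b) = - Tr (N z * N z)" using z nu by (simp add: bz)
    ultimately have "Tr (N b) = 0 \<longleftrightarrow> Tr (N (\<nu> * z) * N (\<nu> * z)) = 0" by (simp only: neg_equal_0_iff_equal)
    thus ?thesis
      using main[OF nz V_nonsquare[OF z(1) z0]] V_total[OF b] unfolding eq bz[symmetric] by simp
  qed
qed

text \<open>Each multiplier c contributes a hemisystem rescaled by an element of norm c. The pieces
  are disjoint, so their character sums add up to r minus a multiple of q^3, and
  \<open>difference_count\<close> applies.\<close>

theorem exists_difference_set:
  assumes CC: "CC \<subseteq> E - {0}"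
    and disj: "\<And>c d x y. c \<in> CC \<Longrightarrow> d \<in> CC \<Longrightarrow> x \<in> P \<Longrightarrow> y \<in> P \<Longrightarrow> c * x = d * y \<Longrightarrow> c = d"
    and r: "2 * r = card CC * (q ^ 2 - 1)"
  shows "\<exists>D\<subseteq>K. 0 \<notin> D \<and> (\<forall>x\<in>D. - x \<in> D) \<and> card D = r * (q ^ 3 + 1) \<and>
    (\<forall>a\<in>K. a \<noteq> 0 \<longrightarrow> int (card {d \<in> D. d - a \<in> D}) =
      int r ^ 2 + int r + (if a \<in> D then 2 * int r - int (q ^ 3) else 0))"
proof -
  have finCC: "finite CC" by (rule finite_subset[OF CC]) simp
  define Y where "Y = {y \<in> K. \<exists>c\<in>CC. N y \<in> (*) c ` P}"
  define D where "D = (\<lambda>y. y * y) ` Y \<union> (\<lambda>y. \<nu> * (y * y)) ` Y"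
  have YK: "Y \<subseteq> K" by (auto simp: Y_def)
  have Y0: "0 \<notin> Y"
  proof
    assume "0 \<in> Y"
    then obtain c x where "c \<in> CC" "x \<in> P" "c * x = 0" by (auto simp: Y_def)
    thus False using CC P_nonzero[of x] by auto
  qed
  have Yneg: "y \<in> Y \<Longrightarrow> - y \<in> Y" for y by (auto simp: Y_def)
  have "\<forall>c\<in>CC. \<exists>d. d \<in> K \<and> N d = c" using CC N_surj by blast
  then obtain d where d: "\<And>c. c \<in> CC \<Longrightarrow> d c \<in> K \<and> N (d c) = c" by metis
  have d0: "d c \<noteq> 0" if "c \<in> CC" for c using d[OF that] CC that by auto
  have sumY: "(\<Sum>y\<in>Y. h y) = (\<Sum>c\<in>CC. \<Sum>y\<in>{y \<in> K. N y \<in> P}. h (d c * y))" for h :: "'b \<Rightarrow> complex"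
  proof -
    have "Y = (\<Union>c\<in>CC. {y \<in> K. N y \<in> (*) c ` P})" by (auto simp: Y_def)
    hence "(\<Sum>y\<in>Y. h y) = (\<Sum>c\<in>CC. \<Sum>y\<in>{y \<in> K. N y \<in> (*) c ` P}. h y)"
      using finCC disj by (simp only:) (intro sum.UNION_disjoint, auto)
    also have "\<dots> = (\<Sum>c\<in>CC. \<Sum>y\<in>{y \<in> K. N y \<in> P}. h (d c * y))"
    proof (rule sum.cong[OF refl])
      fix c assume c: "c \<in> CC"
      note dc = d[OF c] d0[OF c]
      have "bij_betw ((*) (d c)) {y \<in> K. N y \<in> P} {y \<in> K. N y \<in> (*) c ` P}"
      proof (rule bij_betwI[where g = "\<lambda>y. K.recip (d c) * y"])
        show "(*) (d c) \<in> {y \<in> K. N y \<in> P} \<rightarrow> {y \<in> K. N y \<in> (*) c ` P}" using dc by auto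
        show "(\<lambda>y. K.recip (d c) * y) \<in> {y \<in> K. N y \<in> (*) c ` P} \<rightarrow> {y \<in> K. N y \<in> P}"
        proof clarsimp
          fix y x assume yx: "y \<in> K" "x \<in> P" "N y = c * x"
          have "c * N (K.recip (d c) * y) = N (d c * (K.recip (d c) * y))" using dc by (simp only: N_mult)
          also have "\<dots> = c * x" using dc yx by simp
          finally have "N (K.recip (d c) * y) = x"
            using E.mult_cancel[of "N (K.recip (d c) * y)" x c] dc yx CC c by auto
          thus "K.recip (d c) * y \<in> K \<and> N (K.recip (d c)) * (c * x) \<in> P" using yx dc by simp
        qed
      qed (use dc in \<open>auto simp: mult.left_commute[of "K.recip (d c)"]\<close>)
      from sum.reindex_bij_betw[OF this, of h]
      show "(\<Sum>y\<in>{y \<in> K. N y \<in> (*) c ` P}. h y) = (\<Sum>y\<in>{y \<in> K. N y \<in> P}. h (d c * y))" by simp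
    qed
    finally show ?thesis .
  qed
  have hat2: "2 * (\<Sum>x\<in>D. \<psi>K (b * x)) = (\<Sum>c\<in>CC. V P (b * (d c * d c)) + V P (\<nu> * (b * (d c * d c))))" for b
  proof -
    have "2 * (\<Sum>x\<in>D. \<psi>K (b * x)) = (\<Sum>y\<in>Y. \<psi>K (b * (y * y))) + (\<Sum>y\<in>Y. \<psi>K (b * (\<nu> * (y * y))))"
      unfolding D_def using sum_squares_nonsquares[OF YK Y0 Yneg, of "\<lambda>x. \<psi>K (b * x)"] by simp
    thus ?thesis unfolding sumY V_def by (simp add: sum.distrib mult_ac)
  qed
  have cardD: "card D = r * (q ^ 3 + 1)"
  proof -
    have "card {y \<in> K. N y \<in> P} = (\<Sum>x\<in>P. card {y \<in> K. N y = x})"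
    proof -
      have "{y \<in> K. N y \<in> P} = (\<Union>x\<in>P. {y \<in> K. N y = x})" by auto
      thus ?thesis by (simp only:) (rule card_UN_disjoint, auto)
    qed
    also have "\<dots> = card P * (q ^ 3 + 1)" using card_fiber P_nonzero by simp
    finally have fib: "card {y \<in> K. N y \<in> P} = card P * (q ^ 3 + 1)" .
    \<comment> \<open>At b = 0 all character values are 1, so the transform counts elements.\<close>
    have "2 * complex_of_nat (card D) = 2 * (of_nat (card CC) * of_nat (card P * (q ^ 3 + 1)))"
      using hat2[of 0] fib by (simp add: V_def)
    hence "complex_of_nat (card D) = of_nat (card CC * (card P * (q ^ 3 + 1)))" by simp
    hence "card D = card CC * (card P * (q ^ 3 + 1))" by (simp only: of_nat_eq_iff)
    hence "2 * card D = card CC * (2 * card P) * (q ^ 3 + 1)" by (simp add: algebra_simps)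
    also have "\<dots> = 2 * (r * (q ^ 3 + 1))" unfolding card_P r[symmetric] by simp
    finally show ?thesis by simp
  qed
  have DK: "D \<subseteq> K" using YK nu by (auto simp: D_def)
  have D0: "0 \<notin> D" using YK Y0 nu by (auto simp: D_def)
  have Dneg: "- x \<in> D" if "x \<in> D" for x
  proof -
    \<comment> \<open>\<open>i\<close> has norm e and square -e: multiplying by it preserves
      \<open>Y\<close> and negates squares.\<close>
    have iY: "i * y \<in> Y" if "y \<in> Y" for y using that i by (auto simp: Y_def)
    have "(i * y) * (i * y) = - (y * y)" if "y \<in> K" for y
    proof -
      have "(i * y) * (i * y) = (i * i) * (y * y)" by (simp add: mult_ac)
      thus ?thesis using that i by simp
    qed
    note ii = this
    from that consider y where "y \<in> Y" "x = y * y" | y where "y \<in> Y" "x = \<nu> * (y * y)"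
      unfolding D_def by blast
    thus ?thesis
    proof cases
      case 1
      hence "- x = (i * y) * (i * y)" using ii YK by auto
      thus ?thesis unfolding D_def using iY[OF 1(1)] by blast
    next
      case 2
      hence "- x = \<nu> * ((i * y) * (i * y))" using ii YK by auto
      thus ?thesis unfolding D_def using iY[OF 2(1)] by blast
    qed
  qed
  have hat: "\<exists>m::int. (\<Sum>x\<in>D. \<psi>K (b * x)) = of_nat r - of_nat (q ^ 3) * of_int m"
    if b: "b \<in> K" "b \<noteq> 0" for b
  proof -
    have "\<forall>c. \<exists>m::int. c \<in> CC \<longrightarrow> V P (b * (d c * d c)) + V P (\<nu> * (b * (d c * d c))) =
        of_nat q ^ 2 - 1 - 2 * of_nat q ^ 3 * of_int m"
      using V_sum_value b d d0 by auto
    then obtain m :: "'b \<Rightarrow> int" where m: "\<And>c. c \<in> CC \<Longrightarrow>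
        V P (b * (d c * d c)) + V P (\<nu> * (b * (d c * d c))) = of_nat q ^ 2 - 1 - 2 * of_nat q ^ 3 * of_int (m c)"
      by metis
    have "2 * (\<Sum>x\<in>D. \<psi>K (b * x)) = (\<Sum>c\<in>CC. of_nat q ^ 2 - 1 - 2 * of_nat q ^ 3 * of_int (m c))"
      unfolding hat2 by (intro sum.cong refl m)
    also have "\<dots> = of_nat (card CC) * (of_nat q ^ 2 - 1) - 2 * of_nat q ^ 3 * of_int (\<Sum>c\<in>CC. m c)"
      by (simp add: sum_subtractf sum_distrib_left[symmetric] right_diff_distrib)
    also have "of_nat (card CC) * (of_nat q ^ 2 - 1) = (2 * of_nat r :: complex)"
    proof -
      have "1 \<le> q ^ 2" by (rule one_le_power) (use q_pos in linarith)
      hence "complex_of_nat (q ^ 2 - 1) = of_nat q ^ 2 - 1" by (simp add: of_nat_diff)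
      moreover have "complex_of_nat (2 * r) = of_nat (card CC * (q ^ 2 - 1))" by (simp only: r)
      ultimately show ?thesis by simp
    qed
    finally have "2 * (\<Sum>x\<in>D. \<psi>K (b * x)) = 2 * (of_nat r - of_nat (q ^ 3) * of_int (\<Sum>c\<in>CC. m c))"
      by (simp add: right_diff_distrib)
    hence "(\<Sum>x\<in>D. \<psi>K (b * x)) = of_nat r - of_nat (q ^ 3) * of_int (\<Sum>c\<in>CC. m c)"
      by (simp only: mult_cancel_left) simp
    thus ?thesis by blast
  qed
  have "card K = (q ^ 3) ^ 2" by (simp add: card_K power_mult[symmetric])
  from K.difference_count[OF DK Dneg D0 cardD this hat]
  show ?thesis using DK D0 Dneg cardD by (intro exI[of _ D]) auto
qed

end

section \<open>Disjoint multiples of the half cone\<close>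

context hemisystem
begin

lemma e_power_mult [simp]: "x \<in> K \<Longrightarrow> e ^ k * x = x"
  by (cases "k = 0") simp_all

lemma power_reduce:
  assumes "x \<in> K" "x ^ m = e" "0 < j"
  shows "x ^ (m * k + j) = x ^ j"
  using assms by (simp add: power_add power_mult K.power_mem)

text \<open>An extension of odd degree contains no new square roots: fr w = -w would give w = -w
  after three applications of Frobenius.\<close>

lemma square_in_F:
  assumes w: "w \<in> E" "w * w \<in> F"
  shows "w \<in> F"
proof -
  have "w * w = fr w * fr w" using fr_F[OF w(2)] by simp
  hence "fr w = w \<or> fr w = - w" using E.square_eq_square[of w "fr w"] w by simp
  moreover have "w = 0" if "fr w = - w"
  proof -
    have "fr (fr (fr w)) = - w" using that by simp
    thus ?thesis using w E.neg_neq[of w] by (metis fr3)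
  qed
  ultimately show ?thesis using w F_iff_E[of w] by (metis F.zero_mem)
qed

text \<open>The classical root x + 1 / x of 2 for a primitive eighth root of unity x, written as x -
  x^3 because x^4 = -e. Frobenius acts on x through q mod 8.\<close>

lemma sqrt_two:
  obtains t where "t \<in> K" "t * t = 2 * e"
    "q mod 8 = 7 \<Longrightarrow> t \<in> F" "q mod 8 = 3 \<Longrightarrow> fr t = - t"
proof -
  obtain k where k: "q = 4 * k + 3" using four_k_plus_3 by blast
  have "8 dvd n"
  proof -
    have "q ^ 2 mod 8 = 1"
    proof -
      have "q ^ 2 = 8 * (2 * k * k + 3 * k + 1) + 1" by (simp add: k power2_eq_square algebra_simps)
      thus ?thesis by presburger
    qed
    hence "(q ^ 2) ^ 3 mod 8 = 1" by (subst power_mod[symmetric]) simp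
    hence "q ^ 6 mod 8 = 1" by (simp add: power_mult[symmetric])
    thus ?thesis unfolding n_def by presburger
  qed
  then obtain l where l: "n = 8 * l" by blast
  have l0: "0 < l" using l n_gt_1 by simp
  define x where "x = \<omega> ^ l"
  have x: "x \<in> K" using l0 by (simp add: x_def)
  have x8: "x ^ 8 = e" using omega_n l by (simp add: x_def power_mult[symmetric] mult.commute)
  have "x ^ 4 \<noteq> e"
  proof
    assume "x ^ 4 = e"
    hence "\<omega> ^ (l * 4) = e" by (simp add: x_def power_mult)
    hence "n dvd l * 4" using omega_eq_unit[of "l * 4"] l0 by simp
    hence "8 * l \<le> l * 4" using l l0 by (intro dvd_imp_le) simp_all
    thus False using l0 by simp
  qed
  moreover have "(x ^ 4 - e) * (x ^ 4 + e) = 0"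
  proof -
    have "x ^ 4 * x ^ 4 = e" using x8 by (simp add: power_add[symmetric])
    moreover have "x ^ 4 \<in> K" using x by (simp add: K.power_mem)
    ultimately show ?thesis by (simp add: algebra_simps)
  qed
  moreover have "x ^ 4 \<in> K" using x by (simp add: K.power_mem)
  ultimately have x4: "x ^ 4 = - e" by (simp add: eq_neg_iff_add_eq_0)
  have pK: "x ^ j \<in> K" if "0 < j" for j using x that by (rule K.power_mem)
  have x47: "x ^ (4 + j) = - (x ^ j)" if "0 < j" for j using pK[OF that] by (simp add: power_add x4)
  define t where "t = x - x ^ 3"
  have t: "t \<in> K" using x pK by (simp add: t_def)
  have "t * t = x ^ 2 - 2 * x ^ 4 + x ^ (4 + 2)"
    by (simp add: t_def algebra_simps power2_eq_square power4_eq_xxxx numeral_eq_Suc)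
  hence t2: "t * t = 2 * e" using x47[of 2] x4 by simp
  have frt: "fr t = x ^ q - x ^ (q * 3)"
  proof -
    have "fr (x ^ 3) = x ^ (q * 3)" by (simp add: fr_def power_mult[symmetric] mult.commute)
    moreover have "fr t = fr x - fr (x ^ 3)" unfolding t_def using x pK by (intro fr_diff) simp_all
    ultimately show ?thesis by (simp add: fr_def)
  qed
  have "fr t = t" if "q mod 8 = 7"
  proof -
    have "q = 8 * (q div 8) + 7" using that by presburger
    then obtain m where m: "q = 8 * m + 7" by blast
    have "q * 3 = 8 * (3 * m + 2) + 5" by (simp add: m)
    hence "x ^ (q * 3) = x ^ 5" using power_reduce[OF x x8, of 5] by (simp only:)
    moreover have "x ^ q = x ^ 7" using power_reduce[OF x x8, of 7] by (simp add: m)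
    moreover have "x ^ 5 = - x" "x ^ 7 = - (x ^ 3)" using x47[of 1] x47[of 3] by simp_all
    ultimately show ?thesis unfolding frt by (simp add: t_def)
  qed
  moreover have "fr t = - t" if "q mod 8 = 3"
  proof -
    have "q = 8 * (q div 8) + 3" using that by presburger
    then obtain m where m: "q = 8 * m + 3" by blast
    have "q * 3 = 8 * (3 * m + 1) + 1" by (simp add: m)
    hence "x ^ (q * 3) = x ^ 1" using power_reduce[OF x x8, of 1] by (simp only:)
    moreover have "x ^ q = x ^ 3" using power_reduce[OF x x8, of 3] by (simp add: m)
    ultimately show ?thesis unfolding frt by (simp add: t_def)
  qed
  ultimately show ?thesis using that t t2 F_iff by blast
qed

lemma two_nonsquare:
  assumes q: "q mod 8 = 3" and s: "s \<in> F"
  shows "s * s \<noteq> 2 * e"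
proof
  assume ss: "s * s = 2 * e"
  obtain t where t: "t \<in> K" "t * t = 2 * e" "fr t = - t" using sqrt_two q by metis
  have "t = s \<or> t = - s" using K_square_eq[of s t] ss t s by simp
  hence "fr t = t" using s by auto
  hence "t = 0" using t K_neg_neq by metis
  thus False using t by simp
qed

lemma P_nonempty: "\<exists>x. x \<in> P"
proof -
  have "3 ^ 2 \<le> q ^ 2" using q_ge_3 by (rule power_mono) simp
  hence "card P \<noteq> 0" using card_P by auto
  thus ?thesis by (metis card.empty ex_in_conv)
qed

text \<open>Put u = y^2 and \<beta> = \<gamma>^2. Isotropy of y and of \<beta> y gives two linear
  equations for the conjugates of u, solved by fr u = \<rho>^2 u; hence x y = \<beta> u is fixed by
  Frobenius. It is also the square of \<gamma> y, which therefore lies in \<open>F\<close>, and 3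
  (\<gamma> y)^2 = Tr (x y) = 2 t^2 would make 6 a square. This last step is why the multiplier is
  given as a square.\<close>

lemma cubic_avoid:
  assumes \<gamma>: "\<gamma> \<in> E" "\<gamma> \<noteq> 0" and \<rho>: "\<rho> \<in> F" "\<rho> * \<rho> + \<rho> + e = 0" "\<rho> \<noteq> e"
    and fr\<beta>: "fr (\<gamma> * \<gamma>) = \<rho> * (\<gamma> * \<gamma>)"
    and six: "\<And>t. t \<in> F \<Longrightarrow> t * t \<noteq> 6 * e"
    and xy: "x \<in> P" "y \<in> P"
  shows "x \<noteq> (\<gamma> * \<gamma>) * y"
proof
  assume eq: "x = (\<gamma> * \<gamma>) * y"
  define \<beta> where "\<beta> = \<gamma> * \<gamma>"
  have \<beta>: "\<beta> \<in> E" "\<beta> \<noteq> 0" "fr \<beta> = \<rho> * \<beta>" "x = \<beta> * y"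
    using \<gamma> fr\<beta> eq by (simp_all add: \<beta>_def)
  have \<rho>2: "\<rho> * \<rho> = - \<rho> - e" using \<rho>(2) by (simp add: algebra_simps eq_neg_iff_add_eq_0)
  have \<rho>3: "\<rho> * (\<rho> * \<rho>) = e" unfolding \<rho>2 using \<rho>(1) by (simp add: right_diff_distrib \<rho>2)
  define u where "u = y * y"
  have u: "u \<in> E" using xy by (simp add: u_def)
  define u1 where "u1 = fr u"
  define u2 where "u2 = fr u1"
  have u12: "u1 \<in> E" "u2 \<in> E" "fr u2 = u" using u by (simp_all add: u1_def u2_def)
  have T1: "u + u1 + u2 = 0"
    using P_isotropic[OF xy(2)] by (simp add: Tr_def u_def u1_def u2_def)
  have "Tr (\<beta> * \<beta> * u) = 0"
    using P_isotropic[OF xy(1)] unfolding \<beta>(4) u_def by (simp only: mult_ac)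
  hence "\<beta> * \<beta> * u + (\<rho> * \<beta>) * (\<rho> * \<beta>) * u1 + (\<rho> * (\<rho> * \<beta>)) * (\<rho> * (\<rho> * \<beta>)) * u2 = 0"
    using \<rho>(1) by (simp add: Tr_def u1_def u2_def \<beta>)
  hence "(\<beta> * \<beta>) * (u + (\<rho> * \<rho>) * u1 + (\<rho> * (\<rho> * (\<rho> * \<rho>))) * u2) = 0" by (simp add: algebra_simps)
  hence "u + (\<rho> * \<rho>) * u1 + (\<rho> * e) * u2 = 0" unfolding \<rho>3 using \<beta> \<rho>(1) u u12 by simp
  hence T2: "u + (- \<rho> - e) * u1 + \<rho> * u2 = 0" unfolding \<rho>2 using \<rho>(1) by simp
  \<comment> \<open>Eliminating u from the two equations leaves the factor \<rho> - e; the summands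
    in u - e u and e - e e only record that e acts as the unit.\<close>
  have "(\<rho> - e) * (u2 - (- \<rho> - e) * u1) =
      (u + (- \<rho> - e) * u1 + \<rho> * u2) - e * (u + u1 + u2) + (\<rho> * \<rho> + \<rho> + e) * u1 - (u - e * u) +
      (e - e * e) * u1"
    using u u12 \<rho>(1) by (simp add: algebra_simps)
  also have "\<dots> = 0" unfolding T1 T2 \<rho>(2) using u u12 by simp
  finally have "u2 = (- \<rho> - e) * u1" using \<rho>(1,3) u12 by simp
  hence h: "fr u1 = (\<rho> * \<rho>) * u1" by (simp only: u2_def \<rho>2)
  have "fr (fr (fr u1)) = (\<rho> * \<rho>) * fr (fr u1)"
    using \<rho>(1) by (simp add: h)
  moreover have "fr (fr u1) = u" using u12(3) unfolding u2_def .
  moreover have "fr (fr (fr u1)) = u1" using u12(1) by (rule fr3)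
  ultimately have "u1 = (\<rho> * \<rho>) * u" by metis
  hence "\<rho> * u1 = (\<rho> * (\<rho> * \<rho>)) * u" by (simp only: mult.assoc)
  hence ru: "\<rho> * u1 = u" unfolding \<rho>3 using u by simp
  define s where "s = \<beta> * u"
  have "fr s = \<beta> * (\<rho> * u1)" unfolding s_def u1_def fr_mult \<beta>(3) by (simp only: mult_ac)
  hence "fr s = s" by (simp only: ru s_def)
  moreover have "s \<in> E" using \<beta> u by (simp add: s_def)
  ultimately have sF: "s \<in> F" unfolding F_iff_E by blast
  define w where "w = \<gamma> * y"
  have ww: "w * w = s" by (simp add: w_def s_def u_def \<beta>_def mult_ac)
  have wF: "w \<in> F" using square_in_F[of w] ww sF \<gamma> xy by (simp add: w_def)
  have w0: "w \<noteq> 0" using \<gamma> xy P_nonzero by (simp add: w_def)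
  obtain t where t: "t \<in> F" "Tr (x * y) = 2 * (t * t)" using Tr_P[OF xy] by blast
  have "x * y = s" by (simp add: \<beta>(4) s_def u_def mult_ac)
  hence 3: "3 * s = 2 * (t * t)" using t Tr_of_F[OF sF] by simp
  have "(2 * t) * (2 * t) = 2 * (2 * (t * t))" by (simp only: mult.assoc mult.left_commute[of t 2])
  also have "\<dots> = 6 * (w * w)" unfolding 3[symmetric] ww by simp
  finally have tw: "(2 * t) * (2 * t) = 6 * (w * w)" .
  define v where "v = F.recip w"
  have v: "v \<in> F" "w * v = e" using wF w0 by (simp_all add: v_def)
  have "(2 * t * v) * (2 * t * v) = ((2 * t) * (2 * t)) * (v * v)" by (simp only: mult_ac)
  also have "\<dots> = 6 * ((w * v) * (w * v))" unfolding tw by (simp only: mult_ac)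
  also have "\<dots> = 6 * e" by (simp add: v)
  finally show False using six[of "2 * t * v"] t v by simp
qed

text \<open>\<gamma> = \<omega>^l has order 3 (q - 1), so its cube generates the nonzero elements of
  \<open>F\<close> and is a noncube there, and \<sigma> = \<gamma>^(q - 1) has order 3. In l = n /
  (3 (q - 1)) the first factor is (q^2 + q + 1) / 3, expressed through q = 3 k + 1.\<close>

lemma cube_root_of_unity:
  assumes "q mod 3 = 1"
  obtains \<gamma> \<sigma> where "\<gamma> \<in> E" "\<gamma> \<noteq> 0" "\<sigma> \<in> F" "\<sigma> * \<sigma> + \<sigma> + e = 0" "\<sigma> \<noteq> e" "fr \<gamma> = \<sigma> * \<gamma>"
proof -
  obtain k where k: "q = 3 * k + 1" using assms by (metis add.commute mult.commute mod_mult_div_eq)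
  have k0: "0 < k" using k q_ge_3 by simp
  define l where "l = (3 * k * k + 3 * k + 1) * (q ^ 3 + 1)"
  have n: "n = 3 * l * (q - 1)"
  proof -
    have "n = (q ^ 3 - 1) * (q ^ 3 + 1)"
      by (simp add: n_def algebra_simps diff_mult_distrib power_add[symmetric])
    also have "q ^ 3 - 1 = 3 * (3 * k * k + 3 * k + 1) * (q - 1)"
      by (simp add: k power3_eq_cube algebra_simps)
    finally show ?thesis by (simp only: l_def mult_ac)
  qed
  have l0: "0 < l" by (simp add: l_def)
  define \<gamma> where "\<gamma> = \<omega> ^ l"
  define \<sigma> where "\<sigma> = \<omega> ^ (l * (q - 1))"
  have q1: "0 < q - 1" using q_ge_3 by simp
  have mem: "\<gamma> \<in> K" "\<gamma> \<noteq> 0" "\<sigma> \<in> K" using l0 q1 by (simp_all add: \<gamma>_def \<sigma>_def)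
  have fr\<gamma>: "fr \<gamma> = \<sigma> * \<gamma>"
  proof -
    have "q = (q - 1) + 1" using q_ge_3 by simp
    hence "fr \<gamma> = \<gamma> ^ ((q - 1) + 1)" by (simp add: fr_def)
    thus ?thesis by (simp only: \<gamma>_def \<sigma>_def power_add power_one_right power_mult)
  qed
  have \<sigma>3: "\<sigma> ^ 3 = e"
  proof -
    have "\<sigma> ^ 3 = \<omega> ^ n" by (simp only: \<sigma>_def n power_mult[symmetric] mult_ac)
    thus ?thesis by (simp only: omega_n)
  qed
  have \<sigma>1: "\<sigma> \<noteq> e"
  proof
    assume "\<sigma> = e"
    hence "n dvd l * (q - 1)" using omega_eq_unit[of "l * (q - 1)"] l0 q1 by (simp add: \<sigma>_def)
    hence "n \<le> l * (q - 1)" using l0 q1 by (intro dvd_imp_le) simp_all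
    thus False using l0 q1 unfolding n by simp
  qed
  have "\<sigma> ^ q = \<sigma>" using power_reduce[OF mem(3) \<sigma>3, of 1 k] by (subst k) simp
  hence "fr \<sigma> = \<sigma>" unfolding fr_def .
  hence \<sigma>F: "\<sigma> \<in> F" using mem F_iff by blast
  have \<sigma>3': "\<sigma> * (\<sigma> * \<sigma>) = e" using \<sigma>3 by (simp add: power3_eq_cube mult.assoc)
  have "(\<sigma> - e) * (\<sigma> * \<sigma> + \<sigma> + e) = 0"
    using \<sigma>F \<sigma>3' by (simp add: left_diff_distrib right_diff_distrib distrib_left)
  hence \<sigma>0: "\<sigma> * \<sigma> + \<sigma> + e = 0" using \<sigma>F \<sigma>1 by simp
  have "bar \<gamma> = (\<sigma> * (\<sigma> * \<sigma>)) * \<gamma>" unfolding bar_fr fr\<gamma> using \<sigma>F by (simp add: fr\<gamma> mult_ac)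
  hence "\<gamma> \<in> E" unfolding E_iff \<sigma>3' using mem by simp
  thus ?thesis using that mem \<sigma>F \<sigma>0 \<sigma>1 fr\<gamma> by blast
qed

text \<open>2 is a square since q is 7 mod 8, and a primitive cube root of unity makes -3 a square.
  So -6 is a square, and 6 cannot be one too because -1 is a nonsquare.\<close>

lemma six_nonsquare:
  assumes q: "q mod 24 = 7" and t: "t \<in> F"
  shows "t * t \<noteq> 6 * e"
proof
  assume tt: "t * t = 6 * e"
  have q3: "q mod 3 = 1" "q mod 8 = 7"
    using mod_mod_cancel[of 3 24 q] mod_mod_cancel[of 8 24 q] q by simp_all
  obtain \<gamma> \<sigma> where \<sigma>: "\<sigma> \<in> F" "\<sigma> * \<sigma> + \<sigma> + e = 0" "\<sigma> \<noteq> e" using cube_root_of_unity[OF q3(1)] by metis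
  obtain s where s: "s \<in> F" "s * s = 2 * e" using sqrt_two q3(2) by metis
  \<comment> \<open>The square root 2 \<sigma> + 1 of -3.\<close>
  define c where "c = 2 * \<sigma> + e"
  have c: "c \<in> F" using \<sigma> by (simp add: c_def)
  have cc: "c * c = - (3 * e)"
  proof -
    have "c * c = 4 * (\<sigma> * \<sigma> + \<sigma> * e) + e * e" by (simp only: c_def) (simp add: algebra_simps)
    also have "\<sigma> * \<sigma> + \<sigma> * e = - e" using \<sigma> by (simp add: eq_neg_iff_add_eq_0)
    finally show ?thesis by simp
  qed
  have "(s * c) * (s * c) = (s * s) * (c * c)" by (simp add: mult_ac)
  also have "\<dots> = - (6 * (e * e))" unfolding s cc by (simp add: algebra_simps del: K.unit E.unit F.unit K.unit_right E.unit_right F.unit_right)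
  also have "\<dots> = - (t * t)" by (simp add: tt)
  finally have "s * c = 0" using F.square_eq_neg_square[of "s * c" t] s c t by simp
  moreover have "s \<noteq> 0" using s by auto
  ultimately have "c = 0" using s c by simp
  \<comment> \<open>Only characteristic 3 is left, where (\<sigma> - e)^2 = 0 contradicts \<sigma>
    being primitive.\<close>
  hence 3: "3 * e = 0" using cc by simp
  have "(\<sigma> - e) * (\<sigma> - e) = (\<sigma> * \<sigma> + \<sigma> + e) - 3 * \<sigma>"
    using \<sigma>(1) by (simp add: left_diff_distrib right_diff_distrib)
  moreover have "3 * \<sigma> = (3 * e) * \<sigma>" using \<sigma>(1) by (simp add: mult.assoc)
  ultimately have "(\<sigma> - e) * (\<sigma> - e) = 0" using \<sigma>(2) 3 by simp
  thus False using \<sigma> by simp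
qed

text \<open>Ratios of distinct multipliers are \<beta> or \<beta>^2 up to inversion. These are the
  squares of \<gamma> and \<beta>, with Frobenius factors \<sigma>^2 and \<sigma>, so
  \<open>cubic_avoid\<close> serves for both.\<close>

theorem multipliers_3:
  assumes q: "q mod 24 = 7"
  shows "\<exists>CC\<subseteq>E - {0}. card CC = 3 \<and>
    (\<forall>c\<in>CC. \<forall>d\<in>CC. \<forall>x\<in>P. \<forall>y\<in>P. c * x = d * y \<longrightarrow> c = d)"
proof -
  have q3: "q mod 3 = 1" using mod_mod_cancel[of 3 24 q] q by simp
  obtain \<gamma> \<sigma> where g: "\<gamma> \<in> E" "\<gamma> \<noteq> 0" "\<sigma> \<in> F" "\<sigma> * \<sigma> + \<sigma> + e = 0" "\<sigma> \<noteq> e" "fr \<gamma> = \<sigma> * \<gamma>"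
    using cube_root_of_unity[OF q3] by metis
  have \<sigma>2: "\<sigma> * \<sigma> = - \<sigma> - e" using g(4) by (simp add: algebra_simps eq_neg_iff_add_eq_0)
  have \<sigma>4: "(\<sigma> * \<sigma>) * (\<sigma> * \<sigma>) = \<sigma>"
    unfolding \<sigma>2 using g(3) by (simp add: algebra_simps \<sigma>2)
  have \<rho>: "(\<sigma> * \<sigma>) * (\<sigma> * \<sigma>) + \<sigma> * \<sigma> + e = 0" "\<sigma> * \<sigma> \<in> F"
    using g(3,4) unfolding \<sigma>4 by (simp_all add: algebra_simps)
  have \<rho>1: "\<sigma> * \<sigma> \<noteq> e"
  proof
    assume h: "\<sigma> * \<sigma> = e"
    have "e = \<sigma>" using \<sigma>4 unfolding h by simp
    thus False using g by simp
  qed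
  define \<beta> where "\<beta> = \<gamma> * \<gamma>"
  have \<beta>: "\<beta> \<in> E" "\<beta> \<noteq> 0" "fr \<beta> = (\<sigma> * \<sigma>) * \<beta>" using g by (simp_all add: \<beta>_def mult_ac)
  have six: "\<And>t. t \<in> F \<Longrightarrow> t * t \<noteq> 6 * e" using six_nonsquare[OF q] .
  have b1: "x \<noteq> \<beta> * y" if "x \<in> P" "y \<in> P" for x y
    unfolding \<beta>_def by (rule cubic_avoid[OF g(1,2) \<rho>(2,1) \<rho>1 _ six that]) (use \<beta> in \<open>simp_all add: \<beta>_def\<close>)
  have b2: "x \<noteq> (\<beta> * \<beta>) * y" if "x \<in> P" "y \<in> P" for x y
  proof (rule cubic_avoid[OF \<beta>(1,2) g(3,4,5) _ six that])
    have "fr (\<beta> * \<beta>) = ((\<sigma> * \<sigma>) * (\<sigma> * \<sigma>)) * (\<beta> * \<beta>)" by (simp only: fr_mult \<beta>(3) mult_ac)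
    thus "fr (\<beta> * \<beta>) = \<sigma> * (\<beta> * \<beta>)" by (simp only: \<sigma>4)
  qed
  obtain x0 where x0: "x0 \<in> P" using P_nonempty by blast
  have ne: "\<beta> \<noteq> e" "\<beta> * \<beta> \<noteq> e" "\<beta> * \<beta> \<noteq> \<beta>"
  proof -
    show 1: "\<beta> \<noteq> e" using b1[OF x0 x0] x0 by auto
    show "\<beta> * \<beta> \<noteq> e"
    proof
      assume "\<beta> * \<beta> = e"
      hence "\<beta> * \<beta> * x0 = x0" using x0 by simp
      thus False using b2[OF x0 x0] by simp
    qed
    show "\<beta> * \<beta> \<noteq> \<beta>" using K.mult_cancel[of \<beta> e \<beta>] \<beta> 1 by simp
  qed
  have bb: "\<beta> * x = \<beta> * \<beta> * y \<longleftrightarrow> x = \<beta> * y" if "x \<in> P" "y \<in> P" for x y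
    using K.mult_cancel[of x "\<beta> * y" \<beta>] \<beta> that by (simp add: mult.assoc)
  have "\<forall>c\<in>{e, \<beta>, \<beta> * \<beta>}. \<forall>d\<in>{e, \<beta>, \<beta> * \<beta>}. \<forall>x\<in>P. \<forall>y\<in>P. c * x = d * y \<longrightarrow> c = d"
  proof (intro ballI impI)
    fix c d x y
    assume c: "c \<in> {e, \<beta>, \<beta> * \<beta>}" "d \<in> {e, \<beta>, \<beta> * \<beta>}" and xy: "x \<in> P" "y \<in> P" and eq: "c * x = d * y"
    have "x \<noteq> \<beta> * y" "y \<noteq> \<beta> * x" "x \<noteq> \<beta> * \<beta> * y" "y \<noteq> \<beta> * \<beta> * x" "e * x = x" "e * y = y"
      using b1 b2 xy by simp_all
    thus "c = d" using c eq bb[OF xy] bb[OF xy(2,1)] by (elim insertE emptyE) metis+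
  qed
  moreover have "{e, \<beta>, \<beta> * \<beta>} \<subseteq> E - {0}" using \<beta> by simp
  moreover have "card {e, \<beta>, \<beta> * \<beta>} = 3" using ne by (simp add: eq_commute)
  ultimately show ?thesis by blast
qed

text \<open>Let \<tau> be the automorphism of \<open>E\<close> over \<open>F\<close> that squares
  \<eta>, and s = x y. Isotropy of x and y says Tr (\<eta> s) = Tr (s / \<eta>) = 0; eliminating one
  conjugate of s yields s = u z with z in \<open>F\<close> and u = \<eta>^2 - \<eta>^5. The norm of
  u equals its trace \<delta>. Now s is a square, so its norm \<delta> z^3 is a square in
  \<open>F\<close>, while \<delta> z = Tr s = 2 t^2. Dividing makes 2 a square, impossible for q = 3
  mod 8.\<close>

lemma septic_avoid:
  assumes \<eta>: "\<eta> \<in> K" "\<eta> ^ 7 = e" "\<eta> \<noteq> e" and q: "q mod 7 = 2 \<or> q mod 7 = 4"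
    and two: "q mod 8 = 3"
    and xy: "x \<in> P" "y \<in> P"
  shows "x \<noteq> \<eta> * y"
proof
  assume eq: "x = \<eta> * y"
  have red: "\<eta> ^ (7 * k + j) = \<eta> ^ j" if "0 < j" for k j using power_reduce[OF \<eta>(1,2) that] .
  have red1: "\<eta> ^ 8 = \<eta>" "\<eta> ^ 9 = \<eta> ^ 2" "\<eta> ^ 10 = \<eta> ^ 3" "\<eta> ^ 16 = \<eta> ^ 2" "\<eta> ^ 20 = \<eta> ^ 6"
    using red[of 1 1] red[of 2 1] red[of 3 1] red[of 2 2] red[of 6 2] by simp_all
  \<comment> \<open>If q is 4 mod 7, Frobenius gives \<eta>^4 and its second iterate \<eta>^16 =
    \<eta>^2.\<close>
  define \<tau> where "\<tau> = (if q mod 7 = 2 then fr else fr \<circ> fr)"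
  have fr\<eta>: "q mod 7 = 2 \<Longrightarrow> fr \<eta> = \<eta> ^ 2" "q mod 7 = 4 \<Longrightarrow> fr \<eta> = \<eta> ^ 4"
  proof -
    have qd: "q = 7 * (q div 7) + q mod 7" by simp
    show "fr \<eta> = \<eta> ^ 2" if "q mod 7 = 2"
      unfolding fr_def using red[of 2 "q div 7"] qd[unfolded that] by (metis zero_less_numeral)
    show "fr \<eta> = \<eta> ^ 4" if "q mod 7 = 4"
      unfolding fr_def using red[of 4 "q div 7"] qd[unfolded that] by (metis zero_less_numeral)
  qed
  have frp: "fr (z ^ k) = fr z ^ k" for z k by (simp add: fr_def power_mult[symmetric] mult.commute)
  have \<tau>\<eta>: "\<tau> \<eta> = \<eta> ^ 2"
    using q fr\<eta> red1 by (auto simp: \<tau>_def frp power_mult[symmetric])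
  have \<tau>_mult: "\<tau> (a * b) = \<tau> a * \<tau> b" for a b by (simp add: \<tau>_def)
  have \<tau>_diff: "\<tau> (a - b) = \<tau> a - \<tau> b" if "a \<in> K" "b \<in> K" for a b using that by (simp add: \<tau>_def)
  have \<tau>_pow: "\<tau> (a ^ k) = \<tau> a ^ k" for a k by (simp add: \<tau>_def frp)
  have \<tau>_E: "\<tau> a \<in> E" if "a \<in> E" for a using that by (simp add: \<tau>_def)
  have \<tau>_F: "a \<in> F" if "a \<in> E" "\<tau> a = a" for a
  proof (cases "q mod 7 = 2")
    case True
    thus ?thesis using that unfolding F_iff_E by (simp add: \<tau>_def)
  next
    case False
    hence "fr (fr a) = a" using that by (simp add: \<tau>_def)
    hence "fr (fr (fr a)) = fr a" by simp
    thus ?thesis using that unfolding F_iff_E by simp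
  qed
  have Tr\<tau>: "Tr a = a + \<tau> a + \<tau> (\<tau> a)" if "a \<in> E" for a
    using that by (auto simp: \<tau>_def Tr_def add_ac)
  have \<eta>E: "\<eta> \<in> E"
  proof -
    have "\<tau> (\<tau> (\<tau> \<eta>)) = \<eta>" by (simp add: \<tau>\<eta> \<tau>_pow power_mult[symmetric] red1)
    moreover have "\<tau> (\<tau> (\<tau> \<eta>)) = (if q mod 7 = 2 then bar \<eta> else bar (bar \<eta>))" by (simp add: \<tau>_def bar_fr)
    moreover have "bar (bar \<eta>) = \<eta>" using \<eta> by simp
    moreover have "bar \<eta> = \<eta>" if "q mod 7 = 4"
      using fr\<eta>(2)[OF that] red[of 1 9] by (simp add: bar_fr frp power_mult[symmetric])
    ultimately show ?thesis unfolding E_iff using \<eta> q by (auto split: if_splits)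
  qed
  have pE: "\<eta> ^ k \<in> E" if "0 < k" for k using \<eta>E that by (rule E.power_mem)
  have pe: "\<eta> ^ 7 * z = z" if "z \<in> K" for z using that \<eta> by simp
  define s where "s = x * y"
  have sE: "s \<in> E" using xy by (simp add: s_def)
  define b where "b = \<tau> s"
  define c where "c = \<tau> b"
  have bc: "b \<in> E" "c \<in> E" using sE \<tau>_E by (simp_all add: b_def c_def)
  have e1: "\<eta> * s + \<eta> ^ 2 * b + \<eta> ^ 4 * c = 0"
  proof -
    have "Tr (\<eta> * s) = 0" using P_isotropic[OF xy(1)] unfolding s_def eq by (simp only: mult_ac)
    thus ?thesis using \<eta>E sE
      by (subst (asm) Tr\<tau>) (simp_all add: \<tau>_mult \<tau>_pow \<tau>\<eta> b_def c_def power_mult[symmetric])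
  qed
  have e2: "\<eta> ^ 6 * s + \<eta> ^ 5 * b + \<eta> ^ 3 * c = 0"
  proof -
    have "\<eta> ^ 6 * s = \<eta> ^ 7 * (y * y)" by (simp add: s_def eq numeral_eq_Suc mult_ac)
    also have "\<dots> = y * y" using xy by (intro pe) simp
    finally have "Tr (\<eta> ^ 6 * s) = 0" using P_isotropic[OF xy(2)] by simp
    moreover have "\<eta> ^ 12 = \<eta> ^ 5" "\<eta> ^ 24 = \<eta> ^ 3" using red[of 5 1] red[of 3 3] by simp_all
    ultimately show ?thesis using pE[of 6] sE
      by (subst (asm) Tr\<tau>) (simp_all add: red1(3) \<tau>_mult \<tau>_pow \<tau>\<eta> b_def c_def power_mult[symmetric])
  qed
  define u where "u = \<eta> ^ 2 - \<eta> ^ 5"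
  have uE: "u \<in> E" using pE by (simp add: u_def)
  have \<tau>u: "\<tau> u = \<eta> ^ 4 - \<eta> ^ 3"
    unfolding u_def using pE by (simp add: \<tau>_diff \<tau>_pow \<tau>\<eta> power_mult[symmetric] red1)
  have \<tau>\<tau>u: "\<tau> (\<tau> u) = \<eta> - \<eta> ^ 6"
    unfolding \<tau>u using pE by (simp add: \<tau>_diff \<tau>_pow \<tau>\<eta> power_mult[symmetric] red1)
  have u0: "u \<noteq> 0"
  proof
    assume "u = 0"
    hence "\<eta> ^ 5 = \<eta> ^ 2 * e" using pE[of 2] by (simp add: u_def)
    hence "\<eta> ^ 2 * \<eta> ^ 3 = \<eta> ^ 2 * e" unfolding power_add[symmetric] by simp
    moreover have "\<eta> ^ 2 \<noteq> 0"
    proof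
      assume "\<eta> ^ 2 = 0"
      hence "\<eta> ^ 2 * \<eta> ^ 5 = 0" by simp
      thus False using \<eta> by (simp add: power_add[symmetric])
    qed
    ultimately have "\<eta> ^ 3 = e" using E.mult_cancel[of "\<eta> ^ 3" e "\<eta> ^ 2"] pE by simp
    hence "\<eta> ^ (3 * 2 + 1) = \<eta> ^ 1" using power_reduce[OF \<eta>(1), of 3 1 2] by simp
    thus False using \<eta> by simp
  qed
  \<comment> \<open>The multiples \<eta>^3 and \<eta>^4 of the two equations are chosen to cancel
    \<open>c\<close>. The result says that s / u is fixed by \<tau>.\<close>
  have rel: "s * \<tau> u = b * u"
  proof -
    have "s * (\<eta> ^ 4 - \<eta> ^ 10) - b * (\<eta> ^ 9 - \<eta> ^ 5) =
        (\<eta> * s + \<eta> ^ 2 * b + \<eta> ^ 4 * c) * \<eta> ^ 3 - (\<eta> ^ 6 * s + \<eta> ^ 5 * b + \<eta> ^ 3 * c) * \<eta> ^ 4"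
      by (simp add: algebra_simps power_add[symmetric])
        (simp add: numeral_eq_Suc algebra_simps)
    hence "s * (\<eta> ^ 4 - \<eta> ^ 3) = b * (\<eta> ^ 2 - \<eta> ^ 5)" unfolding e1 e2 by (simp add: red1)
    thus ?thesis unfolding \<tau>u unfolding u_def .
  qed
  have \<tau>u0: "\<tau> u \<noteq> 0"
  proof
    assume "\<tau> u = 0"
    hence "fr (fr (fr u)) = 0 \<or> fr (fr (fr (fr (fr (fr u))))) = 0" by (auto simp: \<tau>_def split: if_splits)
    thus False using uE u0 by auto
  qed
  define z where "z = E.recip u * s"
  have z: "z \<in> E" "s = u * z" using uE u0 sE by (simp_all add: z_def)
  have "\<tau> z = z"
  proof -
    have "(u * \<tau> u) * z = (u * \<tau> u) * \<tau> z" using rel unfolding b_def z(2) \<tau>_mult by (simp only: mult_ac)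
    thus ?thesis using E.mult_cancel[of z "\<tau> z" "u * \<tau> u"] z uE u0 \<tau>u0 \<tau>_E by auto
  qed
  hence zF: "z \<in> F" using \<tau>_F z by blast
  have z\<tau>: "\<tau> z = z" by fact
  define \<delta> where "\<delta> = u + \<tau> u + \<tau> (\<tau> u)"
  \<comment> \<open>After reduction of exponents modulo 7 the terms \<eta>^7 and -\<eta>^14 cancel,
    and exactly the trace remains. \<delta> is the quadratic Gauss sum modulo 7.\<close>
  have norm_u: "u * \<tau> u * \<tau> (\<tau> u) = \<delta>"
  proof -
    have "(\<eta> ^ 2 - \<eta> ^ 5) * (\<eta> ^ 4 - \<eta> ^ 3) * (\<eta> - \<eta> ^ 6) =
        \<eta> ^ 7 - \<eta> ^ 12 - \<eta> ^ 6 + \<eta> ^ 11 - \<eta> ^ 10 + \<eta> ^ 15 + \<eta> ^ 9 - \<eta> ^ 14"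
      by (simp add: algebra_simps power_add[symmetric]) (simp add: numeral_eq_Suc algebra_simps)
    moreover have "\<eta> ^ 12 = \<eta> ^ 5" "\<eta> ^ 11 = \<eta> ^ 4" "\<eta> ^ 15 = \<eta>" "\<eta> ^ 14 = \<eta> ^ 7"
      using red[of 5 1] red[of 4 1] red[of 1 2] red[of 7 1] by simp_all
    ultimately show ?thesis unfolding \<delta>_def \<tau>\<tau>u unfolding \<tau>u unfolding u_def by (simp add: red1)
  qed
  obtain t where t: "t \<in> F" "Tr (x * y) = 2 * (t * t)" using Tr_P[OF xy] by blast
  have "Tr s = z * \<delta>"
    unfolding Tr\<tau>[OF sE] unfolding z(2) \<tau>_mult z\<tau> \<delta>_def by (simp add: algebra_simps)
  hence "Tr (x * y) = z * \<delta>" by (simp only: s_def[symmetric])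
  hence zd: "z * \<delta> = 2 * (t * t)" using t by simp
  \<comment> \<open>\<eta>^4 is a square root of \<eta>, as \<eta>^8 = \<eta>; so s = \<eta> y^2 is
    the square of \<open>v\<close>.\<close>
  define v where "v = \<eta> ^ 4 * y"
  have vE: "v \<in> E" using pE xy by (simp add: v_def)
  have vv: "v * v = s"
  proof -
    have "v * v = \<eta> ^ 8 * (y * y)" by (simp add: v_def numeral_eq_Suc mult_ac)
    thus ?thesis by (simp add: red1 s_def eq mult_ac)
  qed
  \<comment> \<open>The norm of \<open>v\<close> to \<open>F\<close>; its square is the norm of s =
    u z.\<close>
  define m where "m = v * \<tau> v * \<tau> (\<tau> v)"
  have \<tau>3: "\<tau> (\<tau> (\<tau> v)) = v" using vE by (simp add: \<tau>_def)
  have mF: "m \<in> F"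
    by (rule \<tau>_F) (use vE \<tau>_E in \<open>simp_all add: m_def \<tau>_mult \<tau>3 mult_ac\<close>)
  have "m * m = (v * v) * \<tau> (v * v) * \<tau> (\<tau> (v * v))" by (simp add: m_def \<tau>_mult mult_ac)
  also have "\<dots> = (u * \<tau> u * \<tau> (\<tau> u)) * (z * z * z)" unfolding vv z(2) \<tau>_mult z\<tau> by (simp only: mult_ac)
  also have "\<dots> = (z * \<delta>) * (z * z)" unfolding norm_u by (simp only: mult_ac)
  also have "\<dots> = 2 * ((z * t) * (z * t))" unfolding zd by (simp add: mult_ac)
  finally have mm: "m * m = 2 * ((z * t) * (z * t))" .
  have "v \<noteq> 0" using vv sE xy P_nonzero by (auto simp: s_def)
  have \<tau>0: "a = 0" if "a \<in> E" "\<tau> a = 0" for a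
  proof -
    have "\<tau> (\<tau> (\<tau> a)) = a" using that(1) by (simp add: \<tau>_def)
    moreover have "\<tau> 0 = 0" by (simp add: \<tau>_def)
    ultimately show ?thesis using that(2) by metis
  qed
  have "\<tau> v \<noteq> 0" using \<tau>0[OF vE] \<open>v \<noteq> 0\<close> by blast
  moreover have "\<tau> (\<tau> v) \<noteq> 0" using \<tau>0[OF \<tau>_E[OF vE]] calculation by blast
  ultimately have m0: "m \<noteq> 0"
    unfolding m_def using \<open>v \<noteq> 0\<close> vE \<tau>_E[OF vE] \<tau>_E[OF \<tau>_E[OF vE]] by simp
  have zt: "z * t \<noteq> 0"
  proof
    assume "z * t = 0"
    hence "m * m = 0" using mm by simp
    thus False using m0 mF by simp
  qed
  define w where "w = F.recip (z * t)"
  have w: "w \<in> F" "(z * t) * w = e" using zt zF t by (simp_all add: w_def)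
  have "(m * w) * (m * w) = (m * m) * (w * w)" by (simp only: mult_ac)
  also have "\<dots> = 2 * (((z * t) * w) * ((z * t) * w))" unfolding mm by (simp only: mult_ac)
  also have "\<dots> = 2 * e" by (simp add: w)
  finally show False using two_nonsquare[OF two, of "m * w"] mF w by simp
qed

text \<open>q^3 is 1 mod 7, so the seventh roots of unity lie in \<open>E\<close>; a ratio of two
  different ones is again a nontrivial one, and \<open>septic_avoid\<close> excludes it. Exponents
  1..7 let e appear as \<zeta>^7.\<close>

theorem multipliers_7:
  assumes q: "q mod 7 = 2 \<or> q mod 7 = 4" "q mod 8 = 3"
  shows "\<exists>CC\<subseteq>E - {0}. card CC = 7 \<and>
    (\<forall>c\<in>CC. \<forall>d\<in>CC. \<forall>x\<in>P. \<forall>y\<in>P. c * x = d * y \<longrightarrow> c = d)"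
proof -
  have q37: "q ^ 3 mod 7 = 1"
  proof -
    have "q ^ 3 mod 7 = (q mod 7) ^ 3 mod 7" by (simp add: power_mod)
    thus ?thesis using q by auto
  qed
  have "7 dvd n"
  proof -
    have "(q ^ 3) ^ 2 mod 7 = 1" using q37 by (subst power_mod[symmetric]) simp
    hence "q ^ 6 mod 7 = 1" by (simp add: power_mult[symmetric])
    thus ?thesis unfolding n_def by presburger
  qed
  then obtain l where l: "n = 7 * l" by blast
  have l0: "0 < l" using l n_gt_1 by simp
  define \<zeta> where "\<zeta> = \<omega> ^ l"
  have \<zeta>: "\<zeta> \<in> K" using l0 by (simp add: \<zeta>_def)
  have \<zeta>7: "\<zeta> ^ 7 = e" using omega_n l by (simp add: \<zeta>_def power_mult[symmetric] mult.commute)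
  have \<zeta>k: "\<zeta> ^ k \<noteq> e" if "0 < k" "k < 7" for k
  proof
    assume "\<zeta> ^ k = e"
    hence "n dvd l * k" using omega_eq_unit[of "l * k"] l0 that by (simp add: \<zeta>_def power_mult)
    hence "n \<le> l * k" using l0 that by (intro dvd_imp_le) simp_all
    moreover have "l * k < l * 7" using l0 that by simp
    ultimately show False using l by linarith
  qed
  have avoid: "x \<noteq> \<zeta> ^ k * y" if "0 < k" "k < 7" "x \<in> P" "y \<in> P" for k x y
  proof (rule septic_avoid[OF _ _ _ q that(3,4)])
    show "\<zeta> ^ k \<in> K" using \<zeta> that by (intro K.power_mem)
    have "(\<zeta> ^ k) ^ 7 = (\<zeta> ^ 7) ^ k" by (simp add: power_mult[symmetric] mult.commute)
    thus "(\<zeta> ^ k) ^ 7 = e" using that by (simp add: \<zeta>7)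
    show "\<zeta> ^ k \<noteq> e" using \<zeta>k that by simp
  qed
  have pK: "\<zeta> ^ k \<in> K" if "0 < k" for k using \<zeta> that by (rule K.power_mem)
  have \<zeta>nz: "\<zeta> ^ k \<noteq> 0" if "0 < k" for k
    using omega_power_nz[of "l * k"] that l0 by (simp add: \<zeta>_def power_mult)
  have lt: "\<zeta> ^ i * x \<noteq> \<zeta> ^ j * y" if "0 < i" "i < j" "j \<le> 7" "x \<in> P" "y \<in> P" for i j x y
  proof
    assume eq: "\<zeta> ^ i * x = \<zeta> ^ j * y"
    have "\<zeta> ^ j = \<zeta> ^ i * \<zeta> ^ (j - i)" using that by (simp add: power_add[symmetric])
    hence "\<zeta> ^ i * x = \<zeta> ^ i * (\<zeta> ^ (j - i) * y)" using eq by (simp add: mult.assoc)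
    hence "x = \<zeta> ^ (j - i) * y"
      using K.mult_cancel[of x "\<zeta> ^ (j - i) * y" "\<zeta> ^ i"] that pK \<zeta>nz by simp
    thus False using avoid[of "j - i" x y] that by simp
  qed
  have \<zeta>E: "\<zeta> \<in> E"
  proof -
    have "q ^ 3 = 7 * (q ^ 3 div 7) + 1" using q37 by presburger
    hence "bar \<zeta> = \<zeta> ^ (7 * (q ^ 3 div 7) + 1)" by (simp add: bar_def)
    thus ?thesis unfolding E_iff using power_reduce[OF \<zeta> \<zeta>7, of 1] \<zeta> by simp
  qed
  obtain x0 where x0: "x0 \<in> P" using P_nonempty by blast
  have inj: "inj_on (\<lambda>k. \<zeta> ^ k) {1..7}"
  proof (rule inj_onI)
    fix i j :: nat assume ij: "i \<in> {1..7}" "j \<in> {1..7}" "\<zeta> ^ i = \<zeta> ^ j"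
    show "i = j" using lt[of i j x0 x0] lt[of j i x0 x0] ij x0 by (cases i j rule: linorder_cases) auto
  qed
  have "\<forall>c\<in>(\<lambda>k. \<zeta> ^ k) ` {1..7}. \<forall>d\<in>(\<lambda>k. \<zeta> ^ k) ` {1..7}. \<forall>x\<in>P. \<forall>y\<in>P. c * x = d * y \<longrightarrow> c = d"
  proof (intro ballI impI)
    fix c d x y
    assume "c \<in> (\<lambda>k. \<zeta> ^ k) ` {1..7}" "d \<in> (\<lambda>k. \<zeta> ^ k) ` {1..7}" and xy: "x \<in> P" "y \<in> P" "c * x = d * y"
    then obtain i j where ij: "i \<in> {1..7}" "j \<in> {1..7}" "c = \<zeta> ^ i" "d = \<zeta> ^ j" by blast
    thus "c = d" using lt[of i j x y] lt[of j i y x] xy by (cases i j rule: linorder_cases) auto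
  qed
  moreover have "(\<lambda>k. \<zeta> ^ k) ` {1..7} \<subseteq> E - {0}" using E.power_mem[OF \<zeta>E] \<zeta>nz by auto
  moreover have "card ((\<lambda>k. \<zeta> ^ k) ` {1..7}) = 7" unfolding card_image[OF inj] by simp
  ultimately show ?thesis by blast
qed

end

section \<open>Embedding abstract fields and the main theorem\<close>

text \<open>All commutative rings carried by subsets of \<open>'a\<close> embed, without their units, into this one.
  The integer component makes \<open>0 \<noteq> 1\<close> even when every such ring is trivial.\<close>

typedef 'a cring_product =
  "{(m :: int, f :: 'a ring \<Rightarrow> 'a). \<forall>R. if cring R then f R \<in> carrier R else f R = undefined}"
  by (rule exI[of _ "(0, \<lambda>R. if cring R then \<zero>\<^bsub>R\<^esub> else undefined)"])
    (auto simp: cring.cring_simprules)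

setup_lifting type_definition_cring_product

instantiation cring_product :: (type) comm_ring_1
begin

lift_definition zero_cring_product :: "'a cring_product" is
  "(0, \<lambda>R. if cring R then \<zero>\<^bsub>R\<^esub> else undefined)"
  by (auto intro: abelian_monoid.zero_closed simp: cring_def ring_def abelian_group_def)

lift_definition one_cring_product :: "'a cring_product" is
  "(1, \<lambda>R. if cring R then \<one>\<^bsub>R\<^esub> else undefined)"
  by (auto intro: monoid.one_closed simp: cring_def ring_def)

lift_definition plus_cring_product :: "'a cring_product \<Rightarrow> 'a cring_product \<Rightarrow> 'a cring_product" is
  "\<lambda>(m, f) (n, g). (m + n, \<lambda>R. if cring R then f R \<oplus>\<^bsub>R\<^esub> g R else undefined)"
  by (auto split: if_splits intro!: cring.cring_simprules(1))

lift_definition uminus_cring_product :: "'a cring_product \<Rightarrow> 'a cring_product" is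
  "\<lambda>(m, f). (- m, \<lambda>R. if cring R then \<ominus>\<^bsub>R\<^esub> f R else undefined)"
  by (auto split: if_splits intro!: cring.cring_simprules(3))

definition minus_cring_product :: "'a cring_product \<Rightarrow> 'a cring_product \<Rightarrow> 'a cring_product" where
  "minus_cring_product x y = x + - y"

lift_definition times_cring_product :: "'a cring_product \<Rightarrow> 'a cring_product \<Rightarrow> 'a cring_product" is
  "\<lambda>(m, f) (n, g). (m * n, \<lambda>R. if cring R then f R \<otimes>\<^bsub>R\<^esub> g R else undefined)"
  by (auto split: if_splits intro!: cring.cring_simprules(5))

instance
proof
  fix a b c :: "'a cring_product"
  show "a + b + c = a + (b + c)"
    by transfer (auto simp: fun_eq_iff cring.cring_simprules split: if_splits)
  show "a + b = b + a"
    by transfer (auto simp: fun_eq_iff cring.cring_simprules split: if_splits)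
  show "0 + a = a"
    by transfer (force simp: fun_eq_iff cring.cring_simprules)
  show "- a + a = 0"
    by transfer (auto simp: fun_eq_iff cring.cring_simprules split: if_splits)
  show "a - b = a + - b" by (simp add: minus_cring_product_def)
  show "a * b * c = a * (b * c)"
    by transfer (auto simp: fun_eq_iff cring.cring_simprules split: if_splits)
  show "a * b = b * a"
    by transfer (auto simp: fun_eq_iff cring.cring_simprules split: if_splits)
  show "1 * a = a"
    by transfer (clarsimp simp: fun_eq_iff, metis cring.cring_simprules(12))
  show "(a + b) * c = a * c + b * c"
    by transfer (auto simp: fun_eq_iff cring.cring_simprules algebra_simps split: if_splits)
  show "(0::'a cring_product) \<noteq> 1" by transfer auto
qed

end

text \<open>The element sits in the component of \<open>L\<close> and is zero in all others. Sums
  and products are respected but the unit is not: its image is the idempotent that serves as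
  \<open>e\<close>.\<close>

definition embed :: "'a ring \<Rightarrow> 'a \<Rightarrow> 'a cring_product" where
  "embed L x = Abs_cring_product
     (0, \<lambda>R. if R = L then x else if cring R then \<zero>\<^bsub>R\<^esub> else undefined)"

lemma Rep_embed:
  assumes "cring L" "x \<in> carrier L"
  shows "Rep_cring_product (embed L x) = (0, \<lambda>R. if R = L then x else if cring R then \<zero>\<^bsub>R\<^esub> else undefined)"
  unfolding embed_def using assms
  by (intro Abs_cring_product_inverse) (auto intro: cring.cring_simprules)

lemma embed_inj: "cring L \<Longrightarrow> inj_on (embed L) (carrier L)"
  by (rule inj_onI) (metis (mono_tags, lifting) Rep_embed prod.inject)

lemma embed_zero: "cring L \<Longrightarrow> embed L \<zero>\<^bsub>L\<^esub> = 0"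
  by (auto simp: Rep_cring_product_inject[symmetric] Rep_embed zero_cring_product.rep_eq
      fun_eq_iff cring.cring_simprules)

lemma embed_add:
  "cring L \<Longrightarrow> x \<in> carrier L \<Longrightarrow> y \<in> carrier L \<Longrightarrow> embed L (x \<oplus>\<^bsub>L\<^esub> y) = embed L x + embed L y"
  by (auto simp: Rep_cring_product_inject[symmetric] Rep_embed plus_cring_product.rep_eq
      fun_eq_iff cring.cring_simprules)

lemma embed_mult:
  "cring L \<Longrightarrow> x \<in> carrier L \<Longrightarrow> y \<in> carrier L \<Longrightarrow> embed L (x \<otimes>\<^bsub>L\<^esub> y) = embed L x * embed L y"
  by (auto simp: Rep_cring_product_inject[symmetric] Rep_embed times_cring_product.rep_eq
      fun_eq_iff cring.cring_simprules)

text \<open>The components of the product ring are indexed by plain ring records, so a record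
  extension of the given field has to be dropped before embedding.\<close>

lemma (in cring) cring_truncate: "cring (ring.truncate R)"
proof -
  have "abelian_group (ring.truncate R)"
    by (rule abelian_groupI) (auto simp: ring.truncate_def a_ac intro: l_neg a_inv_closed)
  moreover have "comm_monoid (ring.truncate R)"
    by (rule comm_monoidI) (auto simp: ring.truncate_def m_ac)
  ultimately show ?thesis by (rule cringI) (auto simp: ring.truncate_def l_distr)
qed

lemma (in field_tower) exists_negative_latin_square_difference_set:
  assumes q: "q mod 24 = 7 \<and> M = 3 \<or> (q mod 7 = 2 \<or> q mod 7 = 4) \<and> q mod 8 = 3 \<and> M = 7"
    and r: "2 * r = M * (q ^ 2 - 1)"
  shows "\<exists>D\<subseteq>K. 0 \<notin> D \<and> (\<forall>x\<in>D. - x \<in> D) \<and> card D = r * (q ^ 3 + 1) \<and>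
    (\<forall>a\<in>K. a \<noteq> 0 \<longrightarrow> int (card {d \<in> D. d - a \<in> D}) =
      int r ^ 2 + int r + (if a \<in> D then 2 * int r - int (q ^ 3) else 0))"
proof -
  obtain \<psi> where \<psi>: "additive_character F e \<psi>"
    using F.exists_character[OF prime_p p_mult[OF K.unit_mem]] by blast
  interpret field_tower_character K e p f q \<omega> \<psi>
    by (intro field_tower_character.intro field_tower_character_axioms.intro field_tower_axioms)
      (rule \<psi>[unfolded F_def])
  obtain i where i: "i \<in> K" "i * i = - e" "bar i = - i" by (rule imaginary_unit)
  obtain \<nu> where nu: "\<nu> \<in> K" "N \<nu> = - e"
    "\<forall>b\<in>K. b \<noteq> 0 \<longrightarrow> (\<exists>z\<in>K. b = z * z \<or> b = \<nu> * (z * z))" using nonsquare by blast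
  obtain A C where AC: "A \<in> E" "C \<in> E" "Tr (A * A) = 0" "Tr (C * C) = 0" "Tr (A * C) = 2 * e"
    by (rule hyperbolic_pair)
  interpret hemisystem K e p f q \<omega> \<psi> i \<nu> A C
    by unfold_locales (fact i nu(1,2) nu(3)[rule_format] AC)+
  have "\<exists>CC\<subseteq>E - {0}. card CC = M \<and>
    (\<forall>c\<in>CC. \<forall>d\<in>CC. \<forall>x\<in>P. \<forall>y\<in>P. c * x = d * y \<longrightarrow> c = d)"
    using q
  proof (elim disjE conjE)
    assume "q mod 24 = 7" and M: "M = 3"
    thus ?thesis unfolding M by (intro multipliers_3)
  next
    assume "q mod 7 = 2" "q mod 8 = 3" and M: "M = 7"
    thus ?thesis unfolding M by (intro multipliers_7 disjI1)
  next
    assume "q mod 7 = 4" "q mod 8 = 3" and M: "M = 7"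
    thus ?thesis unfolding M by (intro multipliers_7 disjI2)
  qed
  then obtain CC where CC: "CC \<subseteq> E - {0}" "card CC = M"
    "\<forall>c\<in>CC. \<forall>d\<in>CC. \<forall>x\<in>P. \<forall>y\<in>P. c * x = d * y \<longrightarrow> c = d" by (elim exE conjE)
  show ?thesis
  proof (rule exists_difference_set[OF CC(1)])
    show "c = d" if "c \<in> CC" "d \<in> CC" "x \<in> P" "y \<in> P" "c * x = d * y" for c d x y
      using CC(3) that by blast
    show "2 * r = card CC * (q ^ 2 - 1)" unfolding CC(2) by (rule r)
  qed
qed

text \<open>For fixed x the bijection z -> h x - h z carries the neighbours of x to
  \<open>D\<close>, and the common neighbours of x and y to those d in \<open>D\<close> with d - (h
  x - h y) in \<open>D\<close>.\<close>

lemma strongly_regular_cayley_graph: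
  fixes K :: "('a, 'm) ring_scheme" and h :: "'a \<Rightarrow> 'b::ab_group_add"
  assumes K: "abelian_group K" and fin: "finite (carrier K)"
    and inj: "inj_on h (carrier K)"
    and h_minus: "\<And>x y. x \<in> carrier K \<Longrightarrow> y \<in> carrier K \<Longrightarrow> h (x \<ominus>\<^bsub>K\<^esub> y) = h x - h y"
    and D: "D \<subseteq> h ` carrier K" "0 \<notin> D" "\<And>d. d \<in> D \<Longrightarrow> - d \<in> D"
    and count: "\<And>a. a \<in> h ` carrier K \<Longrightarrow> a \<noteq> 0 \<Longrightarrow>
      int (card {d \<in> D. d - a \<in> D}) = (if a \<in> D then l else m)"
  shows "\<exists>\<Gamma>. cayley_graph_on K \<Gamma> \<and>
    strongly_regular \<Gamma> (int (card (carrier K)), int (card D), l, m)"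
proof -
  interpret abelian_group K by fact
  define D' where "D' = {x \<in> carrier K. h x \<in> D}"
  define \<Gamma> where "\<Gamma> = cayley_graph K D'"
  have h0: "h \<zero>\<^bsub>K\<^esub> = 0"
    using h_minus[of "\<zero>\<^bsub>K\<^esub>" "\<zero>\<^bsub>K\<^esub>"] r_neg[OF zero_closed] by (simp add: minus_eq)
  have h_neg: "h (\<ominus>\<^bsub>K\<^esub> x) = - h x" if "x \<in> carrier K" for x
    using h_minus[of "\<zero>\<^bsub>K\<^esub>" x] that h0 by (simp add: minus_eq)
  have arc: "(x, y) \<in> parcs \<Gamma> \<longleftrightarrow> x \<in> carrier K \<and> y \<in> carrier K \<and> h x - h y \<in> D" for x y
    by (auto simp: \<Gamma>_def cayley_graph_def D'_def h_minus)
  have verts: "pverts \<Gamma> = carrier K" by (simp add: \<Gamma>_def cayley_graph_def)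
  have bij: "bij_betw (\<lambda>z. h x - h z) (carrier K) (h ` carrier K)" if x: "x \<in> carrier K" for x
  proof -
    have "inj_on (\<lambda>z. h x - h z) (carrier K)" using inj by (auto simp: inj_on_def)
    moreover have "(\<lambda>z. h x - h z) ` carrier K \<subseteq> h ` carrier K"
      by (auto simp: h_minus[OF x, symmetric] x)
    moreover have "card ((\<lambda>z. h x - h z) ` carrier K) = card (h ` carrier K)"
      using calculation(1) inj by (simp add: card_image)
    ultimately show ?thesis using fin by (simp add: bij_betw_def card_subset_eq)
  qed
  have bij': "bij_betw (\<lambda>z. h x - h z) {z \<in> carrier K. Q (h x - h z)} {d \<in> h ` carrier K. Q d}"
    if x: "x \<in> carrier K" for x Q
    using bij[OF x] unfolding bij_betw_def by (auto simp: inj_on_def image_iff) (metis image_iff)+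
  have nb: "card (neighbours \<Gamma> x) = card D" if x: "x \<in> carrier K" for x
  proof -
    have "neighbours \<Gamma> x = {z \<in> carrier K. h x - h z \<in> D}"
      using x by (auto simp: neighbours_def verts arc)
    moreover have "D = {d \<in> h ` carrier K. d \<in> D}" using D by blast
    ultimately show ?thesis using bij_betw_same_card[OF bij'[OF x, of "\<lambda>d. d \<in> D"]] by simp
  qed
  have cn: "int (card (neighbours \<Gamma> x \<inter> neighbours \<Gamma> y)) = (if (x, y) \<in> parcs \<Gamma> then l else m)"
    if xy: "x \<in> carrier K" "y \<in> carrier K" "x \<noteq> y" for x y
  proof -
    have "neighbours \<Gamma> x \<inter> neighbours \<Gamma> y =
        {z \<in> carrier K. h x - h z \<in> D \<and> h x - h z - (h x - h y) \<in> D}"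
      using xy by (auto simp: neighbours_def verts arc)
    moreover have "{d \<in> D. d - (h x - h y) \<in> D} = {d \<in> h ` carrier K. d \<in> D \<and> d - (h x - h y) \<in> D}"
      using D by blast
    ultimately have "card (neighbours \<Gamma> x \<inter> neighbours \<Gamma> y) = card {d \<in> D. d - (h x - h y) \<in> D}"
      using bij_betw_same_card[OF bij'[OF xy(1), of "\<lambda>d. d \<in> D \<and> d - (h x - h y) \<in> D"]] by simp
    moreover have "h x - h y \<in> h ` carrier K" using h_minus[OF xy(1,2)] minus_closed[OF xy(1,2)] by force
    moreover have "h x - h y \<noteq> 0" using inj_onD[OF inj] xy by auto
    ultimately show ?thesis using count[of "h x - h y"] arc xy by simp
  qed
  have "pair_graph \<Gamma>"
  proof
    show "fst a \<in> pverts \<Gamma>" "snd a \<in> pverts \<Gamma>" if "a \<in> parcs \<Gamma>" for a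
      using that arc by (cases a; simp add: verts)+
    show "finite (pverts \<Gamma>)" by (simp add: verts fin)
    have "parcs \<Gamma> \<subseteq> carrier K \<times> carrier K" using arc by auto
    thus "finite (parcs \<Gamma>)" by (rule finite_subset) (simp add: fin)
    show "fst a \<noteq> snd a" if "a \<in> parcs \<Gamma>" for a
      using that arc[of "fst a" "snd a"] D(2) by auto
    have "(y, x) \<in> parcs \<Gamma>" if "(x, y) \<in> parcs \<Gamma>" for x y
      using that D(3)[of "h x - h y"] by (simp add: arc)
    thus "symmetric (with_proj \<Gamma>)" by (auto simp: symmetric_def sym_def)
  qed
  hence "strongly_regular \<Gamma> (int (card (carrier K)), int (card D), l, m)"
    by (auto simp: strongly_regular_def verts nb cn)
  moreover have "cayley_graph_on K \<Gamma>"
    unfolding cayley_graph_on_def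
  proof (intro conjI exI[of _ D'])
    show "D' \<subseteq> carrier K - {\<zero>\<^bsub>K\<^esub>}" using D(2) h0 by (auto simp: D'_def)
    have neg: "\<ominus>\<^bsub>K\<^esub> x \<in> D'" if "x \<in> D'" for x using that D(3) h_neg by (auto simp: D'_def)
    have "x = \<ominus>\<^bsub>K\<^esub> (\<ominus>\<^bsub>K\<^esub> x)" if "x \<in> D'" for x using that by (simp add: D'_def)
    thus "(\<lambda>d. \<ominus>\<^bsub>K\<^esub> d) ` D' = D'" using neg by blast
  qed (use K fin in \<open>simp_all add: \<Gamma>_def\<close>)
  ultimately show ?thesis by blast
qed

theorem theorem1p1:
  fixes q M r :: nat
    and K :: "('a, 'm) ring_scheme"
  assumes "primepow q"
    and "M > 0"
    and "(M = 3 \<and> [q = 7] (mod 24)) \<or>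
         (M = 7 \<and> ([q = 11] (mod 56) \<or> [q = 51] (mod 56)))"
    and "r = M * (q\<^sup>2 - 1) div 2"
    and "field K"
    and "finite (carrier K)"
    and "card (carrier K) = q ^ 6"
  shows "\<exists>\<Gamma> params.
           params = (int q ^ 6,
                     int r * (int q ^ 3 + 1),
                     - (int q ^ 3) + (int r)\<^sup>2 + 3 * int r,
                     (int r)\<^sup>2 + int r) \<and>
           negative_latin_square_type params \<and>
           cayley_graph_on K \<Gamma> \<and>
           strongly_regular \<Gamma> params"
proof -
  interpret field K by fact
  define L where "L = ring.truncate K"
  have L: "carrier L = carrier K" "\<one>\<^bsub>L\<^esub> = \<one>\<^bsub>K\<^esub>" "\<zero>\<^bsub>L\<^esub> = \<zero>\<^bsub>K\<^esub>"
    "x \<oplus>\<^bsub>L\<^esub> y = x \<oplus>\<^bsub>K\<^esub> y" "x \<otimes>\<^bsub>L\<^esub> y = x \<otimes>\<^bsub>K\<^esub> y" for x y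
    by (simp_all add: L_def ring.truncate_def)
  have cL: "cring L" unfolding L_def by (rule cring_truncate)
  define h where "h = embed L"
  have inj: "inj_on h (carrier K)" using embed_inj[OF cL] by (simp add: h_def L)
  have h0: "h \<zero>\<^bsub>K\<^esub> = 0" using embed_zero[OF cL] by (simp add: h_def L)
  have h_add: "h (x \<oplus>\<^bsub>K\<^esub> y) = h x + h y" if "x \<in> carrier K" "y \<in> carrier K" for x y
    using embed_add[OF cL, of x y] that by (simp add: h_def L)
  have h_mult: "h (x \<otimes>\<^bsub>K\<^esub> y) = h x * h y" if "x \<in> carrier K" "y \<in> carrier K" for x y
    using embed_mult[OF cL, of x y] that by (simp add: h_def L)
  have h_neg: "h (\<ominus>\<^bsub>K\<^esub> x) = - h x" if "x \<in> carrier K" for x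
    using h_add[of x "\<ominus>\<^bsub>K\<^esub> x"] that by (simp add: r_neg h0 add_eq_0_iff)
  have h_minus: "h (x \<ominus>\<^bsub>K\<^esub> y) = h x - h y" if "x \<in> carrier K" "y \<in> carrier K" for x y
    using that by (simp add: minus_eq h_add h_neg)
  have h_eq_0: "h x = 0 \<longleftrightarrow> x = \<zero>\<^bsub>K\<^esub>" if "x \<in> carrier K" for x
    using inj_on_eq_iff[OF inj that zero_closed] h0 by simp
  define S where "S = h ` carrier K"
  define e where "e = h \<one>\<^bsub>K\<^esub>"
  interpret S: finite_subfield S e
  proof
    show "finite S" using assms by (simp add: S_def)
    show "0 \<in> S" unfolding S_def using h0 by (metis imageI zero_closed)
    show "e \<in> S" by (simp add: S_def e_def)
    show "e \<noteq> 0" unfolding e_def using h_eq_0[OF one_closed] by simp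
    show "x + y \<in> S" "x * y \<in> S" if xy: "x \<in> S" "y \<in> S" for x y
    proof -
      obtain u v where uv: "x = h u" "y = h v" "u \<in> carrier K" "v \<in> carrier K" using xy by (auto simp: S_def)
      show "x + y \<in> S" "x * y \<in> S"
        unfolding S_def uv h_add[OF uv(3,4), symmetric] h_mult[OF uv(3,4), symmetric] using uv by simp_all
    qed
    show "- x \<in> S" if "x \<in> S" for x using that h_neg[symmetric] by (auto simp: S_def)
    show "e * x = x" if "x \<in> S" for x using that by (auto simp: S_def e_def h_mult[symmetric])
    show "\<exists>y\<in>S. x * y = e" if x: "x \<in> S" "x \<noteq> 0" for x
    proof -
      obtain u where u: "x = h u" "u \<in> carrier K" using x by (auto simp: S_def)
      hence "u \<in> Units K" using x h0 by (auto simp: field_Units)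
      hence "inv\<^bsub>K\<^esub> u \<in> carrier K" "u \<otimes>\<^bsub>K\<^esub> inv\<^bsub>K\<^esub> u = \<one>\<^bsub>K\<^esub>" by simp_all
      thus ?thesis using u h_mult[of u "inv\<^bsub>K\<^esub> u"] by (auto simp: S_def e_def)
    qed
  qed
  obtain a where a: "a \<in> carrier (mult_of K)" "carrier (mult_of K) = {a [^]\<^bsub>K\<^esub> i | i::nat. i \<in> UNIV}"
    using finite_field_mult_group_has_gen[OF assms(6)] by blast
  have aK: "a \<in> carrier K" using a by simp
  \<comment> \<open>At i = 0 the factor \<open>e\<close> makes the right side the image of the
    unit.\<close>
  have h_pow: "h (a [^]\<^bsub>K\<^esub> i) = e * h a ^ i" for i :: nat
  proof (induction i)
    case (Suc i)
    have "h (a [^]\<^bsub>K\<^esub> Suc i) = h (a [^]\<^bsub>K\<^esub> i) * h a" using aK by (simp add: h_mult)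
    thus ?case by (simp add: Suc.IH mult_ac)
  qed (simp add: e_def)
  obtain p k where pk: "prime p" "k > 0" "q = p ^ k" using assms(1) by (auto simp: primepow_def)
  \<comment> \<open>11 and 51 are the residues modulo 56 that are 3 mod 8 and, respectively, 4 and 2
    mod 7.\<close>
  have modq: "q mod 24 = 7 \<and> M = 3 \<or> (q mod 7 = 2 \<or> q mod 7 = 4) \<and> q mod 8 = 3 \<and> M = 7"
    using assms(3) mod_mod_cancel[of 7 56 q] mod_mod_cancel[of 8 56 q] by (auto simp: Cong.cong_def)
  have q4: "q mod 4 = 3"
    using modq mod_mod_cancel[of 4 24 q] mod_mod_cancel[of 4 8 q] by auto
  interpret field_tower S e p k q "h a"
  proof
    show "card S = q ^ 6" unfolding S_def card_image[OF inj] by (rule assms)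
    show "h a \<in> S" using aK by (simp add: S_def)
    show "\<exists>i. x = e * h a ^ i" if x: "x \<in> S" "x \<noteq> 0" for x
    proof -
      obtain u where u: "x = h u" "u \<in> carrier K" using x by (auto simp: S_def)
      hence "u \<in> carrier (mult_of K)" using x h0 by auto
      then obtain i :: nat where "u = a [^]\<^bsub>K\<^esub> i" using a by blast
      thus ?thesis using u h_pow by blast
    qed
  qed (use pk q4 in auto)
  \<comment> \<open>Oddness of q makes the division by 2 in the definition of \<open>r\<close>
    exact.\<close>
  have "odd q" by (rule odd_q)
  hence "even (M * (q ^ 2 - 1))" by simp
  hence r: "2 * r = M * (q ^ 2 - 1)" unfolding assms(4) by simp
  obtain D where D: "D \<subseteq> S" "0 \<notin> D" "\<And>x. x \<in> D \<Longrightarrow> - x \<in> D" "card D = r * (q ^ 3 + 1)"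
    "\<And>a. a \<in> S \<Longrightarrow> a \<noteq> 0 \<Longrightarrow> int (card {d \<in> D. d - a \<in> D}) =
      int r ^ 2 + int r + (if a \<in> D then 2 * int r - int (q ^ 3) else 0)"
    using exists_negative_latin_square_difference_set[OF modq r] by blast
  have count: "int (card {d \<in> D. d - a \<in> D}) =
      (if a \<in> D then - (int q ^ 3) + (int r)\<^sup>2 + 3 * int r else (int r)\<^sup>2 + int r)"
    if "a \<in> S" "a \<noteq> 0" for a using D(5)[OF that] by simp
  obtain \<Gamma> where \<Gamma>: "cayley_graph_on K \<Gamma>" "strongly_regular \<Gamma> (int (card (carrier K)), int (card D),
      - (int q ^ 3) + (int r)\<^sup>2 + 3 * int r, (int r)\<^sup>2 + int r)"
    using strongly_regular_cayley_graph[OF _ assms(6) inj h_minus D(1)[unfolded S_def] D(2,3)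
        count[unfolded S_def]] abelian_group_axioms by blast
  have "negative_latin_square_type (int q ^ 6, int r * (int q ^ 3 + 1),
      - (int q ^ 3) + (int r)\<^sup>2 + 3 * int r, (int r)\<^sup>2 + int r)"
    unfolding negative_latin_square_type_def latin_square_params_def
    by (intro exI[of _ "q ^ 3"] exI[of _ r]) (simp add: power_mult[symmetric])
  moreover have "int (card (carrier K)) = int q ^ 6" "int (card D) = int r * (int q ^ 3 + 1)"
    using assms(7) D(4) by (simp_all add: algebra_simps)
  ultimately show ?thesis using \<Gamma> by (intro exI[of _ \<Gamma>] exI conjI) (rule refl, simp_all)
qed

end
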